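(* Let $n > 1$, and let $\varphi_1, \varphi_2 \in H^{\infty}(\mathbb{D}^n)$ be non-constant inner functions. Then the truncated Toeplitz operator $T^{\varphi_1}_{\varphi_2}$ on $\mathcal{Q}_{\varphi_1}$ is a partial isometry if and only if there exist inner functions $\tilde{\varphi}_1, \tilde{\varphi}_2, \psi \in H^{\infty}(\mathbb{D}^n)$ such that $\tilde{\varphi}_1$ and $\tilde{\varphi}_2$ are separated and $$\varphi_1 = \tilde{\varphi}_1 \psi \quad \text{and} \quad \varphi_2 = \tilde{\varphi}_2 \psi.$$
   Context: $\mathbb{D}^n$ is the open unit polydisc in $\mathbb{C}^n$ and $\mathbb{T}^n$ its distinguished boundary. $H^\infty(\mathbb{D}^n)$ is the algebra of bounded analytic functions on $\mathbb{D}^n$. $H^2(\mathbb{D}^n)$ is the Hardy space of analytic functions $f$ on $\mathbb{D}^n$ with $\|f\|^2 = \sup_{0 \le r < 1} \int_{\mathbb{T}^n} |f(rz_1,\ldots,rz_n)|^2\, dm(z) < \infty$, where $m$ is normalized Lebesgue measure on $\mathbb{T}^n$. A function $\varphi \in H^\infty(\mathbb{D}^n)$ is inner if its radial boundary values satisfy $|\varphi(z)| = 1$ for almost every $z \in \mathbb{T}^n$. For an inner function $\varphi$, the model space is $\mathcal{Q}_\varphi = H^2(\mathbb{D}^n) \ominus \varphi H^2(\mathbb{D}^n)$. For inner functions $\varphi_1, \varphi_2$, the truncated Toeplitz operator $T^{\varphi_1}_{\varphi_2} : \mathcal{Q}_{\varphi_1} \to \mathcal{Q}_{\varphi_1}$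 is defined by $T^{\varphi_1}_{\varphi_2} f = P_{\mathcal{Q}_{\varphi_1}}(\varphi_2 f)$, where $P_{\mathcal{Q}_{\varphi_1}}$ is the orthogonal projection onto $\mathcal{Q}_{\varphi_1}$. A bounded operator $T$ is a partial isometry if $T|_{(\ker T)^\perp}$ is an isometry. Two functions on $\mathbb{D}^n$ are separated if they do not depend on common variables, i.e. no coordinate $z_i$ is such that both functions depend on $z_i$. *)

theory Defs
  imports "HOL-Analysis.Analysis"
begin

definition polydisc :: "(complex ^ 'n) set" where
  "polydisc = {z. \<forall>i. cmod (z $ i) < 1}"

text \<open>Analyticity in several variables: Frechet differentiability with complex-linear derivative.\<close>

definition analytic_polydisc :: "(complex ^ 'n \<Rightarrow> complex) \<Rightarrow> bool" where
  "analytic_polydisc f \<longleftrightarrow>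
     (\<forall>z\<in>polydisc. \<exists>D. (f has_derivative D) (at z) \<and> (\<forall>c v. D (c *s v) = c * D v))"

text \<open>
  Normalized Lebesgue measure on the torus, as a Borel measure on the whole space:
  the image of Lebesgue measure on the unit cube under
  \<open>t \<mapsto> (exp (2 \<pi> i t\<^sub>j))\<^sub>j\<close>.
\<close>

definition torus_measure :: "(complex ^ 'n) measure" where
  "torus_measure =
     distr (uniform_measure lborel (cbox 0 1 :: (real ^ 'n) set)) borel
       (\<lambda>t. \<chi> j. cis (2 * pi * t $ j))"

definition hardy_infinity :: "(complex ^ 'n \<Rightarrow> complex) set" where
  "hardy_infinity = {f. analytic_polydisc f \<and> bounded (f ` polydisc)}"

definition radial_mean :: "(complex ^ 'n \<Rightarrow> complex) \<Rightarrow> real \<Rightarrow> real" where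
  "radial_mean f r = (\<integral>z. (cmod (f (r *\<^sub>R z)))\<^sup>2 \<partial>torus_measure)"

text \<open>
  Elements of the Hardy space are functions on the polydisc. They are represented by their
  extension by zero to the whole type, so that each element has exactly one representative;
  this matters for the uniqueness of orthogonal projections.
\<close>

definition hardy2 :: "(complex ^ 'n \<Rightarrow> complex) set" where
  "hardy2 = {f. analytic_polydisc f \<and> (\<forall>z. z \<notin> polydisc \<longrightarrow> f z = 0)
                \<and> bdd_above (radial_mean f ` {0..<1})}"

definition hardy_norm :: "(complex ^ 'n \<Rightarrow> complex) \<Rightarrow> real" where
  "hardy_norm f = sqrt (SUP r\<in>{0..<1}. radial_mean f r)"

text \<open>
  The inner product inducing \<^const>\<open>hardy_norm\<close>, recovered by polarization;
  it is linear in the first argument.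
\<close>

definition hardy_inner :: "(complex ^ 'n \<Rightarrow> complex) \<Rightarrow> (complex ^ 'n \<Rightarrow> complex) \<Rightarrow> complex" where
  "hardy_inner f g =
     (\<Sum>k<4. \<i> ^ k * complex_of_real ((hardy_norm (\<lambda>z. f z + \<i> ^ k * g z))\<^sup>2)) / 4"

definition inner_function :: "(complex ^ 'n \<Rightarrow> complex) \<Rightarrow> bool" where
  "inner_function \<phi> \<longleftrightarrow> \<phi> \<in> hardy_infinity \<and>
     (AE z in torus_measure. \<exists>w. ((\<lambda>r. \<phi> (r *\<^sub>R z)) \<longlongrightarrow> w) (at_left 1) \<and> cmod w = 1)"

definition model_space :: "(complex ^ 'n \<Rightarrow> complex) \<Rightarrow> (complex ^ 'n \<Rightarrow> complex) set" where
  "model_space \<phi> = {f \<in> hardy2. \<forall>g\<in>hardy2. hardy_inner f (\<lambda>z. \<phi> z * g z) = 0}"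

definition hardy_projection ::
    "(complex ^ 'n \<Rightarrow> complex) set \<Rightarrow> (complex ^ 'n \<Rightarrow> complex) \<Rightarrow> (complex ^ 'n \<Rightarrow> complex)" where
  "hardy_projection S f = (THE q. q \<in> S \<and> (\<forall>s\<in>S. hardy_inner (\<lambda>z. f z - q z) s = 0))"

definition truncated_toeplitz ::
    "(complex ^ 'n \<Rightarrow> complex) \<Rightarrow> (complex ^ 'n \<Rightarrow> complex) \<Rightarrow>
     (complex ^ 'n \<Rightarrow> complex) \<Rightarrow> (complex ^ 'n \<Rightarrow> complex)" where
  "truncated_toeplitz \<phi>1 \<phi>2 f = hardy_projection (model_space \<phi>1) (\<lambda>z. \<phi>2 z * f z)"

definition bounded_operator_on ::
    "(complex ^ 'n \<Rightarrow> complex) set \<Rightarrow> ((complex ^ 'n \<Rightarrow> complex) \<Rightarrow> (complex ^ 'n \<Rightarrow> complex)) \<Rightarrow> bool" where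
  "bounded_operator_on S T \<longleftrightarrow>
     (\<forall>f\<in>S. T f \<in> S) \<and>
     (\<forall>f\<in>S. \<forall>g\<in>S. T (\<lambda>z. f z + g z) = (\<lambda>z. T f z + T g z)) \<and>
     (\<forall>c. \<forall>f\<in>S. T (\<lambda>z. c * f z) = (\<lambda>z. c * T f z)) \<and>
     (\<exists>K. \<forall>f\<in>S. hardy_norm (T f) \<le> K * hardy_norm f)"

definition kernel_on ::
    "(complex ^ 'n \<Rightarrow> complex) set \<Rightarrow> ((complex ^ 'n \<Rightarrow> complex) \<Rightarrow> (complex ^ 'n \<Rightarrow> complex)) \<Rightarrow>
     (complex ^ 'n \<Rightarrow> complex) set" where
  "kernel_on S T = {f \<in> S. T f = (\<lambda>z. 0)}"

definition partial_isometry_on ::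
    "(complex ^ 'n \<Rightarrow> complex) set \<Rightarrow> ((complex ^ 'n \<Rightarrow> complex) \<Rightarrow> (complex ^ 'n \<Rightarrow> complex)) \<Rightarrow> bool" where
  "partial_isometry_on S T \<longleftrightarrow> bounded_operator_on S T \<and>
     (\<forall>f\<in>S. (\<forall>g\<in>kernel_on S T. hardy_inner f g = 0) \<longrightarrow> hardy_norm (T f) = hardy_norm f)"

definition depends_on_coordinate :: "(complex ^ 'n \<Rightarrow> complex) \<Rightarrow> 'n \<Rightarrow> bool" where
  "depends_on_coordinate f i \<longleftrightarrow>
     (\<exists>z\<in>polydisc. \<exists>w\<in>polydisc. (\<forall>j. j \<noteq> i \<longrightarrow> z $ j = w $ j) \<and> f z \<noteq> f w)"

definition separated :: "(complex ^ 'n \<Rightarrow> complex) \<Rightarrow> (complex ^ 'n \<Rightarrow> complex) \<Rightarrow> bool" where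
  "separated f g \<longleftrightarrow> \<not> (\<exists>i. depends_on_coordinate f i \<and> depends_on_coordinate g i)"

end

theory Submission
  imports Defs "HOL-Complex_Analysis.Cauchy_Integral_Formula" "HOL-Probability.Probability_Measure"
    "HOL-Library.Function_Algebras"
begin

text \<open>
  Taylor coefficients identify the Hardy space with the square-summable families on \<open>\<int>\<^sup>n\<close> that are
  supported in the cone \<open>\<nat>\<^sup>n\<close>. The ambient space \<open>\<ell>\<^sup>2(\<int>\<^sup>n)\<close> plays the role of \<open>L\<^sup>2\<close> of the torus; let \<open>P\<close>
  be the projection onto the families supported in the cone. Multiplication by an inner function
  becomes convolution with a family \<open>p\<close> whose translates are orthonormal (\<open>uni p\<close>: the symbol has modulus
  one). These convolutions form a commutative group of unitary operators, so one can divide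
  by inner functions as freely as on the torus.

  \<^bold>\<open>Reduction to commuting projections.\<close> Let \<open>p\<close> and \<open>q\<close> be the symbols of \<open>\<phi>1\<close> and \<open>\<phi>2\<close>, and let \<open>T\<close> be the
  truncated Toeplitz operator. Then \<open>T T\<^sup>*\<close> is the compression to the model space of the projection onto
  \<open>\<phi>2 H\<^sup>2\<close>. The operator \<open>T\<close> is a partial isometry iff this compression is idempotent, and that happens iff
  the projections onto \<open>\<phi>1 H\<^sup>2\<close> and \<open>\<phi>2 H\<^sup>2\<close> commute (\<open>partial_isometry_iff_commute\<close>). Conjugating by \<open>\<phi>1\<close>, this
  says that \<open>P\<close> commutes with \<open>w P w\<^sup>-\<^sup>1\<close>, where \<open>w\<close> is the quotient of \<open>\<phi>2\<close> by \<open>\<phi>1\<close> on the torus.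

  \<^bold>\<open>Separation of variables.\<close> Suppose that \<open>P\<close> and \<open>w P w\<^sup>-\<^sup>1\<close> commute. If \<open>w\<close> has a negative power of \<open>z\<^sub>i\<close>,
  then \<open>H\<^sup>2 \<inter> w H\<^sup>2\<close> contains some \<open>g \<noteq> 0\<close> that does not depend on \<open>z\<^sub>i\<close>, and \<open>w\<^sup>-\<^sup>1 g\<close> is analytic. If \<open>g\<close> had
  modulus one, one could divide by it and conclude that \<open>w\<^sup>-\<^sup>1\<close> is analytic in \<open>z\<^sub>i\<close>. The argument of
  Helson and Lowdenslager replaces \<open>g\<close> by such a function (\<open>unimodular_in_invariant_subspace\<close>). Hence each variable
  occurs in \<open>w\<close> only with nonnegative or only with nonpositive powers (\<open>coordinate_sign\<close>). Let \<open>J\<close> be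
  the set of variables of the first kind. A suitable monomial yields nonzero analytic functions \<open>a\<close> and \<open>c\<close> with
  \<open>w c = a\<close> such that \<open>a\<close> depends on the variables in \<open>J\<close> only and \<open>c\<close> on the others only. As
  \<open>\<bar>a\<bar> = \<bar>c\<bar>\<close> on the torus, both moduli are constant, and normalizing them gives \<open>w = v / u\<close> with separated \<open>u\<close> and
  \<open>v\<close> (\<open>separated_symbols\<close>). Then \<open>\<psi> = \<phi>1 / u = \<phi>2 / v\<close> is analytic in the variables outside \<open>J\<close> because
  of its second form and in those of \<open>J\<close> because of its first (\<open>separated_factorization\<close>). Conversely, for
  separated \<open>u\<close> and \<open>v\<close> the projection \<open>P\<close> splits into two commuting coordinate projections, one of which
  commutes with \<open>u\<close> and the other with \<open>v\<close> (\<open>separated_imp_commute\<close>).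

  \<^bold>\<open>Back to functions.\<close> A symbol of modulus one belongs to an inner function only if radial limits exist
  almost everywhere. They are inherited from \<open>\<phi>1\<close> and \<open>\<phi>2\<close>: since \<open>v(r z') / u(r z)\<close> converges as \<open>r \<rightarrow> 1\<close> for
  almost all pairs \<open>(z, z')\<close>, one can fix \<open>z\<close> and recover the limit of \<open>1 / u(r z)\<close> by integrating
  over \<open>z'\<close> (\<open>separated_factors_radial_limits\<close>).
\<close>

section \<open>Square-summable families\<close>

typedef 'a ell2 = "{f :: 'a \<Rightarrow> complex. (\<lambda>x. (cmod (f x))\<^sup>2) summable_on UNIV}"
  morphisms coef Ell2
  by (rule exI[of _ "\<lambda>_. 0"]) simp

setup_lifting type_definition_ell2

lemma coef_square_summable: "(\<lambda>x. (cmod (coef f x))\<^sup>2) summable_on UNIV"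
  using coef[of f] by simp

lemma ell2_eqI: "(\<And>x. coef f x = coef g x) \<Longrightarrow> f = g"
  by (simp add: coef_inject[symmetric] ext)

lemma square_summable_add:
  assumes "(\<lambda>x. (cmod (f x))\<^sup>2) summable_on UNIV" "(\<lambda>x. (cmod (g x))\<^sup>2) summable_on UNIV"
  shows "(\<lambda>x. (cmod (f x + g x))\<^sup>2) summable_on UNIV"
proof (rule summable_on_comparison_test)
  show "(\<lambda>x. 2 * (cmod (f x))\<^sup>2 + 2 * (cmod (g x))\<^sup>2) summable_on UNIV"
    by (intro summable_on_add summable_on_cmult_right assms)
  show "(cmod (f x + g x))\<^sup>2 \<le> 2 * (cmod (f x))\<^sup>2 + 2 * (cmod (g x))\<^sup>2" for x
  proof -
    have "(cmod (f x + g x))\<^sup>2 \<le> (cmod (f x) + cmod (g x))\<^sup>2"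
      by (intro power_mono norm_triangle_ineq norm_ge_zero)
    also have "\<dots> \<le> 2 * (cmod (f x))\<^sup>2 + 2 * (cmod (g x))\<^sup>2"
      using sum_squares_bound[of "cmod (f x)" "cmod (g x)"] by (simp add: power2_sum)
    finally show ?thesis .
  qed
qed simp

lemma square_summable_cmult:
  assumes "(\<lambda>x. (cmod (f x))\<^sup>2) summable_on UNIV"
  shows "(\<lambda>x. (cmod (c * f x))\<^sup>2) summable_on UNIV"
  using summable_on_cmult_right[OF assms, of "(cmod c)\<^sup>2"] by (simp add: norm_mult power_mult_distrib)

lift_definition cscale :: "complex \<Rightarrow> 'a ell2 \<Rightarrow> 'a ell2" is "\<lambda>c f x. c * f x"
  using square_summable_cmult by auto

lift_definition cinner :: "'a ell2 \<Rightarrow> 'a ell2 \<Rightarrow> complex" is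
  "\<lambda>f g. \<Sum>\<^sub>\<infinity>x. f x * cnj (g x)" .

instantiation ell2 :: (type) real_vector
begin

lift_definition zero_ell2 :: "'a ell2" is "\<lambda>_. 0" by simp

lift_definition plus_ell2 :: "'a ell2 \<Rightarrow> 'a ell2 \<Rightarrow> 'a ell2" is "\<lambda>f g x. f x + g x"
  using square_summable_add by auto

lift_definition uminus_ell2 :: "'a ell2 \<Rightarrow> 'a ell2" is "\<lambda>f x. - f x" by simp

lift_definition minus_ell2 :: "'a ell2 \<Rightarrow> 'a ell2 \<Rightarrow> 'a ell2" is "\<lambda>f g x. f x - g x"
proof -
  fix f g :: "'a \<Rightarrow> complex"
  assume "(\<lambda>x. (cmod (f x))\<^sup>2) summable_on UNIV" "(\<lambda>x. (cmod (g x))\<^sup>2) summable_on UNIV"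
  then show "(\<lambda>x. (cmod (f x - g x))\<^sup>2) summable_on UNIV"
    using square_summable_add[of f "\<lambda>x. - g x"] by simp
qed

lift_definition scaleR_ell2 :: "real \<Rightarrow> 'a ell2 \<Rightarrow> 'a ell2" is "\<lambda>r f x. complex_of_real r * f x"
  using square_summable_cmult by auto

instance
  by standard
    (auto intro!: ell2_eqI simp: zero_ell2.rep_eq plus_ell2.rep_eq uminus_ell2.rep_eq
      minus_ell2.rep_eq scaleR_ell2.rep_eq algebra_simps)

end

lemma coef_simps [simp]:
  "coef 0 x = 0" "coef (f + g) x = coef f x + coef g x" "coef (- f) x = - coef f x"
  "coef (f - g) x = coef f x - coef g x" "coef (r *\<^sub>R f) x = of_real r * coef f x"
  "coef (cscale c f) x = c * coef f x"
  by (simp_all add: zero_ell2.rep_eq plus_ell2.rep_eq uminus_ell2.rep_eq minus_ell2.rep_eq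
      scaleR_ell2.rep_eq cscale.rep_eq)

lemma coef_product_summable: "(\<lambda>x. coef f x * cnj (coef g x)) summable_on UNIV"
proof (rule abs_summable_summable, rule summable_on_comparison_test)
  show "(\<lambda>x. (cmod (coef f x))\<^sup>2 + (cmod (coef g x))\<^sup>2) summable_on UNIV"
    by (intro summable_on_add coef_square_summable)
  show "norm (coef f x * cnj (coef g x)) \<le> (cmod (coef f x))\<^sup>2 + (cmod (coef g x))\<^sup>2" for x
  proof -
    have "2 * cmod (coef f x) * cmod (coef g x) \<le> (cmod (coef f x))\<^sup>2 + (cmod (coef g x))\<^sup>2"
      by (rule sum_squares_bound)
    moreover have "0 \<le> cmod (coef f x) * cmod (coef g x)" by simp
    ultimately have "cmod (coef f x) * cmod (coef g x) \<le> (cmod (coef f x))\<^sup>2 + (cmod (coef g x))\<^sup>2"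
      by linarith
    then show ?thesis by (simp add: norm_mult)
  qed
qed simp

lemma cinner_infsum: "cinner f g = (\<Sum>\<^sub>\<infinity>x. coef f x * cnj (coef g x))"
  by (simp add: cinner.rep_eq)

lemma cinner_add_left: "cinner (f + g) h = cinner f h + cinner g h"
  unfolding cinner_infsum coef_simps distrib_right by (intro infsum_add coef_product_summable)

lemma cinner_scale_left: "cinner (cscale c f) h = c * cinner f h"
  unfolding cinner_infsum coef_simps mult.assoc by (rule infsum_cmult_right')

lemma cinner_commute: "cinner f g = cnj (cinner g f)"
  unfolding cinner_infsum infsum_cnj[symmetric] by (simp add: mult.commute)

lemma cinner_self: "cinner f f = of_real (\<Sum>\<^sub>\<infinity>x. (cmod (coef f x))\<^sup>2)"
proof -
  have "((\<lambda>x. complex_of_real ((cmod (coef f x))\<^sup>2)) has_sum of_real (\<Sum>\<^sub>\<infinity>x. (cmod (coef f x))\<^sup>2)) UNIV"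
    by (intro has_sum_of_real has_sum_infsum coef_square_summable)
  then show ?thesis
    unfolding cinner_infsum complex_norm_square by (rule infsumI)
qed

lemma cscale_of_real: "cscale (of_real r) f = r *\<^sub>R f"
  by (rule ell2_eqI) simp

instantiation ell2 :: (type) real_inner
begin

definition inner_ell2 :: "'a ell2 \<Rightarrow> 'a ell2 \<Rightarrow> real" where
  "inner_ell2 f g = Re (cinner f g)"

definition norm_ell2 :: "'a ell2 \<Rightarrow> real" where
  "norm_ell2 f = sqrt (inner f f)"

definition dist_ell2 :: "'a ell2 \<Rightarrow> 'a ell2 \<Rightarrow> real" where
  "dist_ell2 f g = norm (f - g)"

definition sgn_ell2 :: "'a ell2 \<Rightarrow> 'a ell2" where
  "sgn_ell2 f = inverse (norm f) *\<^sub>R f"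

definition uniformity_ell2 :: "('a ell2 \<times> 'a ell2) filter" where
  "uniformity_ell2 = (INF e\<in>{0<..}. principal {(x, y). dist x y < e})"

definition open_ell2 :: "'a ell2 set \<Rightarrow> bool" where
  "open_ell2 U \<longleftrightarrow> (\<forall>x\<in>U. eventually (\<lambda>(x', y). x' = x \<longrightarrow> y \<in> U) uniformity)"

instance
proof
  fix f g h :: "'a ell2" and r :: real and U :: "'a ell2 set"
  show "dist f g = norm (f - g)" by (rule dist_ell2_def)
  show "sgn f = f /\<^sub>R norm f" by (rule sgn_ell2_def)
  show "uniformity = (INF e\<in>{0<..}. principal {(x, y :: 'a ell2). dist x y < e})"
    by (rule uniformity_ell2_def)
  show "open U = (\<forall>x\<in>U. \<forall>\<^sub>F (x', y) in uniformity. x' = x \<longrightarrow> y \<in> U)" by (rule open_ell2_def)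
  show "inner f g = inner g f"
    unfolding inner_ell2_def by (subst cinner_commute) simp
  show "inner (f + g) h = inner f h + inner g h"
    by (simp add: inner_ell2_def cinner_add_left)
  show "inner (r *\<^sub>R f) g = r * inner f g"
    by (simp add: inner_ell2_def cinner_scale_left flip: cscale_of_real)
  have *: "inner f f = (\<Sum>\<^sub>\<infinity>x. (cmod (coef f x))\<^sup>2)"
    by (simp add: inner_ell2_def cinner_self)
  show "0 \<le> inner f f" unfolding * by (intro infsum_nonneg) simp
  show "inner f f = 0 \<longleftrightarrow> f = 0"
  proof
    assume "inner f f = 0"
    then have "(cmod (coef f x))\<^sup>2 = 0" for x
      unfolding * by (intro nonneg_infsum_le_0D[OF _ coef_square_summable]) auto
    then show "f = 0" by (intro ell2_eqI) simp
  next
    assume "f = 0"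
    then show "inner f f = 0" unfolding * by simp
  qed
  show "norm f = sqrt (inner f f)" by (rule norm_ell2_def)
qed

end

lemma norm_ell2_square: "(norm f)\<^sup>2 = (\<Sum>\<^sub>\<infinity>x. (cmod (coef f x))\<^sup>2)" for f :: "'a ell2"
  by (simp add: power2_norm_eq_inner inner_ell2_def cinner_self)

lemma cinner_self_norm: "cinner f f = of_real ((norm f)\<^sup>2)"
  by (simp add: norm_ell2_square cinner_self)

lemma cscale_simps [simp]:
  "cscale c (f + g) = cscale c f + cscale c g" "cscale c (f - g) = cscale c f - cscale c g"
  "cscale (c + d) f = cscale c f + cscale d f" "cscale c (cscale d f) = cscale (c * d) f"
  "cscale 1 f = f" "cscale 0 f = 0" "cscale c 0 = 0" "cscale c (r *\<^sub>R f) = r *\<^sub>R cscale c f"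
  "cscale c (- f) = - cscale c f"
  by (auto intro!: ell2_eqI simp: algebra_simps)

lemma cinner_simps:
  "cinner (f + g) h = cinner f h + cinner g h" "cinner h (f + g) = cinner h f + cinner h g"
  "cinner (f - g) h = cinner f h - cinner g h" "cinner h (f - g) = cinner h f - cinner h g"
  "cinner (cscale c f) h = c * cinner f h" "cinner h (cscale c f) = cnj c * cinner h f"
  "cinner (r *\<^sub>R f) h = of_real r * cinner f h" "cinner h (r *\<^sub>R f) = of_real r * cinner h f"
  "cinner 0 h = 0" "cinner h 0 = 0" "cinner (- f) h = - cinner f h" "cinner h (- f) = - cinner h f"
proof -
  have neg: "cinner (- f) h = - cinner f h" for f h :: "'a ell2"
    using cinner_scale_left[of "-1" f h] cscale_of_real[of "-1" f] by simp
  have sc: "cinner (r *\<^sub>R f) h = of_real r * cinner f h" for r and f h :: "'a ell2"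
    by (simp add: cinner_scale_left flip: cscale_of_real)
  have sub: "cinner (f - g) h = cinner f h - cinner g h" for f g h :: "'a ell2"
    by (simp add: cinner_add_left neg diff_conv_add_uminus del: add_uminus_conv_diff)
  show "cinner (f + g) h = cinner f h + cinner g h" "cinner (f - g) h = cinner f h - cinner g h"
    "cinner (cscale c f) h = c * cinner f h" "cinner (r *\<^sub>R f) h = of_real r * cinner f h"
    "cinner (- f) h = - cinner f h" "cinner 0 h = 0"
    using sc[of 0 0 h] by (simp_all add: cinner_add_left cinner_scale_left neg sc sub)
  show "cinner h (f + g) = cinner h f + cinner h g" "cinner h (f - g) = cinner h f - cinner h g"
    "cinner h (cscale c f) = cnj c * cinner h f" "cinner h (r *\<^sub>R f) = of_real r * cinner h f"
    "cinner h (- f) = - cinner h f" "cinner h 0 = 0"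
    using sc[of 0 0 h]
    by (simp_all add: cinner_commute[of h] cinner_add_left cinner_scale_left neg sc sub)
qed

lemma cinner_sum_left: "cinner (sum f A) h = (\<Sum>x\<in>A. cinner (f x) h)"
  by (induction A rule: infinite_finite_induct) (auto simp: cinner_simps)

lemma cinner_sum_right: "cinner h (sum f A) = (\<Sum>x\<in>A. cinner h (f x))"
  by (induction A rule: infinite_finite_induct) (auto simp: cinner_simps)

lemma cinner_eq_inner: "cinner f g = Complex (inner f g) (inner f (cscale \<i> g))"
  by (simp add: inner_ell2_def cinner_simps complex_eq_iff)

lemma norm_cscale [simp]: "norm (cscale c f) = cmod c * norm f"
proof -
  have "(norm (cscale c f))\<^sup>2 = (cmod c * norm f)\<^sup>2"
    by (simp add: norm_ell2_square norm_mult power_mult_distrib infsum_cmult_right')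
  then show ?thesis by (simp add: power2_eq_iff_nonneg)
qed

lemma cinner_bound: "cmod (cinner f g) \<le> norm f * norm g"
proof (cases "cinner f g = 0")
  case False
  define u where "u = cnj (cinner f g) / cmod (cinner f g)"
  have "cmod (cinner f g) = Re (cinner (cscale u f) g)"
    using False by (simp add: u_def cinner_simps complex_norm_square[symmetric] power2_eq_square mult.commute)
  also have "\<dots> = inner (cscale u f) g" by (simp add: inner_ell2_def)
  also have "\<dots> \<le> norm (cscale u f) * norm g" by (rule norm_cauchy_schwarz)
  also have "norm (cscale u f) = norm f" using False by (simp add: u_def norm_divide)
  finally show ?thesis .
qed simp

lemma coef_bound: "cmod (coef f x) \<le> norm f"
proof -
  have "(cmod (coef f x))\<^sup>2 \<le> (norm f)\<^sup>2"
    using finite_sum_le_infsum[OF coef_square_summable, of "{x}" f] by (simp add: norm_ell2_square)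
  then show ?thesis by (rule power2_le_imp_le) simp
qed

text \<open>Membership and the norm bound are established together from finite partial sums, which is the form in
  which completeness, Bessel's inequality and the power series expansion supply them.\<close>

lemma ell2_memI:
  assumes "\<And>F. finite F \<Longrightarrow> (\<Sum>x\<in>F. (cmod (g x))\<^sup>2) \<le> B\<^sup>2" "0 \<le> B"
  shows "coef (Ell2 g) = g" "norm (Ell2 g) \<le> B"
proof -
  have "(\<lambda>x. (cmod (g x))\<^sup>2) summable_on UNIV"
    by (rule nonneg_bdd_above_summable_on) (auto intro!: bdd_aboveI[where M = "B\<^sup>2"] assms)
  then show *: "coef (Ell2 g) = g" by (simp add: Ell2_inverse)
  have "(norm (Ell2 g))\<^sup>2 \<le> B\<^sup>2"
    unfolding norm_ell2_square
    by (rule infsum_le_finite_sums[OF coef_square_summable]) (simp add: * assms)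
  then show "norm (Ell2 g) \<le> B" using assms(2) by (rule power2_le_imp_le)
qed

instance ell2 :: (type) complete_space
proof
  fix X :: "nat \<Rightarrow> 'a ell2"
  assume X: "Cauchy X"
  have "Cauchy (\<lambda>n. coef (X n) x)" for x
    by (rule CauchyI) (metis CauchyD[OF X] coef_bound coef_simps(4) order_le_less_trans)
  then have "\<forall>x. \<exists>l. (\<lambda>n. coef (X n) x) \<longlonglongrightarrow> l" by (simp add: Cauchy_convergent_iff convergent_def)
  then obtain l where l: "\<And>x. (\<lambda>n. coef (X n) x) \<longlonglongrightarrow> l x" by metis
  have tail: "coef (Ell2 (\<lambda>x. l x - coef (X n) x)) = (\<lambda>x. l x - coef (X n) x) \<and>
      norm (Ell2 (\<lambda>x. l x - coef (X n) x)) \<le> e"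
    if e: "0 < e" and N: "\<And>m n. m \<ge> N \<Longrightarrow> n \<ge> N \<Longrightarrow> norm (X m - X n) < e" and n: "n \<ge> N" for e N n
  proof -
    have "(\<Sum>x\<in>F. (cmod (l x - coef (X n) x))\<^sup>2) \<le> e\<^sup>2" if F: "finite F" for F
    proof (rule LIMSEQ_le_const2)
      show "(\<lambda>m. \<Sum>x\<in>F. (cmod (coef (X m) x - coef (X n) x))\<^sup>2) \<longlonglongrightarrow> (\<Sum>x\<in>F. (cmod (l x - coef (X n) x))\<^sup>2)"
        by (intro tendsto_intros l)
      have "(\<Sum>x\<in>F. (cmod (coef (X m) x - coef (X n) x))\<^sup>2) \<le> e\<^sup>2" if "m \<ge> N" for m
      proof -
        have "(\<Sum>x\<in>F. (cmod (coef (X m - X n) x))\<^sup>2) \<le> (norm (X m - X n))\<^sup>2"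
          unfolding norm_ell2_square by (intro finite_sum_le_infsum coef_square_summable F) auto
        also have "\<dots> \<le> e\<^sup>2" using N[OF that n] by (intro power_mono) auto
        finally show ?thesis by simp
      qed
      then show "\<exists>N. \<forall>m\<ge>N. (\<Sum>x\<in>F. (cmod (coef (X m) x - coef (X n) x))\<^sup>2) \<le> e\<^sup>2" by blast
    qed
    from ell2_memI[OF this] e show ?thesis by auto
  qed
  obtain N where N: "\<And>m n. m \<ge> N \<Longrightarrow> n \<ge> N \<Longrightarrow> norm (X m - X n) < 1" using CauchyD[OF X, of 1] by auto
  define L where "L = Ell2 (\<lambda>x. l x - coef (X N) x) + X N"
  have L: "coef L = l" using tail[OF _ N, of N] by (auto simp: L_def)
  have eq: "Ell2 (\<lambda>x. l x - coef (X n) x) = L - X n" if "n \<ge> N" for n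
    using tail[OF _ N that] by (intro ell2_eqI) (simp add: L)
  have "X \<longlonglongrightarrow> L"
  proof (rule LIMSEQ_I)
    fix e :: real assume "0 < e"
    then have "0 < e / 2" by simp
    from CauchyD[OF X this] obtain M where M: "\<And>m n. m \<ge> M \<Longrightarrow> n \<ge> M \<Longrightarrow> norm (X m - X n) < e / 2" by blast
    have "norm (X n - L) < e" if "n \<ge> max M N" for n
    proof -
      have "norm (L - X n) \<le> e / 2"
        using tail[OF \<open>0 < e / 2\<close> M, of M n] eq[of n] that by auto
      then show ?thesis using \<open>0 < e\<close> by (simp only: norm_minus_commute[of "X n"])
    qed
    then show "\<exists>no. \<forall>n\<ge>no. norm (X n - L) < e" by blast
  qed
  then show "convergent X" by (auto simp: convergent_def)
qed

lift_definition delta :: "'a \<Rightarrow> 'a ell2" is "\<lambda>a x. if x = a then 1 else 0"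
proof -
  fix a :: 'a
  show "(\<lambda>x. (cmod (if x = a then 1 else 0))\<^sup>2) summable_on UNIV"
    by (rule finite_nonzero_values_imp_summable_on) simp
qed

lemma coef_delta [simp]: "coef (delta a) x = (if x = a then 1 else 0)"
  by (simp add: delta.rep_eq)

lift_definition restr :: "'a set \<Rightarrow> 'a ell2 \<Rightarrow> 'a ell2" is "\<lambda>A f x. if x \<in> A then f x else 0"
proof -
  fix A and f :: "'a \<Rightarrow> complex"
  assume "(\<lambda>x. (cmod (f x))\<^sup>2) summable_on UNIV"
  then show "(\<lambda>x. (cmod (if x \<in> A then f x else 0))\<^sup>2) summable_on UNIV"
    by (rule summable_on_comparison_test) auto
qed

lemma coef_restr [simp]: "coef (restr A f) x = (if x \<in> A then coef f x else 0)"
  by (simp add: restr.rep_eq)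

lemma cinner_delta [simp]: "cinner f (delta a) = coef f a" "cinner (delta a) f = cnj (coef f a)"
proof -
  have "cinner f (delta a) = (\<Sum>\<^sub>\<infinity>x\<in>{a}. coef f x)"
    unfolding cinner_infsum by (rule infsum_cong_neutral) auto
  then show "cinner f (delta a) = coef f a" by simp
  then show "cinner (delta a) f = cnj (coef f a)" by (subst cinner_commute) simp
qed

lemma norm_delta [simp]: "norm (delta a) = 1"
proof -
  have "complex_of_real ((norm (delta a))\<^sup>2) = 1"
    unfolding cinner_self_norm[symmetric] by simp
  then show ?thesis using norm_ge_zero[of "delta a"] by (simp add: power2_eq_1_iff del: of_real_power)
qed

lemma restr_simps [simp]:
  "restr A (f + g) = restr A f + restr A g" "restr A (f - g) = restr A f - restr A g"
  "restr A (cscale c f) = cscale c (restr A f)" "restr A (r *\<^sub>R f) = r *\<^sub>R restr A f"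
  "restr A (restr B f) = restr (A \<inter> B) f" "restr UNIV f = f" "restr A 0 = 0" "restr {} f = 0"
  by (auto intro!: ell2_eqI)

lemma cinner_restr: "cinner (restr A f) g = cinner f (restr A g)"
  unfolding cinner_infsum by (rule infsum_cong) simp

lemma norm_restr_le: "norm (restr A f) \<le> norm f"
proof -
  have "(norm (restr A f))\<^sup>2 \<le> (norm f)\<^sup>2"
    unfolding norm_ell2_square
    by (rule infsum_mono[OF coef_square_summable coef_square_summable]) auto
  then show ?thesis by (rule power2_le_imp_le) simp
qed

lemma bounded_linear_restr: "bounded_linear (restr A)"
  by (rule bounded_linear_intro[where K = 1]) (auto simp: norm_restr_le)

lemma bounded_linear_cinner_left: "bounded_linear (\<lambda>f. cinner f g)"
  by (rule bounded_linear_intro[where K = "norm g"])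
    (auto simp: cinner_simps cinner_bound scaleR_conv_of_real)

lemma restr_finite: "finite F \<Longrightarrow> restr F f = (\<Sum>a\<in>F. cscale (coef f a) (delta a))"
proof (induction F rule: finite_induct)
  case (insert a F)
  have "restr (insert a F) f = cscale (coef f a) (delta a) + restr F f"
    using insert.hyps by (intro ell2_eqI) auto
  then show ?case using insert by simp
qed simp

lemma restr_tendsto: "((\<lambda>F. restr F f) \<longlongrightarrow> f) (finite_subsets_at_top UNIV)"
proof (rule tendstoI)
  fix e :: real assume e: "0 < e"
  let ?s = "\<lambda>x. (cmod (coef f x))\<^sup>2"
  have "(sum ?s \<longlongrightarrow> infsum ?s UNIV) (finite_subsets_at_top UNIV)"
    by (rule infsum_tendsto[OF coef_square_summable])
  from tendstoD[OF this, of "e\<^sup>2"] e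
  have "\<forall>\<^sub>F F in finite_subsets_at_top UNIV. dist (sum ?s F) (infsum ?s UNIV) < e\<^sup>2" by simp
  moreover have "\<forall>\<^sub>F F in finite_subsets_at_top UNIV. finite (F :: 'a set)"
    by (rule eventually_finite_subsets_at_top_weakI)
  ultimately show "\<forall>\<^sub>F F in finite_subsets_at_top UNIV. dist (restr F f) f < e"
  proof eventually_elim
    case (elim F)
    have "(norm f)\<^sup>2 = (norm (restr F f))\<^sup>2 + (norm (f - restr F f))\<^sup>2"
    proof -
      have "cinner (f - restr F f) (restr F f) = 0"
        by (simp add: cinner_restr[symmetric] cinner_simps cinner_restr)
      then have "inner (f - restr F f) (restr F f) = 0" by (simp add: inner_ell2_def)
      then show ?thesis
        by (simp add: power2_norm_eq_inner inner_diff_left inner_diff_right inner_commute)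
    qed
    moreover have "(norm (restr F f))\<^sup>2 = sum ?s F"
    proof -
      have "(norm (restr F f))\<^sup>2 = (\<Sum>\<^sub>\<infinity>x\<in>F. ?s x)"
        unfolding norm_ell2_square by (rule infsum_cong_neutral) auto
      then show ?thesis using elim by simp
    qed
    ultimately have "(norm (f - restr F f))\<^sup>2 < e\<^sup>2"
      using elim by (simp add: norm_ell2_square dist_real_def abs_less_iff)
    then have "norm (f - restr F f) < e" using e by (simp add: power_less_imp_less_base)
    then show ?case by (simp add: dist_norm norm_minus_commute)
  qed
qed

text \<open>Finitely supported families are dense, so a continuous linear map is determined by its
  values on the complex multiples of the unit vectors.\<close>

lemma closed_subspace_eq_UNIV:
  assumes "closed S" "0 \<in> S" "\<And>f g. f \<in> S \<Longrightarrow> g \<in> S \<Longrightarrow> f + g \<in> S" "\<And>c a. a \<in> A \<Longrightarrow> cscale c (delta a) \<in> S"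
    and "\<And>x. x \<notin> A \<Longrightarrow> coef f x = 0"
  shows "f \<in> S"
proof (rule Lim_in_closed_set[OF assms(1) _ _ restr_tendsto])
  have "restr F f \<in> S" if "finite F" for F
  proof -
    have "(\<Sum>a\<in>F. cscale (coef f a) (delta a)) \<in> S"
      using that by (induction F rule: finite_induct) (use assms in \<open>auto split: if_splits\<close>,
          metis add_0 assms(4,5) cscale_simps(6))
    then show ?thesis using restr_finite[OF that] by metis
  qed
  then show "\<forall>\<^sub>F F in finite_subsets_at_top UNIV. restr F f \<in> S"
    by (intro eventually_finite_subsets_at_top_weakI)
qed simp

lemma bounded_linear_eqI:
  assumes "bounded_linear X" "bounded_linear Y"
    and "\<And>c a. a \<in> A \<Longrightarrow> X (cscale c (delta a)) = Y (cscale c (delta a))"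
    and "\<And>x. x \<notin> A \<Longrightarrow> coef f x = 0"
  shows "X f = Y f"
proof -
  interpret X: bounded_linear X by fact
  interpret Y: bounded_linear Y by fact
  have "f \<in> {g. X g = Y g}"
  proof (rule closed_subspace_eq_UNIV[where A = A])
    show "closed {g. X g = Y g}"
      by (intro closed_Collect_eq linear_continuous_on assms)
  qed (use assms in \<open>auto simp: X.add Y.add X.zero Y.zero\<close>)
  then show ?thesis by simp
qed

section \<open>Orthogonal projection in Hilbert spaces\<close>

text \<open>A sequence in \<open>S\<close> whose distances to \<open>x\<close> approach the infimum converges by the parallelogram law, and its limit,
  a nearest point, is the projection.\<close>

lemma orthogonal_projection_exists:
  fixes S :: "'b :: {real_inner, complete_space} set"
  assumes S: "closed S" "subspace S"
  shows "\<exists>p\<in>S. \<forall>s\<in>S. inner (x - p) s = 0"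
proof -
  define d where "d = Inf ((\<lambda>s. (norm (x - s))\<^sup>2) ` S)"
  have bdd: "bdd_below ((\<lambda>s. (norm (x - s))\<^sup>2) ` S)" by (rule bdd_belowI[of _ 0]) auto
  have ne: "S \<noteq> {}" using subspace_0[OF S(2)] by auto
  have d: "d \<le> (norm (x - s))\<^sup>2" if "s \<in> S" for s
    unfolding d_def using bdd that by (intro cInf_lower) auto
  have "\<exists>s\<in>S. (norm (x - s))\<^sup>2 < d + inverse (real (Suc n))" for n
    using cInf_lessD[of "(\<lambda>s. (norm (x - s))\<^sup>2) ` S" "d + inverse (real (Suc n))"] ne
    by (auto simp: d_def)
  then obtain s where s: "\<And>n. s n \<in> S" "\<And>n. (norm (x - s n))\<^sup>2 < d + inverse (real (Suc n))"
    by metis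
  \<comment> \<open>The parallelogram law makes a minimizing sequence Cauchy.\<close>
  have par: "(norm (s m - s n))\<^sup>2 \<le> 2 * inverse (real (Suc m)) + 2 * inverse (real (Suc n))" for m n
  proof -
    have "(1/2) *\<^sub>R (s m + s n) \<in> S" using S(2) s(1) by (simp add: subspace_add subspace_scale)
    from d[OF this] have "4 * d \<le> 4 * (norm (x - (1/2) *\<^sub>R (s m + s n)))\<^sup>2" by simp
    also have "\<dots> = 2 * (norm (x - s m))\<^sup>2 + 2 * (norm (x - s n))\<^sup>2 - (norm (s m - s n))\<^sup>2"
      by (simp add: power2_norm_eq_inner inner_diff_left inner_diff_right inner_add_left
          inner_add_right inner_commute algebra_simps)
    finally show ?thesis using s(2)[of m] s(2)[of n] by linarith
  qed
  have "Cauchy s"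
  proof (rule CauchyI)
    fix e :: real assume "0 < e"
    then have "0 < e\<^sup>2 / 4" by simp
    then obtain M where M: "inverse (real (Suc M)) < e\<^sup>2 / 4" using reals_Archimedean by blast
    have "norm (s m - s n) < e" if "m \<ge> M" "n \<ge> M" for m n
    proof -
      have "inverse (real (Suc k)) < e\<^sup>2 / 4" if "k \<ge> M" for k
        using M that by (smt (verit, best) inverse_le_iff_le of_nat_0_less_iff of_nat_le_iff zero_less_Suc Suc_le_mono)
      from this[OF that(1)] this[OF that(2)] par[of m n] have "(norm (s m - s n))\<^sup>2 < e\<^sup>2" by linarith
      then show ?thesis using \<open>0 < e\<close> by (simp add: power_less_imp_less_base)
    qed
    then show "\<exists>M. \<forall>m\<ge>M. \<forall>n\<ge>M. norm (s m - s n) < e" by blast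
  qed
  then obtain p where p: "s \<longlonglongrightarrow> p" by (auto simp: Cauchy_convergent_iff convergent_def)
  have pS: "p \<in> S" using closed_sequentially[OF S(1) _ p] s(1) by blast
  have "(norm (x - p))\<^sup>2 \<le> d"
  proof (rule LIMSEQ_le)
    show "(\<lambda>n. (norm (x - s n))\<^sup>2) \<longlonglongrightarrow> (norm (x - p))\<^sup>2" by (intro tendsto_intros p)
    show "(\<lambda>n. d + inverse (real (Suc n))) \<longlonglongrightarrow> d"
      using LIMSEQ_inverse_real_of_nat_add[of d] by simp
    show "\<exists>N. \<forall>n\<ge>N. (norm (x - s n))\<^sup>2 \<le> d + inverse (real (Suc n))" using s(2) less_imp_le by blast
  qed
  have "inner (x - p) t = 0" if t: "t \<in> S" for t
  proof (cases "t = 0")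
    case False
    define c where "c = inner (x - p) t / (norm t)\<^sup>2"
    have "d \<le> (norm (x - (p + c *\<^sub>R t)))\<^sup>2"
      using d[of "p + c *\<^sub>R t"] pS t S(2) by (simp add: subspace_add subspace_scale)
    also have "\<dots> = (norm (x - p))\<^sup>2 - 2 * c * inner (x - p) t + c\<^sup>2 * (norm t)\<^sup>2"
      by (simp add: power2_norm_eq_inner inner_diff_left inner_diff_right inner_add_left
          inner_add_right inner_commute algebra_simps power2_eq_square[of c])
    also have "\<dots> = (norm (x - p))\<^sup>2 - (inner (x - p) t)\<^sup>2 / (norm t)\<^sup>2"
      using False by (simp add: c_def field_simps power2_eq_square)
    finally have "(inner (x - p) t)\<^sup>2 / (norm t)\<^sup>2 \<le> 0" using \<open>(norm (x - p))\<^sup>2 \<le> d\<close> by linarith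
    then show ?thesis using False by (simp add: divide_le_0_iff)
  qed simp
  then show ?thesis using pS by blast
qed

section \<open>Unimodular symbols and their Laurent operators\<close>

lift_definition shift :: "'a::ab_group_add \<Rightarrow> 'a ell2 \<Rightarrow> 'a ell2" is "\<lambda>a f x. f (x - a)"
proof -
  fix a :: 'a and f :: "'a \<Rightarrow> complex"
  assume "(\<lambda>x. (cmod (f x))\<^sup>2) summable_on UNIV"
  then show "(\<lambda>x. (cmod (f (x - a)))\<^sup>2) summable_on UNIV"
    by (subst summable_on_reindex_bij_witness[where i = "\<lambda>x. x + a" and j = "\<lambda>x. x - a"
          and T = UNIV and h = "\<lambda>x. (cmod (f x))\<^sup>2"]) auto
qed

lift_definition sharp :: "'a::ab_group_add ell2 \<Rightarrow> 'a ell2" is "\<lambda>f x. cnj (f (- x))"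
proof -
  fix f :: "'a \<Rightarrow> complex"
  assume "(\<lambda>x. (cmod (f x))\<^sup>2) summable_on UNIV"
  then show "(\<lambda>x. (cmod (cnj (f (- x))))\<^sup>2) summable_on UNIV"
    by (subst summable_on_reindex_bij_witness[where i = uminus and j = uminus
          and T = UNIV and h = "\<lambda>x. (cmod (f x))\<^sup>2"]) auto
qed

lemma coef_shift [simp]: "coef (shift a f) x = coef f (x - a)"
  by (simp add: shift.rep_eq)

lemma coef_sharp [simp]: "coef (sharp f) x = cnj (coef f (- x))"
  by (simp add: sharp.rep_eq)

lemma shift_simps [simp]:
  "shift a (shift b f) = shift (a + b) f" "shift 0 f = f" "shift a (delta b) = delta (a + b)"
  "shift a (f + g) = shift a f + shift a g" "shift a (f - g) = shift a f - shift a g"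
  "shift a (cscale c f) = cscale c (shift a f)" "shift a 0 = 0"
  by (auto intro!: ell2_eqI simp: algebra_simps)

lemma sharp_simps [simp]:
  "sharp (sharp f) = f" "sharp (shift a f) = shift (- a) (sharp f)" "sharp (delta 0) = delta 0"
  by (auto intro!: ell2_eqI simp: algebra_simps)

lemma cinner_shift_shift: "cinner (shift a f) (shift a g) = cinner f g"
  unfolding cinner_infsum
  by (rule infsum_reindex_bij_witness[where i = "\<lambda>x. x + a" and j = "\<lambda>x. x - a"]) auto

lemma cinner_shift_left: "cinner (shift a f) g = cinner f (shift (- a) g)"
  using cinner_shift_shift[of a f "shift (- a) g"] by simp

lemma cinner_sharp: "cinner (sharp f) (sharp g) = cinner g f"
  unfolding cinner_infsum
  by (rule infsum_reindex_bij_witness[where i = uminus and j = uminus]) auto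

text \<open>Square-summable families on the group are Fourier coefficients of square-integrable functions on
  the dual group; \<open>uni v\<close> says that the function with coefficients \<open>v\<close> has modulus one almost
  everywhere, and \<open>conv v\<close> is multiplication by that function.\<close>

definition uni :: "'a::ab_group_add ell2 \<Rightarrow> bool" where
  "uni v \<longleftrightarrow> (\<forall>a. cinner (shift a v) v = (if a = 0 then 1 else 0))"

definition conv :: "'a::ab_group_add ell2 \<Rightarrow> 'a ell2 \<Rightarrow> 'a ell2" where
  "conv v f = Ell2 (\<lambda>x. cinner f (shift x (sharp v)))"

lemma uni_sharp [simp]: "uni (sharp v) \<longleftrightarrow> uni v"
proof -
  have "cinner (shift a (sharp v)) (sharp v) = cinner (shift a v) v" for a
    using cinner_sharp[of "shift (- a) v" v] by (simp add: cinner_shift_left)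
  then show ?thesis by (simp add: uni_def)
qed

lemma uni_orthonormal: "uni v \<Longrightarrow> cinner (shift a v) (shift b v) = (if a = b then 1 else 0)"
  using cinner_shift_left[of "a - b" v v] cinner_shift_left[of a v "shift b v"] by (simp add: uni_def)

lemma uni_delta [simp]: "uni (delta 0)"
  by (simp add: uni_def)

text \<open>Bessel's inequality for the translates of \<open>v\<close>. It makes convolution with \<open>v\<close> a contraction, hence
  everywhere defined, before anything is known about its range.\<close>

lemma uni_bessel:
  assumes v: "uni v" and F: "finite F"
  shows "(\<Sum>x\<in>F. (cmod (cinner f (shift x v)))\<^sup>2) \<le> (norm f)\<^sup>2"
proof -
  define c where "c x = cinner f (shift x v)" for x
  define s where "s = (\<Sum>x\<in>F. cscale (c x) (shift x v))"
  have c2: "c x * cnj (c x) = of_real ((cmod (c x))\<^sup>2)" for x by (simp only: complex_norm_square)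
  have fs: "cinner f s = of_real (\<Sum>x\<in>F. (cmod (c x))\<^sup>2)"
    using c2 by (simp add: s_def cinner_sum_right cinner_simps mult.commute of_real_sum
        del: of_real_power flip: c_def)
  have "cinner s s = (\<Sum>x\<in>F. \<Sum>y\<in>F. c x * (cnj (c y) * (if x = y then 1 else 0)))"
    by (simp only: s_def cinner_sum_right cinner_sum_left cinner_simps uni_orthonormal[OF v] mult.assoc)
      (subst sum.swap, simp add: sum_distrib_left mult_ac eq_commute)
  also have "\<dots> = of_real (\<Sum>x\<in>F. (cmod (c x))\<^sup>2)"
    using F by (simp add: c2 of_real_sum mult_delta_right del: of_real_power)
  finally have ss: "cinner s s = of_real (\<Sum>x\<in>F. (cmod (c x))\<^sup>2)" .
  have sf: "cinner s f = of_real (\<Sum>x\<in>F. (cmod (c x))\<^sup>2)"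
    using fs by (subst cinner_commute) simp
  have "cinner (f - s) (f - s) = of_real ((norm f)\<^sup>2) - of_real (\<Sum>x\<in>F. (cmod (c x))\<^sup>2)"
    unfolding cinner_simps fs ss sf unfolding cinner_self_norm by simp
  then have "of_real ((norm (f - s))\<^sup>2) = complex_of_real ((norm f)\<^sup>2 - (\<Sum>x\<in>F. (cmod (c x))\<^sup>2))"
    by (simp only: cinner_self_norm of_real_diff)
  then have "(norm (f - s))\<^sup>2 = (norm f)\<^sup>2 - (\<Sum>x\<in>F. (cmod (c x))\<^sup>2)"
    by (simp only: of_real_eq_iff)
  then show ?thesis
    using zero_le_power2[of "norm (f - s)"] by (simp add: c_def)
qed

lemma
  assumes "uni v"
  shows coef_conv: "coef (conv v f) x = cinner f (shift x (sharp v))"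
    and norm_conv_le: "norm (conv v f) \<le> norm f"
  using ell2_memI[of "\<lambda>x. cinner f (shift x (sharp v))" "norm f"] uni_bessel[of "sharp v" _ f] assms
  by (simp_all add: conv_def)

lemma coef_conv_sum: "uni v \<Longrightarrow> coef (conv v f) x = (\<Sum>\<^sub>\<infinity>y. coef f y * coef v (x - y))"
  by (simp add: coef_conv cinner_infsum)

lemma conv_linear:
  assumes "uni v"
  shows "conv v (f + g) = conv v f + conv v g" "conv v (f - g) = conv v f - conv v g"
    "conv v (cscale c f) = cscale c (conv v f)" "conv v (r *\<^sub>R f) = r *\<^sub>R conv v f" "conv v 0 = 0"
  by (auto intro!: ell2_eqI simp: assms coef_conv cinner_simps)

lemma bounded_linear_conv: "uni v \<Longrightarrow> bounded_linear (conv v)"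
  by (rule bounded_linear_intro[where K = 1]) (auto simp: conv_linear norm_conv_le)

lemma conv_delta: "uni v \<Longrightarrow> conv v (delta a) = shift a v"
  by (rule ell2_eqI) (simp add: coef_conv)

lemma conv_delta_0 [simp]: "uni v \<Longrightarrow> conv v (delta 0) = v"
  by (simp add: conv_delta)

lemma conv_shift: "uni v \<Longrightarrow> conv v (shift a f) = shift a (conv v f)"
  by (rule ell2_eqI) (simp add: coef_conv cinner_shift_left algebra_simps)

text \<open>Both compositions of \<open>conv v\<close> and \<open>conv (sharp v)\<close> are the identity on unit vectors. So an orthonormal
  family of translates is automatically complete, and the two contractions are mutually inverse unitaries.\<close>

lemma conv_sharp_cancel:
  assumes "uni v"
  shows "conv (sharp v) (conv v f) = f"
proof (rule bounded_linear_eqI[where A = UNIV])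
  show "bounded_linear (\<lambda>f. conv (sharp v) (conv v f))"
    using assms by (intro bounded_linear_compose[OF bounded_linear_conv bounded_linear_conv]) auto
  show "conv (sharp v) (conv v (cscale c (delta a))) = cscale c (delta a)" for c a
    by (rule ell2_eqI) (use assms in \<open>auto simp: conv_linear conv_delta coef_conv uni_orthonormal\<close>)
qed (auto intro: bounded_linear_ident)

lemma conv_sharp_cancel' [simp]:
  assumes "uni v"
  shows "conv v (conv (sharp v) f) = f"
  using conv_sharp_cancel[of "sharp v" f] assms by simp

lemmas conv_sharp_cancel [simp]

lemma conv_eq_iff [simp]: "uni v \<Longrightarrow> conv v f = conv v g \<longleftrightarrow> f = g"
  by (metis conv_sharp_cancel)

lemma conv_eq_0_iff [simp]: "uni v \<Longrightarrow> conv v f = 0 \<longleftrightarrow> f = 0"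
  by (metis conv_sharp_cancel conv_linear(5))

lemma norm_conv [simp]:
  assumes "uni v"
  shows "norm (conv v f) = norm f"
  using norm_conv_le[of "sharp v" "conv v f"] norm_conv_le[of v f] assms by simp

lemma cinner_conv_left:
  assumes "uni v"
  shows "cinner (conv v f) g = cinner f (conv (sharp v) g)"
proof (rule bounded_linear_eqI[where A = UNIV and X = "\<lambda>f. cinner (conv v f) g"
      and Y = "\<lambda>f. cinner f (conv (sharp v) g)"])
  show "bounded_linear (\<lambda>f. cinner (conv v f) g)"
    using bounded_linear_compose[OF bounded_linear_cinner_left bounded_linear_conv[OF assms]] .
  show "cinner (conv v (cscale c (delta a))) g = cinner (cscale c (delta a)) (conv (sharp v) g)" for c a
    using assms by (simp add: conv_linear conv_delta cinner_simps coef_conv cinner_commute[of g])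
qed (auto intro: bounded_linear_cinner_left)

lemma cinner_conv_right: "uni v \<Longrightarrow> cinner f (conv v g) = cinner (conv (sharp v) f) g"
  using cinner_conv_left[of "sharp v" f g] by simp

lemma uni_conv [simp]: "uni v \<Longrightarrow> uni w \<Longrightarrow> uni (conv v w)"
  using uni_orthonormal[of w _ 0] uni_orthonormal[of w 0 0]
  by (auto simp add: uni_def[of "conv v w"] conv_shift[symmetric] cinner_conv_left)

lemma conv_commute:
  assumes "uni v" "uni w"
  shows "conv v w = conv w v"
proof (rule ell2_eqI)
  fix x
  show "coef (conv v w) x = coef (conv w v) x"
    unfolding coef_conv_sum[OF assms(1)] coef_conv_sum[OF assms(2)]
    by (rule infsum_reindex_bij_witness[where i = "\<lambda>y. x - y" and j = "\<lambda>y. x - y"]) auto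
qed

lemma conv_assoc:
  assumes "uni v" "uni w"
  shows "conv (conv v w) f = conv v (conv w f)"
proof (rule bounded_linear_eqI[where A = UNIV and X = "conv (conv v w)"
      and Y = "\<lambda>f. conv v (conv w f)"])
  show "bounded_linear (\<lambda>f. conv v (conv w f))"
    using assms by (intro bounded_linear_compose[OF bounded_linear_conv bounded_linear_conv]) auto
  show "conv (conv v w) (cscale c (delta a)) = conv v (conv w (cscale c (delta a)))" for c a
    using assms by (simp add: conv_linear conv_delta conv_shift)
qed (use assms in \<open>auto intro: bounded_linear_conv\<close>)

lemma conv_left_commute: "uni v \<Longrightarrow> uni w \<Longrightarrow> conv v (conv w f) = conv w (conv v f)"
  by (metis conv_assoc conv_commute)

lemma sharp_conv:
  assumes "uni v" "uni w"
  shows "sharp (conv v w) = conv (sharp v) (sharp w)"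
proof (rule ell2_eqI)
  fix x
  have "uni (sharp v)" using assms by simp
  show "coef (sharp (conv v w)) x = coef (conv (sharp v) (sharp w)) x"
    unfolding coef_sharp coef_conv_sum[OF assms(1)] coef_conv_sum[OF \<open>uni (sharp v)\<close>] infsum_cnj[symmetric]
    by (rule infsum_reindex_bij_witness[where i = uminus and j = uminus])
      (auto simp: algebra_simps minus_diff_commute)
qed

definition supp_in :: "'a set \<Rightarrow> 'a ell2 \<Rightarrow> bool" where
  "supp_in A f \<longleftrightarrow> (\<forall>x. x \<notin> A \<longrightarrow> coef f x = 0)"

lemma supp_in_iff_restr: "supp_in A f \<longleftrightarrow> restr A f = f"
  unfolding supp_in_def by (metis coef_restr ell2_eqI)

lemma supp_in_simps [simp]:
  "supp_in A (restr A f)" "supp_in A 0" "supp_in A f \<Longrightarrow> supp_in A (cscale c f)"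
  "supp_in A f \<Longrightarrow> supp_in A g \<Longrightarrow> supp_in A (f + g)" "supp_in A f \<Longrightarrow> supp_in A g \<Longrightarrow> supp_in A (f - g)"
  "supp_in A f \<Longrightarrow> restr A f = f" "supp_in A (delta a) \<longleftrightarrow> a \<in> A"
  by (auto simp: supp_in_def intro!: ell2_eqI)

lemma supp_in_mono: "supp_in A f \<Longrightarrow> A \<subseteq> B \<Longrightarrow> supp_in B f"
  by (auto simp: supp_in_def)

lemma supp_in_shift: "supp_in A f \<Longrightarrow> (\<And>x. x \<in> A \<Longrightarrow> x + a \<in> B) \<Longrightarrow> supp_in B (shift a f)"
  unfolding supp_in_def coef_shift by (metis diff_add_cancel)

lemma supp_in_conv:
  assumes "uni v" "supp_in B v" "supp_in A f" "\<And>a b. a \<in> A \<Longrightarrow> b \<in> B \<Longrightarrow> a + b \<in> C"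
  shows "supp_in C (conv v f)"
  unfolding supp_in_def
proof (intro allI impI)
  fix x assume x: "x \<notin> C"
  have "coef f y * coef v (x - y) = 0" for y
    using assms(2-3) assms(4)[of y "x - y"] x by (auto simp: supp_in_def)
  then show "coef (conv v f) x = 0" unfolding coef_conv_sum[OF assms(1)] by (rule infsum_0)
qed

text \<open>Convolution with \<open>v\<close> moves indices only by elements of \<open>B\<close>, and such a move never crosses the boundary
  of \<open>A\<close>.\<close>

lemma restr_conv:
  assumes "uni v" "supp_in B v" "\<And>x b. b \<in> B \<Longrightarrow> x + b \<in> A \<longleftrightarrow> x \<in> A"
  shows "restr A (conv v f) = conv v (restr A f)"
proof (rule ell2_eqI)
  fix x
  have "coef v (x - y) = 0 \<or> (x \<in> A \<longleftrightarrow> y \<in> A)" for y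
    using assms(2) assms(3)[of "x - y" y] by (auto simp: supp_in_def)
  then have "coef (restr A f) y * coef v (x - y) = (if x \<in> A then coef f y * coef v (x - y) else 0)" for y
    by auto
  then show "coef (restr A (conv v f)) x = coef (conv v (restr A f)) x"
    by (simp add: coef_conv_sum[OF assms(1)])
qed

lemma supp_in_sharp: "supp_in A v \<Longrightarrow> supp_in (uminus ` A) (sharp v)"
  unfolding supp_in_def coef_sharp by (metis complex_cnj_zero image_eqI minus_minus)

section \<open>Truncated Toeplitz operators as compressions\<close>

text \<open>The projection onto the \<open>v\<close>-multiple of the space of families supported in \<open>N\<close>.\<close>

definition mult_proj :: "'a::ab_group_add set \<Rightarrow> 'a ell2 \<Rightarrow> 'a ell2 \<Rightarrow> 'a ell2" where
  "mult_proj N v f = conv v (restr N (conv (sharp v) f))"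

lemma mult_proj_linear:
  assumes "uni v"
  shows "mult_proj N v (f + g) = mult_proj N v f + mult_proj N v g"
    "mult_proj N v (f - g) = mult_proj N v f - mult_proj N v g"
    "mult_proj N v (cscale c f) = cscale c (mult_proj N v f)" "mult_proj N v 0 = 0"
  using assms by (simp_all add: mult_proj_def conv_linear)

lemma cinner_mult_proj: "uni v \<Longrightarrow> cinner (mult_proj N v f) g = cinner f (mult_proj N v g)"
  by (simp add: mult_proj_def cinner_conv_left cinner_restr)

text \<open>Conjugation by the unitary \<open>conv p\<close> turns the projection belonging to \<open>p\<close> into plain restriction to \<open>N\<close>.\<close>

lemma mult_proj_commute_iff:
  assumes p: "uni p" and q: "uni q"
  shows "(\<forall>f. mult_proj N p (mult_proj N q f) = mult_proj N q (mult_proj N p f)) \<longleftrightarrow>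
    (\<forall>f. restr N (mult_proj N (conv (sharp p) q) f) = mult_proj N (conv (sharp p) q) (restr N f))"
    (is "(\<forall>f. ?L f) \<longleftrightarrow> (\<forall>f. ?R f)")
proof -
  let ?w = "conv (sharp p) q"
  have w: "conv ?w f = conv (sharp p) (conv q f)" "conv (sharp ?w) f = conv (sharp q) (conv p f)" for f
    using p q by (simp_all add: conv_assoc sharp_conv conv_left_commute)
  have "?L (conv p f) \<longleftrightarrow> conv (sharp p) (mult_proj N p (mult_proj N q (conv p f)))
      = conv (sharp p) (mult_proj N q (mult_proj N p (conv p f)))" for f
    using p by simp
  also have "\<dots> f \<longleftrightarrow> ?R f" for f
    using p q by (simp add: mult_proj_def w)
  finally have "?L (conv p f) \<longleftrightarrow> ?R f" for f .
  then show ?thesis using p by (metis conv_sharp_cancel')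
qed

text \<open>Multiplication by \<open>v\<close> maps families supported in \<open>N\<close> to such families, so its adjoint maps the orthogonal
  complement of these families into itself.\<close>

lemma restr_conv_sharp:
  assumes "uni v" "supp_in B v" "\<And>x b. x \<in> N \<Longrightarrow> b \<in> B \<Longrightarrow> x + b \<in> N"
  shows "restr N (conv (sharp v) (restr N f)) = restr N (conv (sharp v) f)"
proof (rule ell2_eqI)
  fix x
  have v': "uni (sharp v)" using assms by simp
  have "coef (restr N f) y * coef (sharp v) (x - y) = coef f y * coef (sharp v) (x - y)" if "x \<in> N" for y
    using assms(2) assms(3)[OF that, of "y - x"] by (auto simp: supp_in_def)
  then show "coef (restr N (conv (sharp v) (restr N f))) x = coef (restr N (conv (sharp v) f)) x"
    unfolding coef_restr[of N "conv _ _"] coef_conv_sum[OF v'] by (auto intro: infsum_cong)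
qed

text \<open>An additively closed set \<open>N\<close> of indices takes the place of the cone of nonnegative exponents. Here \<open>model\<close> is the model space of \<open>p\<close>, \<open>compr\<close> the compression to it of multiplication
  by \<open>q\<close>, and \<open>compr_adj\<close> the adjoint of \<open>compr\<close>.\<close>

locale truncated_symbols =
  fixes N :: "'a::ab_group_add set" and p q :: "'a ell2"
  assumes N: "\<And>x y. x \<in> N \<Longrightarrow> y \<in> N \<Longrightarrow> x + y \<in> N"
    and p: "uni p" "supp_in N p" and q: "uni q" "supp_in N q"
begin

lemma supp_conv_symbol: "supp_in N f \<Longrightarrow> supp_in N (conv p f)" "supp_in N f \<Longrightarrow> supp_in N (conv q f)"
  using N p q by (auto intro: supp_in_conv)

lemmas restr_conv_sharp_symbol = restr_conv_sharp[OF p N] restr_conv_sharp[OF q N]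

definition model :: "'a ell2 set" where
  "model = {f. supp_in N f \<and> restr N (conv (sharp p) f) = 0}"

definition compr :: "'a ell2 \<Rightarrow> 'a ell2" where
  "compr f = conv q f - mult_proj N p (conv q f)"

definition compr_adj :: "'a ell2 \<Rightarrow> 'a ell2" where
  "compr_adj f = restr N (conv (sharp q) f)"

lemma supp_mult_proj: "supp_in N (mult_proj N p f)" "supp_in N (mult_proj N q f)"
  by (simp_all add: mult_proj_def supp_conv_symbol)

lemma mult_proj_restr: "mult_proj N p (restr N f) = mult_proj N p f" "mult_proj N q (restr N f) = mult_proj N q f"
  by (simp_all add: mult_proj_def restr_conv_sharp_symbol)

lemma model_mult_proj: "f \<in> model \<Longrightarrow> mult_proj N p f = 0"
  using p by (simp add: model_def mult_proj_def)

lemma model_projection: "supp_in N f \<Longrightarrow> f - mult_proj N p f \<in> model"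
  using p supp_mult_proj by (auto simp: model_def mult_proj_def conv_linear supp_conv_symbol)

lemma model_orth_mult_proj: "g \<in> model \<Longrightarrow> cinner (mult_proj N p f) g = 0"
  using p by (simp add: cinner_mult_proj model_mult_proj cinner_simps)

lemma model_subspace:
  "f \<in> model \<Longrightarrow> g \<in> model \<Longrightarrow> f + g \<in> model" "f \<in> model \<Longrightarrow> g \<in> model \<Longrightarrow> f - g \<in> model"
  "f \<in> model \<Longrightarrow> cscale c f \<in> model" "0 \<in> model"
  using p by (auto simp: model_def conv_linear)

lemma compr_model: "f \<in> model \<Longrightarrow> compr f \<in> model"
  unfolding compr_def by (rule model_projection) (simp add: model_def supp_conv_symbol)

lemma compr_linear:
  "compr (f + g) = compr f + compr g" "compr (f - g) = compr f - compr g"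
  "compr (cscale c f) = cscale c (compr f)"
  using p q by (simp_all add: compr_def conv_linear mult_proj_linear)

lemma compr_adj_model:
  assumes "f \<in> model"
  shows "compr_adj f \<in> model"
proof -
  have "restr N (conv (sharp p) (restr N (conv (sharp q) f))) = restr N (conv (sharp q) (restr N (conv (sharp p) f)))"
    using p q by (simp add: restr_conv_sharp_symbol conv_left_commute)
  then show ?thesis using assms q by (simp add: model_def compr_adj_def conv_linear)
qed

lemma cinner_compr:
  assumes "f \<in> model" "g \<in> model"
  shows "cinner (compr f) g = cinner f (compr_adj g)"
  using assms q model_orth_mult_proj[of g]
  by (simp add: compr_def compr_adj_def cinner_simps cinner_conv_left model_def flip: cinner_restr)

lemma norm_compr_le:
  assumes "f \<in> model"
  shows "norm (compr f) \<le> norm f"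
proof -
  have "cinner (compr f) (compr f) = cinner (conv q f) (compr f)"
    using model_orth_mult_proj[OF compr_model[OF assms]] by (simp add: compr_def cinner_simps)
  then have "(norm (compr f))\<^sup>2 = inner (conv q f) (compr f)"
    by (simp add: inner_ell2_def power2_norm_eq_inner)
  also have "\<dots> \<le> norm f * norm (compr f)"
    using norm_cauchy_schwarz[of "conv q f" "compr f"] q by simp
  finally show ?thesis
    by (cases "norm (compr f) = 0") (auto simp: power2_eq_square mult_le_cancel_right)
qed

lemma bounded_linear_compr: "bounded_linear compr"
  unfolding compr_def mult_proj_def using p q
  by (intro bounded_linear_sub bounded_linear_compose[OF bounded_linear_conv]
      bounded_linear_compose[OF bounded_linear_restr] bounded_linear_conv) auto

lemma closed_model: "closed model"
proof -
  have "model = {f. restr N f = f} \<inter> {f. restr N (conv (sharp p) f) = 0}"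
    by (auto simp: model_def supp_in_iff_restr)
  moreover have "bounded_linear (\<lambda>f. restr N (conv (sharp p) f))"
    using p by (intro bounded_linear_compose[OF bounded_linear_restr bounded_linear_conv]) auto
  ultimately show ?thesis
    by (auto intro!: closed_Int closed_Collect_eq linear_continuous_on bounded_linear_restr continuous_on_id continuous_on_const)
qed

text \<open>The compression of one projection to the range of another is idempotent only if the two
  projections commute.\<close>

lemma partial_isometry_imp_commute:
  assumes pi: "\<And>f. f \<in> model \<Longrightarrow> (\<And>g. g \<in> model \<Longrightarrow> compr g = 0 \<Longrightarrow> cinner f g = 0) \<Longrightarrow> norm (compr f) = norm f"
  shows "mult_proj N p (mult_proj N q f) = mult_proj N q (mult_proj N p f)"
proof -
  let ?T = compr and ?S = compr_adj
  have TST: "?T (?S (?T f)) = ?T f" if f: "f \<in> model" for f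
  proof -
    define K where "K = {g \<in> model. ?T g = 0}"
    have "closed K"
      unfolding K_def Collect_conj_eq
      by (intro closed_Int closed_Collect_eq linear_continuous_on bounded_linear_compr continuous_on_const)
        (simp add: closed_model)
    moreover have K: "cscale c g \<in> K" if "g \<in> K" for c g
      using that by (auto simp: K_def model_subspace compr_linear)
    moreover have "subspace K"
      unfolding subspace_def
      using K compr_linear(3)[of 0 0] by (auto simp: K_def model_subspace compr_linear simp flip: cscale_of_real)
    ultimately obtain f0 where f0: "f0 \<in> K" "\<And>g. g \<in> K \<Longrightarrow> inner (f - f0) g = 0"
      using orthogonal_projection_exists[of K f] by blast
    define f1 where "f1 = f - f0"
    have f1: "f1 \<in> model" using f f0(1) by (simp add: f1_def K_def model_subspace)
    have "cinner f1 g = 0" if "g \<in> K" for g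
      using f0(2)[OF that] f0(2)[OF K[OF that]] by (simp add: cinner_eq_inner f1_def zero_complex.ctr)
    then have nrm: "norm (?T f1) = norm f1" using pi[OF f1] by (auto simp: K_def)
    have "norm (?S (?T f1)) \<le> norm f1"
      unfolding compr_adj_def using norm_restr_le[of N "conv (sharp q) (?T f1)"] nrm q by simp
    moreover have "cinner f1 (?S (?T f1)) = of_real ((norm f1)\<^sup>2)"
      using cinner_compr[OF f1 compr_model[OF f1]] nrm by (simp add: cinner_self_norm)
    then have "inner (?S (?T f1)) f1 = (norm f1)\<^sup>2"
      by (subst inner_commute) (simp only: inner_ell2_def Re_complex_of_real)
    ultimately have "(norm (?S (?T f1) - f1))\<^sup>2 \<le> 0"
      using power_mono[of "norm (?S (?T f1))" "norm f1" 2]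
      by (simp add: power2_norm_eq_inner inner_diff_left inner_diff_right inner_commute)
    then have "?S (?T f1) = f1" by simp
    moreover have "?T f = ?T f1" using f0(1) by (simp add: f1_def K_def compr_linear)
    ultimately show ?thesis by simp
  qed
  \<comment> \<open>The adjoint of the identity \<open>T T\<^sup>* T = T\<close>.\<close>
  have STS: "?S (?T (?S f)) = ?S f" if f: "f \<in> model" for f
  proof -
    have "cinner h (?S (?T (?S f))) = cinner h (?S f)" if h: "h \<in> model" for h
    proof -
      have "cinner h (?S (?T (?S f))) = cinner (?T h) (?T (?S f))"
        using h f by (simp add: cinner_compr compr_model compr_adj_model)
      also have "\<dots> = cnj (cinner (?T (?S f)) (?T h))" by (rule cinner_commute)
      also have "\<dots> = cinner (?S (?T h)) (?S f)"
        using h f by (simp add: cinner_compr compr_model compr_adj_model cinner_commute[of "?S (?T h)"])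
      also have "\<dots> = cinner (?T (?S (?T h))) f"
        using h f by (simp add: cinner_compr compr_model compr_adj_model)
      also have "\<dots> = cinner h (?S f)" using h f by (simp add: TST cinner_compr)
      finally show ?thesis .
    qed
    from this[of "?S (?T (?S f)) - ?S f"] have "cinner (?S (?T (?S f)) - ?S f) (?S (?T (?S f)) - ?S f) = 0"
      using f by (simp add: cinner_simps compr_model compr_adj_model model_subspace)
    then show ?thesis by (simp add: cinner_self_norm)
  qed
  \<comment> \<open>Idempotence of \<open>T T\<^sup>*\<close> shows that compressing \<open>\<Pi>\<^sub>q f\<close> to the model space preserves its norm; by Pythagoras
    the discarded part vanishes, so that \<open>\<Pi>\<^sub>q\<close> leaves the model space invariant.\<close>
  have inv: "mult_proj N p (mult_proj N q f) = 0" if f: "f \<in> model" for f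
  proof -
    let ?E = "conv q (?S f)" and ?R = "mult_proj N p (conv q (?S f))"
    have Sf: "?S f \<in> model" using f by (rule compr_adj_model)
    have "cinner (?T (?S f)) (?T (?S f)) = cinner ?E ?E"
      using Sf q by (simp add: cinner_compr compr_model STS[OF f] cinner_conv_left)
    moreover have "cinner (?E - ?R) ?R = 0" "cinner ?R (?E - ?R) = 0"
      using model_orth_mult_proj[OF compr_model[OF Sf]] cinner_commute[of "?E - ?R" ?R]
      by (simp_all add: compr_def)
    ultimately have "cinner ?R ?R = 0" by (simp add: compr_def cinner_simps)
    then show ?thesis by (simp add: cinner_self_norm mult_proj_def[of N q] compr_adj_def)
  qed
  have *: "mult_proj N p (mult_proj N q f) = mult_proj N p (mult_proj N q (mult_proj N p f))" for f
    using inv[OF model_projection[of "restr N f"]] p q by (simp add: mult_proj_linear mult_proj_restr)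
  have "cinner h (mult_proj N q (mult_proj N p f)) = cinner h (mult_proj N p (mult_proj N q f))" for f h
  proof -
    have "cinner h (mult_proj N q (mult_proj N p f)) = cinner (mult_proj N p (mult_proj N q h)) f"
      using p q by (simp add: cinner_mult_proj)
    also have "\<dots> = cinner (mult_proj N p (mult_proj N q (mult_proj N p h))) f" by (subst *) simp
    also have "\<dots> = cinner h (mult_proj N p (mult_proj N q (mult_proj N p f)))"
      using p q by (simp add: cinner_mult_proj)
    also have "\<dots> = cinner h (mult_proj N p (mult_proj N q f))" by (subst *[of f]) simp
    finally show ?thesis .
  qed
  from this[of "delta x" for x] show ?thesis by (intro ell2_eqI) simp
qed

text \<open>If the projections commute, then \<open>T T\<^sup>* T = T\<close>, so \<open>T\<^sup>* T f - f\<close> lies in the kernel of \<open>T\<close>.\<close>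

lemma commute_imp_partial_isometry:
  assumes comm: "\<And>f. mult_proj N p (mult_proj N q f) = mult_proj N q (mult_proj N p f)"
    and f: "f \<in> model" and orth: "\<And>g. g \<in> model \<Longrightarrow> compr g = 0 \<Longrightarrow> cinner f g = 0"
  shows "norm (compr f) = norm f"
proof -
  let ?g = "compr_adj (compr f)"
  have "mult_proj N q (conv q f) = conv q f" using f q by (simp add: mult_proj_def model_def)
  then have "conv q ?g = compr f"
    using q comm[of "conv q f"] by (simp add: compr_adj_def compr_def mult_proj_linear flip: mult_proj_def)
  then have "compr ?g = compr f"
    using compr_def[of ?g] model_mult_proj[OF compr_model[OF f]] by simp
  then have "compr (?g - f) = 0" by (simp add: compr_linear)
  then have "cinner f (?g - f) = 0"
    using f by (intro orth) (auto intro!: model_subspace compr_adj_model compr_model)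
  then have "cinner (compr f) (compr f) = cinner f f"
    using f by (simp add: cinner_compr compr_model cinner_simps)
  then show ?thesis by (simp add: norm_eq_sqrt_inner inner_ell2_def)
qed

end

section \<open>A lexicographic order on the integer lattice\<close>

definition nonneg_cone :: "('n \<Rightarrow> int) set" where
  "nonneg_cone = {a. \<forall>i. 0 \<le> a i}"

definition unit_index :: "'n \<Rightarrow> 'n \<Rightarrow> int" where
  "unit_index i = (\<lambda>j. if j = i then 1 else 0)"

lemma unit_index_simps [simp]: "unit_index i i = 1" "j \<noteq> i \<Longrightarrow> unit_index i j = 0"
  by (auto simp: unit_index_def)

lemma nonneg_cone_diff_unit: "x - unit_index i \<in> nonneg_cone \<longleftrightarrow> x \<in> nonneg_cone \<and> 0 < x i"
proof
  assume *: "x - unit_index i \<in> nonneg_cone"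
  have "(if j = i then 1 else 0) \<le> x j" for j
    using * by (simp add: nonneg_cone_def unit_index_def)
  then have "0 \<le> x j" "1 \<le> x i" for j
    by (smt (verit))+
  then show "x \<in> nonneg_cone \<and> 0 < x i" by (force simp: nonneg_cone_def)
qed (auto simp: nonneg_cone_def unit_index_def)

lemma nonneg_cone_add: "x \<in> nonneg_cone \<Longrightarrow> y \<in> nonneg_cone \<Longrightarrow> x + y \<in> nonneg_cone"
  by (auto simp: nonneg_cone_def)

text \<open>The strictly positive elements of the lexicographic order in which the coordinates are ranked by the
  injection \<open>e\<close>.\<close>

definition lexpos :: "('n \<Rightarrow> nat) \<Rightarrow> ('n \<Rightarrow> int) \<Rightarrow> bool" where
  "lexpos e a \<longleftrightarrow> (\<exists>j. 0 < a j \<and> (\<forall>l. e l < e j \<longrightarrow> a l = 0))"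

lemma lexpos_total:
  assumes "inj e" "a \<noteq> 0"
  shows "lexpos e a \<or> lexpos e (- a)"
proof -
  obtain j0 where "a j0 \<noteq> 0" using assms(2) by (auto simp: fun_eq_iff)
  then obtain j where j: "a j \<noteq> 0" "\<And>l. a l \<noteq> 0 \<Longrightarrow> e j \<le> e l"
    using ex_has_least_nat[of "\<lambda>j. a j \<noteq> 0" j0 e] by auto
  then have "\<forall>l. e l < e j \<longrightarrow> a l = 0" by (meson leD)
  then show ?thesis
    using j(1) unfolding lexpos_def fun_Compl_def by (metis neg_0_equal_iff_equal neg_0_less_iff_less linorder_neqE)
qed

lemma lexpos_antisym:
  assumes "inj e" "lexpos e a" "lexpos e (- a)"
  shows False
proof -
  obtain j l where "0 < a j" "\<forall>i. e i < e j \<longrightarrow> a i = 0" "a l < 0" "\<forall>i. e i < e l \<longrightarrow> a i = 0"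
    using assms(2,3) by (auto simp: lexpos_def)
  moreover from this have "j \<noteq> l" by auto
  then have "e j < e l \<or> e l < e j" using assms(1) by (meson inj_eq linorder_neqE_nat)
  ultimately show False by auto
qed

lemma lexpos_add:
  assumes "inj e" "lexpos e a" "lexpos e b"
  shows "lexpos e (a + b)"
proof -
  obtain j l where *: "0 < a j" "\<forall>i. e i < e j \<longrightarrow> a i = 0" "0 < b l" "\<forall>i. e i < e l \<longrightarrow> b i = 0"
    using assms(2,3) by (auto simp: lexpos_def)
  consider "e j < e l" | "e l < e j" | "j = l" using assms(1) by (meson inj_eq linorder_neqE_nat)
  then show ?thesis
  proof cases
    case 1
    then show ?thesis using * unfolding lexpos_def by (intro exI[of _ j]) auto
  next
    case 2
    then show ?thesis using * unfolding lexpos_def by (intro exI[of _ l]) auto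
  next
    case 3
    then show ?thesis using * unfolding lexpos_def by (intro exI[of _ j]) auto
  qed
qed

text \<open>The lexicographic order is not a well-order on \<open>\<int>\<^sup>n\<close>, but on the cone each coordinate can be minimized
  in turn; the induction runs over the number of coordinates already treated.\<close>

lemma lexpos_minimum_exists:
  fixes A :: "('n::finite \<Rightarrow> int) set"
  assumes "inj e" "A \<noteq> {}" "A \<subseteq> nonneg_cone"
  shows "\<exists>m\<in>A. \<forall>x\<in>A. x = m \<or> lexpos e (x - m)"
proof -
  have "\<exists>m\<in>A. \<forall>x\<in>A. (\<forall>l. e l < n \<longrightarrow> x l = m l) \<or>
      (\<exists>j. e j < n \<and> m j < x j \<and> (\<forall>l. e l < e j \<longrightarrow> x l = m l))" for n
  proof (induction n)
    case 0
    then show ?case using assms(2) by auto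
  next
    case (Suc n)
    then obtain m where m: "m \<in> A" "\<And>x. x \<in> A \<Longrightarrow> (\<forall>l. e l < n \<longrightarrow> x l = m l) \<or>
      (\<exists>j. e j < n \<and> m j < x j \<and> (\<forall>l. e l < e j \<longrightarrow> x l = m l))" by blast
    show ?case
    proof (cases "\<exists>j. e j = n")
      case False
      then have "e l < Suc n \<longleftrightarrow> e l < n" for l by (metis less_antisym less_Suc_eq)
      then show ?thesis using m by (intro bexI[of _ m]) simp_all
    next
      case True
      then obtain j where j: "e j = n" by blast
      define B where "B = {x \<in> A. \<forall>l. e l < n \<longrightarrow> x l = m l}"
      have "m \<in> B" using m by (simp add: B_def)
      then obtain m' where m': "m' \<in> B" "\<And>x. x \<in> B \<Longrightarrow> nat (m' j) \<le> nat (x j)"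
        using ex_has_least_nat[of "\<lambda>x. x \<in> B" m "\<lambda>x. nat (x j)"] by auto
      have least: "m' j \<le> x j" if "x \<in> B" for x
        using m'(2)[OF that] that assms(3) by (auto simp: B_def nonneg_cone_def nat_le_iff)
      have agree: "m' l = m l" if "e l < n" for l using m'(1) that by (simp add: B_def)
      have lt: "e l < Suc n \<longleftrightarrow> e l < n \<or> l = j" for l using j assms(1) by (auto simp: inj_eq less_Suc_eq)
      have "(\<forall>l. e l < Suc n \<longrightarrow> x l = m' l) \<or>
          (\<exists>j. e j < Suc n \<and> m' j < x j \<and> (\<forall>l. e l < e j \<longrightarrow> x l = m' l))" if x: "x \<in> A" for x
      proof (cases "x \<in> B")
        case True
        show ?thesis
        proof (cases "x j = m' j")
          case True
          then show ?thesis using \<open>x \<in> B\<close> agree by (auto simp: lt B_def)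
        next
          case False
          then have "m' j < x j" using least[OF \<open>x \<in> B\<close>] by simp
          then show ?thesis using \<open>x \<in> B\<close> agree j by (intro disjI2 exI[of _ j]) (auto simp: B_def)
        qed
      next
        case False
        then obtain i where "e i < n" "m i < x i" "\<forall>l. e l < e i \<longrightarrow> x l = m l"
          using m(2)[OF x] x by (auto simp: B_def)
        then show ?thesis using agree by (intro disjI2 exI[of _ i]) auto
      qed
      then show ?thesis using m'(1) by (auto simp: B_def)
    qed
  qed
  from this[of "Suc (Max (range e))"] obtain m where m: "m \<in> A"
    "\<And>x. x \<in> A \<Longrightarrow> (\<forall>l. e l < Suc (Max (range e)) \<longrightarrow> x l = m l) \<or>
      (\<exists>j. e j < Suc (Max (range e)) \<and> m j < x j \<and> (\<forall>l. e l < e j \<longrightarrow> x l = m l))" by blast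
  have "e l < Suc (Max (range e))" for l by (simp add: less_Suc_eq_le)
  then have "x = m \<or> lexpos e (x - m)" if "x \<in> A" for x
    using m(2)[OF that] by (auto simp: lexpos_def)
  then show ?thesis using m(1) by blast
qed

section \<open>Unimodular elements of doubly invariant subspaces\<close>

lemma closed_supp_in:
  assumes "bounded_linear X"
  shows "closed {f. supp_in A (X f)}"
  unfolding supp_in_iff_restr using assms
  by (intro closed_Collect_eq linear_continuous_on bounded_linear_compose[OF bounded_linear_restr])

lemma cinner_shift_disjoint:
  assumes "supp_in V f" "\<And>x y. x \<in> V \<Longrightarrow> y \<in> V \<Longrightarrow> x - y \<in> V" "a \<notin> V"
  shows "cinner (shift a f) f = 0"
proof -
  have "coef f (x - a) * cnj (coef f x) = 0" for x
    using assms(1,3) assms(2)[of x "x - a"] by (auto simp: supp_in_def)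
  then show ?thesis unfolding cinner_infsum coef_shift by (intro infsum_0) auto
qed

text \<open>Orthogonality of \<open>f\<close> to its proper translates says that all nontrivial Fourier coefficients of the squared modulus
  vanish, so the modulus is constant.\<close>

lemma uni_normalize:
  assumes "f \<noteq> 0" "\<And>a. a \<noteq> 0 \<Longrightarrow> cinner (shift a f) f = 0"
  shows "uni (cscale (1 / of_real (norm f)) f)"
  using assms by (auto simp: uni_def cinner_simps cinner_self_norm power2_eq_square)

text \<open>
  The argument of Helson and Lowdenslager. Let \<open>m\<close> be the least exponent of \<open>g\<close> and let \<open>Z\<close> be the part of \<open>Y\<close>
  supported in exponents at least \<open>m\<close>. Let \<open>p\<close> be the projection of \<open>\<delta>\<^sub>m\<close> to \<open>Z\<close>, which represents evaluation
  at \<open>m\<close> on \<open>Z\<close> and is nonzero because of \<open>g\<close>. For positive \<open>a\<close> the translate of \<open>p\<close> by \<open>a\<close> lies in \<open>Z\<close> and has no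
  \<open>m\<close>-th coefficient, hence is orthogonal to \<open>p\<close>. As every nonzero \<open>a\<close> or its negative is positive, \<open>p\<close>
  has constant modulus.
\<close>

lemma unimodular_in_invariant_subspace:
  fixes Y :: "('n::finite \<Rightarrow> int) ell2 set"
  assumes Y: "closed Y" "\<And>f g. f \<in> Y \<Longrightarrow> g \<in> Y \<Longrightarrow> f + g \<in> Y" "\<And>c f. f \<in> Y \<Longrightarrow> cscale c f \<in> Y"
    and V: "\<And>x y. x \<in> V \<Longrightarrow> y \<in> V \<Longrightarrow> x - y \<in> V" "\<And>f. f \<in> Y \<Longrightarrow> supp_in V f"
    and inv: "\<And>a f. a \<in> V \<Longrightarrow> f \<in> Y \<Longrightarrow> shift a f \<in> Y"
    and g: "g \<in> Y" "g \<noteq> 0" "supp_in nonneg_cone g"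
  shows "\<exists>k\<in>Y. uni k"
proof -
  obtain e :: "'n \<Rightarrow> nat" where e: "inj e" using finite_imp_inj_to_nat_seg[of "UNIV :: 'n set"] by auto
  have "{x. coef g x \<noteq> 0} \<noteq> {}" using g(2) ell2_eqI[of g 0] by auto
  moreover have "{x. coef g x \<noteq> 0} \<subseteq> nonneg_cone" using g(3) by (auto simp: supp_in_def)
  ultimately obtain m where m: "coef g m \<noteq> 0" "\<And>x. coef g x \<noteq> 0 \<Longrightarrow> x = m \<or> lexpos e (x - m)"
    using lexpos_minimum_exists[OF e] by (metis (mono_tags, lifting) mem_Collect_eq)
  define C where "C = {x. x = m \<or> lexpos e (x - m)}"
  define Z where "Z = Y \<inter> {f. supp_in C f}"
  have gZ: "g \<in> Z" using g m by (auto simp: Z_def C_def supp_in_def)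
  have Zsc: "cscale c f \<in> Z" if "f \<in> Z" for c f using that Y by (auto simp: Z_def)
  have "0 \<in> Z" using Zsc[OF gZ, of 0] by simp
  then have "subspace Z"
    using Zsc Y by (auto simp: subspace_def Z_def simp flip: cscale_of_real)
  moreover have "closed Z"
    unfolding Z_def using Y closed_supp_in[OF bounded_linear_ident, of C] by (intro closed_Int) auto
  ultimately obtain p where p: "p \<in> Z" "\<And>s. s \<in> Z \<Longrightarrow> inner (delta m - p) s = 0"
    using orthogonal_projection_exists[of Z "delta m"] by blast
  have orth: "cinner p s = cnj (coef s m)" if "s \<in> Z" for s
  proof -
    have "cinner (delta m - p) s = 0"
      using p(2)[OF that] p(2)[OF Zsc[OF that]] by (simp add: cinner_eq_inner zero_complex.ctr)
    then show ?thesis by (simp add: cinner_simps)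
  qed
  have "p \<noteq> 0" using orth[OF gZ] m(1) by (auto simp: cinner_simps)
  have pos: "cinner p (shift a p) = 0" if a: "a \<in> V" "lexpos e a" for a
  proof -
    have "supp_in C (shift a p)"
      unfolding supp_in_def
    proof (intro allI impI)
      fix x assume x: "x \<notin> C"
      have "x - a \<notin> C"
      proof
        assume "x - a \<in> C"
        then have "lexpos e (x - m)"
          using lexpos_add[OF e a(2), of "x - a - m"] a(2) by (auto simp: C_def algebra_simps)
        with x show False by (simp add: C_def)
      qed
      then show "coef (shift a p) x = 0" using p(1) by (auto simp: Z_def supp_in_def)
    qed
    then have "shift a p \<in> Z" using p(1) inv a(1) by (simp add: Z_def)
    moreover have "m - a \<notin> C"
    proof -
      have "a \<noteq> 0" using a(2) by (auto simp: lexpos_def)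
      then show ?thesis using lexpos_antisym[OF e a(2)] by (auto simp: C_def)
    qed
    then have "coef (shift a p) m = 0" using p(1) by (auto simp: Z_def supp_in_def)
    ultimately show ?thesis using orth by simp
  qed
  have "cinner (shift a p) p = 0" if "a \<noteq> 0" for a
  proof (cases "a \<in> V")
    case False
    then show ?thesis using p(1) V by (intro cinner_shift_disjoint[of V]) (auto simp: Z_def)
  next
    case True
    then have "- a \<in> V" using V(1)[of a a] V(1)[of 0 a] by simp
    then show ?thesis
      using pos[OF True] pos[of "- a"] lexpos_total[OF e that] cinner_commute[of "shift a p" p]
      by (auto simp: cinner_shift_left)
  qed
  from uni_normalize[OF \<open>p \<noteq> 0\<close> this] show ?thesis using Zsc[OF p(1)] by (auto simp: Z_def)
qed

section \<open>Separation of variables\<close>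

text \<open>Here \<open>w\<close> stands for the quotient of two inner functions whose range projections commute.\<close>

locale commuting_symbol =
  fixes w :: "('n::finite \<Rightarrow> int) ell2"
  assumes w: "uni w"
    and comm: "\<And>f. restr nonneg_cone (mult_proj nonneg_cone w f) = mult_proj nonneg_cone w (restr nonneg_cone f)"
begin

text \<open>The intersection of \<open>H\<^sup>2\<close> and \<open>w H\<^sup>2\<close>.\<close>

definition range_space :: "('n \<Rightarrow> int) ell2 set" where
  "range_space = {x. supp_in nonneg_cone x \<and> supp_in nonneg_cone (conv (sharp w) x)}"

text \<open>The product of the two commuting projections is the projection onto the intersection of their ranges, so the
  analytic part of \<open>w h\<close> stays in \<open>w H\<^sup>2\<close>.\<close>

lemma restr_conv_range_space:
  assumes "supp_in nonneg_cone h"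
  shows "restr nonneg_cone (conv w h) \<in> range_space"
proof -
  have "mult_proj nonneg_cone w (conv w h) = conv w h" using w assms by (simp add: mult_proj_def)
  then have "restr nonneg_cone (conv w h) = mult_proj nonneg_cone w (restr nonneg_cone (conv w h))"
    using comm[of "conv w h"] by simp
  then have "conv (sharp w) (restr nonneg_cone (conv w h)) =
      conv (sharp w) (mult_proj nonneg_cone w (restr nonneg_cone (conv w h)))"
    by simp
  also have "\<dots> = restr nonneg_cone (conv (sharp w) (restr nonneg_cone (conv w h)))"
    using w by (simp add: mult_proj_def)
  finally show ?thesis by (simp add: range_space_def supp_in_iff_restr)
qed

lemma range_space_shift:
  assumes "h \<in> range_space"
  shows "shift (unit_index i) h \<in> range_space"
proof -
  have "x + unit_index i \<in> nonneg_cone" if "x \<in> nonneg_cone" for x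
    using that by (auto simp: nonneg_cone_def unit_index_def)
  then show ?thesis
    using assms w by (auto simp: range_space_def conv_shift intro: supp_in_shift)
qed

text \<open>
  Shift \<open>w\<close> by an exponent \<open>k\<close> that turns the offending exponent \<open>\<alpha>\<close> into one in the cone with \<open>i\<close>-th coordinate zero. The
  part \<open>g\<close> of the shifted family that is analytic and free of \<open>z\<^sub>i\<close> is the difference between the analytic part of
  \<open>w z\<^sup>k\<close> and \<open>z\<^sub>i\<close> times the analytic part of \<open>w z\<^sup>k / z\<^sub>i\<close>. So it lies in the intersection of \<open>H\<^sup>2\<close> and \<open>w H\<^sup>2\<close>, and
  \<open>g\<close> belongs to the doubly invariant space \<open>Y\<close> of all \<open>f\<close> free of \<open>z\<^sub>i\<close> for which \<open>f / w\<close> is analytic in \<open>z\<^sub>i\<close>.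
  Dividing by a unimodular element of \<open>Y\<close> shows that \<open>1 / w\<close> itself is analytic in \<open>z\<^sub>i\<close>.
\<close>

lemma coordinate_sign:
  assumes \<alpha>: "coef w \<alpha> \<noteq> 0" "\<alpha> i < 0" and \<beta>: "coef w \<beta> \<noteq> 0"
  shows "\<beta> i \<le> 0"
proof -
  define V where "V = {a :: 'n \<Rightarrow> int. a i = 0}"
  define R where "R = {a :: 'n \<Rightarrow> int. 0 \<le> a i}"
  define k where "k j = (if j = i then - \<alpha> i else \<bar>\<alpha> j\<bar>)" for j
  define g where "g = restr (nonneg_cone \<inter> V) (shift k w)"
  let ?e = "unit_index i"
  have kN: "k \<in> nonneg_cone" "k - ?e \<in> nonneg_cone"
    using \<alpha>(2) by (auto simp: nonneg_cone_def k_def unit_index_def)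
  have "g = restr nonneg_cone (conv w (delta k)) - shift ?e (restr nonneg_cone (conv w (delta (k - ?e))))"
  proof (rule ell2_eqI)
    fix x :: "'n \<Rightarrow> int"
    note nonneg_cone_diff_unit[of x i]
    moreover have "0 \<le> x i" if "x \<in> nonneg_cone" using that by (simp add: nonneg_cone_def)
    moreover have "x - ?e - (k - ?e) = x - k" by simp
    ultimately show "coef g x = coef (restr nonneg_cone (conv w (delta k)) - shift ?e (restr nonneg_cone (conv w (delta (k - ?e))))) x"
      by (auto simp: g_def V_def conv_delta[OF w])
  qed
  then have "g \<in> range_space"
    using restr_conv_range_space[of "delta k"] range_space_shift[OF restr_conv_range_space[of "delta (k - ?e)"]]
      kN w by (simp add: range_space_def conv_linear)
  then have gN: "supp_in nonneg_cone g" "supp_in nonneg_cone (conv (sharp w) g)" by (auto simp: range_space_def)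
  have "k + \<alpha> \<in> nonneg_cone \<inter> V" by (auto simp: nonneg_cone_def V_def k_def)
  then have "coef g (k + \<alpha>) \<noteq> 0" using \<alpha>(1) by (simp add: g_def)
  then have "g \<noteq> 0" by auto
  define Y where "Y = {f. supp_in V f} \<inter> {f. supp_in R (conv (sharp w) f)}"
  have "\<exists>k\<in>Y. uni k"
  proof (rule unimodular_in_invariant_subspace[of Y V g])
    show "closed Y"
      unfolding Y_def using w by (intro closed_Int closed_supp_in bounded_linear_conv bounded_linear_ident) auto
    show "g \<in> Y"
    proof -
      have "supp_in V g" by (simp add: g_def supp_in_def)
      moreover have "supp_in R (conv (sharp w) g)"
        by (rule supp_in_mono[OF gN(2)]) (auto simp: R_def nonneg_cone_def)
      ultimately show ?thesis by (simp add: Y_def)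
    qed
    show "shift a f \<in> Y" if "a \<in> V" "f \<in> Y" for a f
      using that w by (auto simp: Y_def V_def R_def conv_shift intro: supp_in_shift)
  qed (use w gN \<open>g \<noteq> 0\<close> in \<open>auto simp: Y_def V_def conv_linear\<close>)
  then obtain k where k: "uni k" "supp_in V k" "supp_in R (conv (sharp w) k)" by (auto simp: Y_def)
  have "conv (sharp k) (conv (sharp w) k) = conv (sharp w) (conv (sharp k) k)"
    using w k(1) by (simp add: conv_left_commute)
  also have "conv (sharp k) k = delta 0" using k(1) conv_sharp_cancel[of k "delta 0"] by simp
  finally have "sharp w = conv (sharp k) (conv (sharp w) k)" using w by simp
  moreover have "supp_in R (conv (sharp k) (conv (sharp w) k))"
    by (rule supp_in_conv[OF _ supp_in_sharp[OF k(2)] k(3)]) (use k(1) in \<open>auto simp: V_def R_def\<close>)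
  ultimately have "supp_in R (sharp w)" by simp
  then have "- \<beta> \<in> R" using \<beta> by (force simp: supp_in_def)
  then show ?thesis by (simp add: R_def)
qed

text \<open>
  Among the exponents \<open>k\<close> supported outside \<open>J\<close> for which the analytic part \<open>a\<close> of \<open>w z\<^sup>k\<close> is nonzero, take one of
  minimal degree. Minimality removes from \<open>a\<close> all variables outside \<open>J\<close>. The function \<open>c = a / w\<close> is analytic and is the
  projection of \<open>z\<^sup>k\<close> onto the intersection of \<open>H\<^sup>2\<close> and \<open>H\<^sup>2 / w\<close>. On \<open>H\<^sup>2\<close> that projection commutes with multiplication
  by \<open>z\<^sub>j\<close> for \<open>j \<in> J\<close>, so \<open>c\<close> is free of the variables in \<open>J\<close>. The families \<open>a\<close> and \<open>c\<close> have the same correlations with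
  their translates, and since they live on complementary coordinates all nontrivial ones vanish.
\<close>

lemma separated_symbols:
  "\<exists>J u v. uni u \<and> uni v \<and> supp_in (nonneg_cone \<inter> {a. \<forall>i\<in>J. a i = 0}) u \<and>
     supp_in (nonneg_cone \<inter> {a. \<forall>i. i \<notin> J \<longrightarrow> a i = 0}) v \<and> conv w u = v"
proof -
  define J where "J = {i. \<forall>\<beta>. coef w \<beta> \<noteq> 0 \<longrightarrow> 0 \<le> \<beta> i}"
  have J: "0 \<le> \<beta> i" if "coef w \<beta> \<noteq> 0" "i \<in> J" for \<beta> i using that by (auto simp: J_def)
  have notJ: "\<beta> i \<le> 0" if "coef w \<beta> \<noteq> 0" "i \<notin> J" for \<beta> i
  proof -
    obtain \<alpha> where "coef w \<alpha> \<noteq> 0" "\<alpha> i < 0" using \<open>i \<notin> J\<close> by (auto simp: J_def not_le)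
    then show ?thesis using coordinate_sign that by blast
  qed
  define D where "D = {k \<in> nonneg_cone. (\<forall>j\<in>J. k j = 0) \<and> restr nonneg_cone (shift k w) \<noteq> 0}"
  have "D \<noteq> {}"
  proof -
    have "w \<noteq> 0" using uni_orthonormal[OF w, of 0 0] by (auto simp: cinner_simps)
    then obtain \<alpha> where \<alpha>: "coef w \<alpha> \<noteq> 0" using ell2_eqI[of w 0] by auto
    define k where "k i = (if i \<in> J then 0 else - \<alpha> i)" for i
    have "coef (restr nonneg_cone (shift k w)) (k + \<alpha>) \<noteq> 0"
      using \<alpha> J by (auto simp: nonneg_cone_def k_def)
    then have "restr nonneg_cone (shift k w) \<noteq> 0" by (metis coef_simps(1))
    then have "k \<in> D" using notJ[OF \<alpha>] by (auto simp: D_def nonneg_cone_def k_def)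
    then show ?thesis by blast
  qed
  then obtain k where k: "k \<in> D" "\<And>k'. k' \<in> D \<Longrightarrow> nat (\<Sum>i\<in>UNIV. k i) \<le> nat (\<Sum>i\<in>UNIV. k' i)"
    using ex_has_least_nat[of "\<lambda>k. k \<in> D" _ "\<lambda>k. nat (\<Sum>i\<in>UNIV. k i)"] by auto
  have kN: "k \<in> nonneg_cone" "\<And>j. j \<in> J \<Longrightarrow> k j = 0" using k(1) by (auto simp: D_def)
  define a where "a = restr nonneg_cone (conv w (delta k))"
  define c where "c = conv (sharp w) a"
  have a: "a \<in> range_space" unfolding a_def using kN by (intro restr_conv_range_space) simp
  have "a \<noteq> 0" using k(1) w by (auto simp: D_def a_def conv_delta)
  have asupp: "x i = 0" if x: "coef a x \<noteq> 0" and i: "i \<notin> J" for x i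
  proof (rule ccontr)
    assume "x i \<noteq> 0"
    have xN: "x \<in> nonneg_cone" and wx: "coef w (x - k) \<noteq> 0"
      using x w by (auto simp: a_def conv_delta split: if_splits)
    have xi: "0 < x i" using xN \<open>x i \<noteq> 0\<close> by (auto simp: nonneg_cone_def order_less_le)
    then have ki: "0 < k i" using notJ[OF wx i] by simp
    let ?k = "k - unit_index i"
    have kN': "?k \<in> nonneg_cone" "x - unit_index i \<in> nonneg_cone"
      using kN(1) xN ki xi by (auto simp: nonneg_cone_def unit_index_def)
    have "x - unit_index i - ?k = x - k" by simp
    then have "coef (restr nonneg_cone (shift ?k w)) (x - unit_index i) \<noteq> 0" using wx kN' by simp
    then have "restr nonneg_cone (shift ?k w) \<noteq> 0" by (metis coef_simps(1))
    moreover have "\<forall>j\<in>J. ?k j = 0" using kN(2) i by (auto simp: unit_index_def)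
    ultimately have "?k \<in> D" using kN' by (simp add: D_def)
    moreover have "(\<Sum>j\<in>UNIV. ?k j) = (\<Sum>j\<in>UNIV. k j) - 1"
      by (simp add: sum_subtractf unit_index_def)
    moreover have "k i \<le> (\<Sum>j\<in>UNIV. k j)"
      using kN(1) by (intro member_le_sum) (auto simp: nonneg_cone_def)
    ultimately show False using k(2)[of ?k] ki by simp
  qed
  have csupp: "x j = 0" if x: "coef c x \<noteq> 0" and j: "j \<in> J" for x j
  proof (rule ccontr)
    assume "x j \<noteq> 0"
    have xN: "x \<in> nonneg_cone" using a x by (auto simp: c_def range_space_def supp_in_def)
    have xj: "0 < x j" using xN \<open>x j \<noteq> 0\<close> by (auto simp: nonneg_cone_def order_less_le)
    define P where "P h = mult_proj nonneg_cone (sharp w) h" for h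
    define h where "h = delta (x - unit_index j)"
    have hN: "supp_in nonneg_cone h"
      using xN xj by (auto simp: h_def nonneg_cone_def unit_index_def)
    have wh: "coef (conv w h) y = 0" if "y j < 0" for y
      using xj J[OF _ j, of "y - (x - unit_index j)"] that by (auto simp: h_def conv_delta[OF w])
    have "restr nonneg_cone (shift (unit_index j) (conv w h)) = shift (unit_index j) (restr nonneg_cone (conv w h))"
    proof (rule ell2_eqI)
      fix y :: "'n \<Rightarrow> int"
      have "0 \<le> y j" if "y \<in> nonneg_cone" using that by (simp add: nonneg_cone_def)
      then show "coef (restr nonneg_cone (shift (unit_index j) (conv w h))) y =
          coef (shift (unit_index j) (restr nonneg_cone (conv w h))) y"
        using wh[of "y - unit_index j"] nonneg_cone_diff_unit[of y j] by auto
    qed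
    then have "P (shift (unit_index j) h) = shift (unit_index j) (P h)"
      using w by (simp add: P_def mult_proj_def conv_shift)
    then have Pdx: "P (delta x) = shift (unit_index j) (P h)" by (simp add: h_def)
    have "supp_in nonneg_cone (P h)"
      using restr_conv_range_space[OF hN] by (simp add: P_def mult_proj_def range_space_def)
    moreover have "k - unit_index j \<notin> nonneg_cone"
      using kN(2)[OF j] by (auto simp: nonneg_cone_def intro!: exI[of _ j])
    ultimately have "coef (P (delta x)) k = 0" unfolding Pdx by (simp add: supp_in_def)
    moreover have "c = P (delta k)" by (simp add: c_def a_def P_def mult_proj_def)
    then have "coef c x = cinner (P (delta k)) (delta x)" by simp
    then have "coef c x = cinner (delta k) (P (delta x))"
      using w by (simp only: P_def cinner_mult_proj uni_sharp)
    ultimately show False using x by simp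
  qed
  have wc: "conv w c = a" using w by (simp add: c_def)
  have orth_eq: "cinner (shift x c) c = cinner (shift x a) a" for x
    using w by (simp add: c_def conv_shift[symmetric] cinner_conv_left)
  let ?VJ = "{a :: 'n \<Rightarrow> int. \<forall>i\<in>J. a i = 0}" and ?VI = "{a :: 'n \<Rightarrow> int. \<forall>i. i \<notin> J \<longrightarrow> a i = 0}"
  have supp: "supp_in ?VI a" "supp_in ?VJ c" using asupp csupp by (auto simp: supp_in_def)
  have orth: "cinner (shift x a) a = 0" if "x \<noteq> 0" for x
  proof (cases "x \<in> ?VI")
    case False
    then show ?thesis by (intro cinner_shift_disjoint[OF supp(1)]) auto
  next
    case True
    then have "x \<notin> ?VJ" using that by (auto simp: fun_eq_iff)
    then have "cinner (shift x c) c = 0" by (intro cinner_shift_disjoint[OF supp(2)]) auto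
    then show ?thesis by (simp add: orth_eq)
  qed
  have "c \<noteq> 0" "norm c = norm a" using \<open>a \<noteq> 0\<close> w by (auto simp: c_def)
  define r where "r = 1 / complex_of_real (norm a)"
  have "uni (cscale r c)" "uni (cscale r a)"
    using uni_normalize[of c] uni_normalize[of a] orth orth_eq \<open>a \<noteq> 0\<close> \<open>c \<noteq> 0\<close> \<open>norm c = norm a\<close>
    by (auto simp: r_def)
  moreover have "supp_in (nonneg_cone \<inter> ?VJ) (cscale r c)" "supp_in (nonneg_cone \<inter> ?VI) (cscale r a)"
    using a supp by (auto simp: range_space_def supp_in_def simp flip: c_def)
  moreover have "conv w (cscale r c) = cscale r a" using w wc by (simp add: conv_linear)
  ultimately show ?thesis by blast
qed

end

lemma separated_factorization:
  fixes p q :: "('n::finite \<Rightarrow> int) ell2"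
  assumes p: "uni p" "supp_in nonneg_cone p" and q: "uni q" "supp_in nonneg_cone q"
    and comm: "\<And>f. mult_proj nonneg_cone p (mult_proj nonneg_cone q f) = mult_proj nonneg_cone q (mult_proj nonneg_cone p f)"
  shows "\<exists>J u v s. uni u \<and> uni v \<and> uni s \<and> supp_in (nonneg_cone \<inter> {a. \<forall>i\<in>J. a i = 0}) u \<and>
     supp_in (nonneg_cone \<inter> {a. \<forall>i. i \<notin> J \<longrightarrow> a i = 0}) v \<and> supp_in nonneg_cone s \<and>
     conv u s = p \<and> conv v s = q"
proof -
  let ?w = "conv (sharp p) q"
  have "commuting_symbol ?w"
    using p(1) q(1) comm mult_proj_commute_iff[OF p(1) q(1), of nonneg_cone] by unfold_locales auto
  from commuting_symbol.separated_symbols[OF this]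
  obtain J u v where "uni u \<and> uni v \<and> supp_in (nonneg_cone \<inter> {a. \<forall>i\<in>J. a i = 0}) u \<and>
     supp_in (nonneg_cone \<inter> {a. \<forall>i. i \<notin> J \<longrightarrow> a i = 0}) v \<and> conv ?w u = v"
    by (elim exE)
  then have u: "uni u" "supp_in (nonneg_cone \<inter> {a. \<forall>i\<in>J. a i = 0}) u"
    and v: "uni v" "supp_in (nonneg_cone \<inter> {a. \<forall>i. i \<notin> J \<longrightarrow> a i = 0}) v" and w: "conv ?w u = v"
    by simp_all
  define s where "s = conv (sharp u) p"
  have us: "conv u s = p" and "uni s" using u p by (simp_all add: s_def)
  have "conv p v = conv q u" using w p q u by (simp add: conv_assoc flip: w)
  then have "conv (sharp v) (conv (sharp u) (conv v p)) = conv (sharp v) (conv (sharp u) (conv u q))"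
    using p q u v by (simp add: conv_commute)
  then have s': "s = conv (sharp v) q"
    using p q u v by (simp add: s_def conv_left_commute[of "sharp v" "sharp u"])
  then have vs: "conv v s = q" using v by simp
  have "supp_in {a. \<forall>i\<in>J. 0 \<le> a i} s"
    unfolding s_def using u p
    by (intro supp_in_conv[where A = nonneg_cone and B = "uminus ` (nonneg_cone \<inter> {a. \<forall>i\<in>J. a i = 0})"] supp_in_sharp)
      (auto simp: nonneg_cone_def)
  moreover have "supp_in {a. \<forall>i. i \<notin> J \<longrightarrow> 0 \<le> a i} s"
    unfolding s' using v q
    by (intro supp_in_conv[where A = nonneg_cone and B = "uminus ` (nonneg_cone \<inter> {a. \<forall>i. i \<notin> J \<longrightarrow> a i = 0})"] supp_in_sharp)
      (auto simp: nonneg_cone_def)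
  ultimately have "supp_in nonneg_cone s" by (auto simp: supp_in_def nonneg_cone_def)
  then show ?thesis using u v us vs \<open>uni s\<close> by blast
qed

text \<open>Write \<open>P = P\<^sub>A P\<^sub>B\<close>, where \<open>A\<close> constrains the coordinates in \<open>J\<close> and \<open>B\<close> the others. Since \<open>u\<close> commutes with
  \<open>P\<^sub>A\<close> and \<open>v\<close> with \<open>P\<^sub>B\<close>, the projection of the quotient \<open>v / u\<close> is \<open>u\<^sup>-\<^sup>1 P\<^sub>B u\<close> times \<open>F = v P\<^sub>A v\<^sup>-\<^sup>1\<close>. The range of the
  first contains that of \<open>P\<^sub>B\<close>, and the range of the second lies in that of \<open>P\<^sub>A\<close>.\<close>

lemma separated_imp_commute:
  fixes u v s :: "('n::finite \<Rightarrow> int) ell2"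
  assumes u: "uni u" "supp_in (nonneg_cone \<inter> {a. \<forall>i\<in>J. a i = 0}) u"
    and v: "uni v" "supp_in (nonneg_cone \<inter> {a. \<forall>i. i \<notin> J \<longrightarrow> a i = 0}) v" and s: "uni s"
  shows "mult_proj nonneg_cone (conv u s) (mult_proj nonneg_cone (conv v s) f) =
    mult_proj nonneg_cone (conv v s) (mult_proj nonneg_cone (conv u s) f)"
proof -
  let ?A = "{a :: 'n \<Rightarrow> int. \<forall>i\<in>J. 0 \<le> a i}" and ?B = "{a :: 'n \<Rightarrow> int. \<forall>i. i \<notin> J \<longrightarrow> 0 \<le> a i}"
  let ?w = "conv (sharp u) v"
  have N: "restr nonneg_cone f = restr ?A (restr ?B f)" for f :: "('n \<Rightarrow> int) ell2"
    by (rule ell2_eqI) (auto simp: nonneg_cone_def)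
  have AB: "restr ?A (restr ?B f) = restr ?B (restr ?A f)" for f :: "('n \<Rightarrow> int) ell2"
    by (rule ell2_eqI) auto
  have uA: "restr ?A (conv u f) = conv u (restr ?A f)" for f
    by (rule restr_conv[OF u]) auto
  have uA': "restr ?A (conv (sharp u) f) = conv (sharp u) (restr ?A f)" for f
    by (rule restr_conv[OF _ supp_in_sharp[OF u(2)]]) (use u in auto)
  have vB: "restr ?B (conv v f) = conv v (restr ?B f)" for f
    by (rule restr_conv[OF v]) auto
  have vB': "restr ?B (conv (sharp v) f) = conv (sharp v) (restr ?B f)" for f
    by (rule restr_conv[OF _ supp_in_sharp[OF v(2)]]) (use v in auto)
  have uB: "restr ?B (conv (sharp u) (restr ?B f)) = restr ?B (conv (sharp u) f)" for f
    by (rule restr_conv_sharp[OF u]) (auto simp: nonneg_cone_def)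
  have uB': "restr ?B (conv u (restr ?B f)) = conv u (restr ?B f)" for f
    unfolding supp_in_iff_restr[symmetric]
    by (rule supp_in_conv[OF u, where A = ?B]) (auto simp: nonneg_cone_def)
  have vA: "restr ?A (conv (sharp v) (restr ?A f)) = restr ?A (conv (sharp v) f)" for f
    by (rule restr_conv_sharp[OF v]) (auto simp: nonneg_cone_def)
  have vA': "restr ?A (conv v (restr ?A f)) = conv v (restr ?A f)" for f
    unfolding supp_in_iff_restr[symmetric]
    by (rule supp_in_conv[OF v, where A = ?A]) (auto simp: nonneg_cone_def)
  define F where "F f = conv v (restr ?A (conv (sharp v) f))" for f
  have mp: "mult_proj nonneg_cone ?w f = conv (sharp u) (restr ?B (conv u (F f)))" for f
  proof -
    have "mult_proj nonneg_cone ?w f = conv (sharp u) (conv v (restr ?B (restr ?A (conv u (conv (sharp v) f)))))"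
      using u v by (simp add: mult_proj_def N AB sharp_conv conv_assoc del: restr_simps)
    also have "\<dots> = conv (sharp u) (restr ?B (conv v (conv u (restr ?A (conv (sharp v) f)))))"
      by (simp only: uA vB)
    also have "conv v (conv u (restr ?A (conv (sharp v) f))) = conv u (F f)"
      unfolding F_def by (rule conv_left_commute[OF v(1) u(1)])
    finally show ?thesis .
  qed
  have "restr nonneg_cone (mult_proj nonneg_cone ?w f) = mult_proj nonneg_cone ?w (restr nonneg_cone f)" for f
  proof -
    have "restr nonneg_cone (mult_proj nonneg_cone ?w f) = restr ?A (restr ?B (F f))"
      unfolding N mp uB using u by simp
    also have "\<dots> = restr ?B (F f)" unfolding AB F_def vA' ..
    finally have 1: "restr nonneg_cone (mult_proj nonneg_cone ?w f) = restr ?B (F f)" .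
    have "F (restr ?A (restr ?B f)) = F (restr ?B f)" unfolding F_def vA ..
    also have "F (restr ?B f) = conv v (restr ?A (restr ?B (conv (sharp v) f)))"
      unfolding F_def vB' ..
    also have "\<dots> = restr ?B (F f)" unfolding AB vB[symmetric] F_def ..
    finally have "mult_proj nonneg_cone ?w (restr nonneg_cone f) = conv (sharp u) (restr ?B (conv u (restr ?B (F f))))"
      unfolding N mp by simp
    also have "\<dots> = restr ?B (F f)" unfolding uB' using u by simp
    finally show ?thesis using 1 by simp
  qed
  moreover have "conv (sharp (conv u s)) (conv v s) = ?w"
    using u v s by (simp add: sharp_conv conv_assoc) (simp add: conv_left_commute[of "sharp s" v] conv_commute)
  ultimately show ?thesis
    using mult_proj_commute_iff[of "conv u s" "conv v s" nonneg_cone] u v s by simp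
qed

section \<open>The torus as a product of circles\<close>

definition circle_measure :: "complex measure" where
  "circle_measure = distr (uniform_measure lborel {0..1}) borel (\<lambda>t. cis (2 * pi * t))"

lemma sets_circle_measure [simp, measurable_cong]: "sets circle_measure = sets borel"
  and space_circle_measure [simp]: "space circle_measure = UNIV"
  by (simp_all add: circle_measure_def)

lemma cis_borel [measurable]: "(\<lambda>t. cis (2 * pi * t)) \<in> borel_measurable borel"
  by (intro borel_measurable_continuous_onI continuous_intros)

interpretation circle: prob_space circle_measure
  unfolding circle_measure_def
  by (intro prob_space.prob_space_distr prob_space_uniform_measure) auto

lemma sets_torus_measure [simp, measurable_cong]: "sets torus_measure = sets borel"
  and space_torus_measure [simp]: "space torus_measure = UNIV"
  by (simp_all add: torus_measure_def)

lemma vec_nth_borel [measurable]: "(\<lambda>z :: 'b::euclidean_space ^ 'n. z $ i) \<in> borel_measurable borel"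
  by (intro borel_measurable_continuous_onI continuous_intros)

lemma vec_lambda_borel [measurable (raw)]:
  fixes f :: "'n::finite \<Rightarrow> 'a \<Rightarrow> 'b::euclidean_space"
  assumes "\<And>i. f i \<in> borel_measurable M"
  shows "(\<lambda>x. \<chi> i. f i x) \<in> borel_measurable M"
proof (subst borel_measurable_euclidean_space, intro ballI)
  fix b :: "'b ^ 'n" assume "b \<in> Basis"
  then obtain i c where "b = axis i c" "c \<in> Basis" by (auto simp: Basis_vec_def)
  then show "(\<lambda>x. (\<chi> i. f i x) \<bullet> b) \<in> borel_measurable M"
    using assms[of i] by (simp add: inner_axis)
qed

lemma emeasure_lborel_vec:
  fixes B :: "'n::finite \<Rightarrow> real set"
  assumes B: "\<And>i. B i \<in> sets borel"
  shows "emeasure lborel {t :: real ^ 'n. \<forall>i. t $ i \<in> B i} = (\<Prod>i\<in>UNIV. emeasure lborel (B i))"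
proof -
  interpret product_sigma_finite "\<lambda>_ :: 'n. lborel :: real measure" by standard
  let ?P = "PiM UNIV (\<lambda>_ :: 'n. lborel :: real measure)"
  have v: "(\<lambda>x. \<chi> i. x i) \<in> measurable ?P (borel :: (real ^ 'n) measure)"
    by (intro vec_lambda_borel) simp
  have rect: "emeasure (distr ?P borel (\<lambda>x. \<chi> i. x i)) {t. \<forall>i. t $ i \<in> B i} = (\<Prod>i\<in>UNIV. emeasure lborel (B i))"
    if B: "\<And>i. B i \<in> sets borel" for B :: "'n \<Rightarrow> real set"
  proof -
    have "(\<lambda>x. \<chi> i. x i) -` {t. \<forall>i. t $ i \<in> B i} \<inter> space ?P = Pi\<^sub>E UNIV B"
      by (auto simp: space_PiM PiE_iff)
    moreover have "{t :: real ^ 'n. \<forall>i. t $ i \<in> B i} \<in> sets borel" using B by measurable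
    ultimately show ?thesis
      using B by (simp add: emeasure_distr[OF v] emeasure_PiM)
  qed
  have "(lborel :: (real ^ 'n) measure) = distr ?P borel (\<lambda>x. \<chi> i. x i)"
  proof (rule lborel_eqI)
    fix l u :: "real ^ 'n" assume le: "\<And>b. b \<in> Basis \<Longrightarrow> l \<bullet> b \<le> u \<bullet> b"
    have le': "l $ i \<le> u $ i" for i using le[of "axis i 1"] by (simp add: cart_eq_inner_axis)
    have "box l u = {t. \<forall>i. t $ i \<in> {l $ i <..< u $ i}}" by (auto simp: mem_box_cart)
    then have "emeasure (distr ?P borel (\<lambda>x. \<chi> i. x i)) (box l u) = (\<Prod>i\<in>UNIV. emeasure lborel {l $ i <..< u $ i})"
      using rect[of "\<lambda>i. {l $ i <..< u $ i}"] by simp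
    also have "\<dots> = ennreal (\<Prod>i\<in>UNIV. u $ i - l $ i)"
      using le' by (simp add: prod_ennreal)
    also have "(\<Prod>i\<in>UNIV. u $ i - l $ i) = (\<Prod>b\<in>Basis. (u - l) \<bullet> b)"
    proof -
      have "Basis = (\<lambda>i :: 'n. axis i (1 :: real)) ` UNIV" by (auto simp: Basis_vec_def)
      moreover have "inj (\<lambda>i :: 'n. axis i (1 :: real))" by (auto simp: inj_on_def axis_eq_axis)
      ultimately have "(\<Prod>i\<in>UNIV. (u - l) \<bullet> axis i 1) = (\<Prod>b\<in>Basis. (u - l) \<bullet> b)"
        by (intro prod.reindex_bij_betw) (auto simp: bij_betw_def)
      then show ?thesis by (simp add: inner_axis)
    qed
    finally show "emeasure (distr ?P borel (\<lambda>x. \<chi> i. x i)) (box l u) = (\<Prod>b\<in>Basis. (u - l) \<bullet> b)" .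
  qed simp
  then show ?thesis using rect[OF B] by simp
qed

lemma emeasure_torus_rectangle:
  fixes A :: "'n::finite \<Rightarrow> complex set"
  assumes A: "\<And>i. A i \<in> sets borel"
  shows "emeasure torus_measure {z. \<forall>i. z $ i \<in> A i} = (\<Prod>i\<in>UNIV. emeasure circle_measure (A i))"
proof -
  define B where "B i = {t. cis (2 * pi * t) \<in> A i}" for i
  have B[measurable]: "B i \<in> sets borel" for i
    unfolding B_def using A[of i] by measurable
  have m: "(\<lambda>t. \<chi> j. cis (2 * pi * t $ j)) \<in> measurable (uniform_measure lborel (cbox 0 1)) (borel :: (complex ^ 'n) measure)"
    by measurable
  have rA: "{z :: complex ^ 'n. \<forall>i. z $ i \<in> A i} \<in> sets borel" using A by measurable
  have rB: "{t :: real ^ 'n. \<forall>i. t $ i \<in> B i} \<in> sets borel" by measurable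
  have cb: "cbox 0 1 = {t :: real ^ 'n. \<forall>i. t $ i \<in> {0..1}}" by (auto simp: mem_box_cart)
  have one: "emeasure lborel (cbox 0 1 :: (real ^ 'n) set) = 1"
    unfolding cb by (subst emeasure_lborel_vec) auto
  have "emeasure torus_measure {z. \<forall>i. z $ i \<in> A i} =
      emeasure (uniform_measure lborel (cbox 0 1)) {t :: real ^ 'n. \<forall>i. t $ i \<in> B i}"
    unfolding torus_measure_def by (subst emeasure_distr[OF m rA]) (simp add: B_def vimage_def)
  also have "\<dots> = emeasure lborel (cbox 0 1 \<inter> {t :: real ^ 'n. \<forall>i. t $ i \<in> B i})"
    using rB one by (simp add: divide_ennreal_def)
  also have "cbox 0 1 \<inter> {t :: real ^ 'n. \<forall>i. t $ i \<in> B i} = {t. \<forall>i. t $ i \<in> {0..1} \<inter> B i}"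
    unfolding cb by auto
  also have "emeasure lborel \<dots> = (\<Prod>i\<in>UNIV. emeasure lborel ({0..1} \<inter> B i))"
    by (rule emeasure_lborel_vec) auto
  also have "\<dots> = (\<Prod>i\<in>UNIV. emeasure circle_measure (A i))"
  proof (rule prod.cong[OF refl])
    fix i
    have "emeasure circle_measure (A i) = emeasure (uniform_measure lborel {0..1}) (B i)"
      unfolding circle_measure_def using A[of i] by (subst emeasure_distr) (auto simp: B_def vimage_def)
    then show "emeasure lborel ({0..1} \<inter> B i) = emeasure circle_measure (A i)"
      by (simp add: divide_ennreal_def)
  qed
  finally show ?thesis .
qed

text \<open>This characterizes both the torus measure and its image under a mixing of coordinates, so that the two
  coincide.\<close>

lemma torus_measure_eqI:
  fixes \<mu> :: "(complex ^ 'n::finite) measure"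
  assumes "sets \<mu> = sets borel"
    and "\<And>A. (\<And>i. A i \<in> sets borel) \<Longrightarrow> emeasure \<mu> {z. \<forall>i. z $ i \<in> A i} = (\<Prod>i\<in>UNIV. emeasure circle_measure (A i))"
  shows "\<mu> = distr (PiM UNIV (\<lambda>_ :: 'n. circle_measure)) borel (\<lambda>x. \<chi> i. x i)"
proof -
  interpret product_sigma_finite "\<lambda>_ :: 'n. circle_measure" by standard
  let ?P = "PiM UNIV (\<lambda>_ :: 'n. circle_measure)"
  note [measurable_cong] = assms(1)
  have sp: "space \<mu> = UNIV" using assms(1) by (metis sets_eq_imp_space_eq space_borel)
  have m: "(\<lambda>z i. z $ i) \<in> measurable \<mu> ?P"
    by (rule measurable_PiM_single') (auto simp: sp space_PiM)
  have "distr \<mu> ?P (\<lambda>z i. z $ i) = ?P"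
  proof (rule PiM_eqI)
    fix A :: "'n \<Rightarrow> complex set" assume A: "\<And>i. i \<in> UNIV \<Longrightarrow> A i \<in> sets circle_measure"
    have "Pi\<^sub>E UNIV A \<in> sets ?P" using A by (intro sets_PiM_I_finite) auto
    then have "emeasure (distr \<mu> ?P (\<lambda>z i. z $ i)) (Pi\<^sub>E UNIV A) = emeasure \<mu> {z. \<forall>i. z $ i \<in> A i}"
      by (subst emeasure_distr[OF m]) (auto simp: sp PiE_iff intro!: arg_cong[where f = "emeasure \<mu>"])
    then show "emeasure (distr \<mu> ?P (\<lambda>z i. z $ i)) (Pi\<^sub>E UNIV A) = (\<Prod>i\<in>UNIV. emeasure circle_measure (A i))"
      using assms(2)[of A] A by simp
  qed auto
  then have "distr ?P borel (\<lambda>x. \<chi> i. x i) = distr (distr \<mu> ?P (\<lambda>z i. z $ i)) borel (\<lambda>x. (\<chi> i. x i) :: complex ^ 'n)"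
    by simp
  also have "\<dots> = distr \<mu> borel (\<lambda>z. z)"
    by (subst distr_distr) (auto simp: o_def m)
  also have "\<dots> = \<mu>" using assms(1) by (intro distr_id2) simp
  finally show ?thesis by simp
qed

lemma torus_measure_eq_PiM:
  "torus_measure = distr (PiM UNIV (\<lambda>_ :: 'n::finite. circle_measure)) borel (\<lambda>x. \<chi> i. x i)"
  by (rule torus_measure_eqI) (simp_all add: emeasure_torus_rectangle)

interpretation torus: prob_space "torus_measure :: (complex ^ 'n::finite) measure"
proof
  have "{z :: complex ^ 'n. \<forall>i. z $ i \<in> UNIV} = UNIV" by simp
  then show "emeasure torus_measure (space torus_measure :: (complex ^ 'n) set) = 1"
    using emeasure_torus_rectangle[of "\<lambda>_ :: 'n. UNIV"] circle.emeasure_space_1 by simp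
qed

text \<open>Take the coordinates in \<open>J\<close> from one point and the others from a second one. Since the
  coordinates are independent, mixing two independent random points gives a random point.\<close>

definition mix :: "'n set \<Rightarrow> 'b ^ 'n \<Rightarrow> 'b ^ 'n \<Rightarrow> 'b ^ 'n" where
  "mix J z z' = (\<chi> i. if i \<in> J then z $ i else z' $ i)"

lemma mix_nth [simp]: "mix J z z' $ i = (if i \<in> J then z $ i else z' $ i)"
  by (simp add: mix_def)

lemma mix_measurable [measurable]:
  "(\<lambda>x. mix J (fst x) (snd x)) \<in> measurable (torus_measure \<Otimes>\<^sub>M torus_measure) (borel :: (complex ^ 'n::finite) measure)"
  unfolding mix_def by measurable

interpretation torus_pair: pair_prob_space "torus_measure :: (complex ^ 'n::finite) measure"
  "torus_measure :: (complex ^ 'n::finite) measure" ..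

lemma distr_mix:
  "distr (torus_measure \<Otimes>\<^sub>M torus_measure) borel (\<lambda>x. mix J (fst x) (snd x)) = (torus_measure :: (complex ^ 'n::finite) measure)"
proof -
  let ?D = "distr (torus_measure \<Otimes>\<^sub>M torus_measure) borel (\<lambda>x. mix J (fst x) (snd x)) :: (complex ^ 'n) measure"
  have "emeasure ?D {z. \<forall>i. z $ i \<in> A i} = (\<Prod>i\<in>UNIV. emeasure circle_measure (A i))"
    if A[measurable]: "\<And>i. A i \<in> sets borel" for A
  proof -
    have rect: "{z :: complex ^ 'n. \<forall>i. z $ i \<in> A i} \<in> sets borel" by measurable
    let ?X = "{z :: complex ^ 'n. \<forall>i. z $ i \<in> (if i \<in> J then A i else UNIV)}"
    let ?Y = "{z :: complex ^ 'n. \<forall>i. z $ i \<in> (if i \<in> J then UNIV else A i)}"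
    have "{z :: complex ^ 'n. \<forall>i. z $ i \<in> B i} \<in> sets borel" if [measurable]: "\<And>i. B i \<in> sets borel" for B
      by measurable
    from this[of "\<lambda>i. if i \<in> J then A i else UNIV"] this[of "\<lambda>i. if i \<in> J then UNIV else A i"]
    have XY: "?X \<in> sets borel" "?Y \<in> sets borel" using A by auto
    have "(\<forall>i. mix J z z' $ i \<in> A i) \<longleftrightarrow> z \<in> ?X \<and> z' \<in> ?Y" for z z' :: "complex ^ 'n"
      by (simp add: if_distrib[where f = "\<lambda>S. _ \<in> S"] flip: all_conj_distrib)
    then have "(\<lambda>x. mix J (fst x) (snd x)) -` {z. \<forall>i. z $ i \<in> A i} \<inter> space (torus_measure \<Otimes>\<^sub>M torus_measure) = ?X \<times> ?Y"
      by (auto simp: space_pair_measure simp del: mix_nth)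
    then have "emeasure ?D {z. \<forall>i. z $ i \<in> A i} = emeasure (torus_measure \<Otimes>\<^sub>M torus_measure) (?X \<times> ?Y)"
      by (simp only: emeasure_distr[OF mix_measurable rect])
    also have "\<dots> = emeasure torus_measure ?X * emeasure torus_measure ?Y"
      using XY by (intro torus.emeasure_pair_measure_Times) auto
    also have "\<dots> = (\<Prod>i\<in>UNIV. emeasure circle_measure (if i \<in> J then A i else UNIV)) *
        (\<Prod>i\<in>UNIV. emeasure circle_measure (if i \<in> J then UNIV else A i))"
      by (intro arg_cong2[where f = "(*)"] emeasure_torus_rectangle) auto
    also have "\<dots> = (\<Prod>i\<in>UNIV. emeasure circle_measure (A i))"
      unfolding prod.distrib[symmetric]
      using circle.emeasure_space_1 by (intro prod.cong) auto
    finally show ?thesis .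
  qed
  from torus_measure_eqI[OF _ this] show ?thesis by (simp add: torus_measure_eq_PiM)
qed

text \<open>Fubini's theorem for the splitting of the coordinates into \<open>J\<close> and its complement: the remaining coordinates
  are resampled in the inner integral.\<close>

lemma torus_integral_mix:
  fixes G :: "complex ^ 'n::finite \<Rightarrow> complex"
  assumes G: "integrable torus_measure G"
  shows "integral\<^sup>L torus_measure G = (\<integral>z. (\<integral>z'. G (mix J z z') \<partial>torus_measure) \<partial>torus_measure)"
proof -
  have Gm: "G \<in> borel_measurable borel" using borel_measurable_integrable[OF G] by simp
  have "integrable (torus_measure \<Otimes>\<^sub>M torus_measure) (\<lambda>x. G (mix J (fst x) (snd x)))"
    using G by (intro integrable_distr[OF mix_measurable]) (simp add: distr_mix)
  then have "(\<integral>z. (\<integral>z'. G (mix J z z') \<partial>torus_measure) \<partial>torus_measure) =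
      integral\<^sup>L (torus_measure \<Otimes>\<^sub>M torus_measure) (\<lambda>x. G (mix J (fst x) (snd x)))"
    using torus_pair.integral_fst'[of "\<lambda>x. G (mix J (fst x) (snd x))"] by simp
  also have "\<dots> = integral\<^sup>L (distr (torus_measure \<Otimes>\<^sub>M torus_measure) borel (\<lambda>x. mix J (fst x) (snd x))) G"
    by (rule integral_distr[OF mix_measurable Gm, symmetric])
  finally show ?thesis by (simp add: distr_mix)
qed

lemma AE_torus_mix:
  assumes "AE z in torus_measure. P (z :: complex ^ 'n::finite)"
  shows "AE z in torus_measure. AE z' in torus_measure. P (mix J z z')"
proof -
  have "AE z in distr (torus_measure \<Otimes>\<^sub>M torus_measure) borel (\<lambda>x. mix J (fst x) (snd x)). P z"
    unfolding distr_mix by (rule assms)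
  from torus_pair.AE_pair[OF AE_distrD[OF mix_measurable this]] show ?thesis by simp
qed

lemma torus_integral_prod:
  fixes g :: "'n::finite \<Rightarrow> complex \<Rightarrow> complex"
  assumes "\<And>i. integrable circle_measure (g i)"
  shows "(\<integral>z. (\<Prod>i\<in>UNIV. g i (z $ i)) \<partial>torus_measure) = (\<Prod>i\<in>UNIV. integral\<^sup>L circle_measure (g i))"
proof -
  interpret product_sigma_finite "\<lambda>_ :: 'n. circle_measure" by standard
  have [measurable]: "g i \<in> borel_measurable borel" for i
    using borel_measurable_integrable[OF assms[of i]] by simp
  have "(\<integral>z. (\<Prod>i\<in>UNIV. g i (z $ i)) \<partial>torus_measure) =
      (\<integral>x. (\<Prod>i\<in>UNIV. g i (x i)) \<partial>PiM UNIV (\<lambda>_ :: 'n. circle_measure))"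
    unfolding torus_measure_eq_PiM
    by (subst integral_distr) (auto intro!: vec_lambda_borel)
  also have "\<dots> = (\<Prod>i\<in>UNIV. integral\<^sup>L circle_measure (g i))"
    using assms by (intro product_integral_prod) auto
  finally show ?thesis .
qed

lemma distr_torus_nth: "distr torus_measure borel (\<lambda>z :: complex ^ 'n::finite. z $ i) = circle_measure"
proof (rule measure_eqI)
  fix A assume "A \<in> sets (distr torus_measure borel (\<lambda>z :: complex ^ 'n. z $ i))"
  then have A[measurable]: "A \<in> sets borel" by simp
  have "emeasure (distr torus_measure borel (\<lambda>z :: complex ^ 'n. z $ i)) A =
      emeasure torus_measure {z :: complex ^ 'n. \<forall>j. z $ j \<in> (if j = i then A else UNIV)}"
    by (subst emeasure_distr) (auto simp: intro!: arg_cong[where f = "emeasure _"])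
  also have "\<dots> = (\<Prod>j\<in>UNIV. emeasure circle_measure (if j = i then A else UNIV))"
    by (rule emeasure_torus_rectangle) auto
  also have "\<dots> = (\<Prod>j\<in>{i}. emeasure circle_measure A)"
    using circle.emeasure_space_1 by (intro prod.mono_neutral_cong_right) auto
  finally show "emeasure (distr torus_measure borel (\<lambda>z :: complex ^ 'n. z $ i)) A = emeasure circle_measure A"
    by simp
qed simp

lemma AE_torus_norm: "AE z in torus_measure. \<forall>i. cmod ((z :: complex ^ 'n::finite) $ i) = 1"
  unfolding torus_measure_def by (subst AE_distr_iff) (auto intro!: AE_I2)

lemma circle_integral:
  fixes F :: "complex \<Rightarrow> complex"
  assumes F: "F \<in> borel_measurable borel" and cont: "continuous_on {0..1} (\<lambda>t. F (cis (2 * pi * t)))"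
  shows "integral\<^sup>L circle_measure F = integral {0..1} (\<lambda>t. F (cis (2 * pi * t)))"
    and "integrable circle_measure F"
proof -
  note [measurable] = F
  have U: "uniform_measure lborel {0..1} = density lborel (\<lambda>t. ennreal (indicator {0..1 :: real} t))"
    unfolding uniform_measure_def by (intro density_cong) (auto split: split_indicator)
  have si: "set_integrable lborel {0..1} (\<lambda>t. F (cis (2 * pi * t)))"
    by (rule borel_integrable_atLeastAtMost'[OF cont])
  have "integral\<^sup>L circle_measure F = (LBINT t:{0..1}. F (cis (2 * pi * t)))"
    unfolding circle_measure_def U set_lebesgue_integral_def
    by (subst integral_distr) (auto simp: integral_density)
  also have "\<dots> = integral {0..1} (\<lambda>t. F (cis (2 * pi * t)))"
    using si by (rule set_borel_integral_eq_integral)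
  finally show "integral\<^sup>L circle_measure F = integral {0..1} (\<lambda>t. F (cis (2 * pi * t)))" .
  show "integrable circle_measure F"
    using si unfolding circle_measure_def U set_integrable_def
    by (subst integrable_distr_eq) (auto simp: integrable_density)
qed

lemma circle_integral_power:
  "(\<integral>z. z ^ m * cnj z ^ n \<partial>circle_measure) = (if m = n then 1 else 0)"
  "integrable circle_measure (\<lambda>z. z ^ m * cnj z ^ n)"
proof -
  have meas: "(\<lambda>z :: complex. z ^ m * cnj z ^ n) \<in> borel_measurable borel"
    by (intro borel_measurable_continuous_onI continuous_intros)
  have cont: "continuous_on {0..1} (\<lambda>t. cis (2 * pi * t) ^ m * cnj (cis (2 * pi * t)) ^ n)"
    by (intro continuous_intros)
  note * = circle_integral[OF meas cont]
  show "integrable circle_measure (\<lambda>z. z ^ m * cnj z ^ n)" by (rule *)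
  define k where "k = real m - real n"
  have e: "cis (2 * pi * t) ^ m * cnj (cis (2 * pi * t)) ^ n = cis (2 * pi * k * t)" for t
    by (simp add: Complex.DeMoivre cis_cnj cis_mult k_def algebra_simps)
  have "((\<lambda>t. cis (2 * pi * k * t)) has_integral (if m = n then 1 else 0)) {0..1}"
  proof (cases "m = n")
    case True
    then show ?thesis using has_integral_const_real[of "1 :: complex" 0 1] by (simp add: k_def)
  next
    case False
    then have k: "k \<noteq> 0" by (simp add: k_def)
    have "((\<lambda>t. cis (2 * pi * k * t)) has_integral
        cis (2 * pi * k * 1) / (\<i> * of_real (2 * pi * k)) - cis (2 * pi * k * 0) / (\<i> * of_real (2 * pi * k))) {0..1}"
    proof (rule fundamental_theorem_of_calculus)
      fix t :: real
      have "((\<lambda>t. exp (\<i> * of_real (2 * pi * k) * of_real t) / (\<i> * of_real (2 * pi * k))) has_vector_derivative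
          exp (\<i> * of_real (2 * pi * k) * of_real t)) (at t within {0..1})"
        using k by (auto intro!: derivative_eq_intros has_vector_derivative_real_field simp: field_simps)
      then show "((\<lambda>t. cis (2 * pi * k * t) / (\<i> * of_real (2 * pi * k))) has_vector_derivative cis (2 * pi * k * t)) (at t within {0..1})"
        by (simp add: cis_conv_exp mult_ac)
    qed simp
    moreover have "cis (2 * pi * k) = 1"
    proof -
      have "k \<in> \<int>" by (simp add: k_def)
      then show ?thesis using cis_multiple_2pi[of k] by (simp add: mult_ac)
    qed
    ultimately show ?thesis using False by simp
  qed
  then have "integral {0..1} (\<lambda>t. cis (2 * pi * k * t)) = (if m = n then 1 else 0)" by (rule integral_unique)
  then show "(\<integral>z. z ^ m * cnj z ^ n \<partial>circle_measure) = (if m = n then 1 else 0)"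
    using *(1) by (simp only: e)
qed

lemma circle_cauchy_formula:
  assumes g: "g holomorphic_on ball 0 1" "g \<in> borel_measurable borel" and w: "cmod w < r" and r: "r < 1"
  shows "g w = (\<integral>z. g (of_real r * z) / (1 - w * cnj z / of_real r) \<partial>circle_measure)"
proof -
  have r0: "0 < r" using w norm_ge_zero[of w] by linarith
  have sub: "cball 0 r \<subseteq> ball (0 :: complex) 1" using r by auto
  define F where "F z = g (of_real r * z) / (1 - w * cnj z / of_real r)" for z
  have nz: "1 - w * cnj z / of_real r \<noteq> 0" if "cmod z = 1" for z
  proof
    assume "1 - w * cnj z / of_real r = 0"
    then have "w * cnj z = of_real r" using r0 by (simp add: field_simps)
    then have "cmod (w * cnj z) = r" using r0 by simp
    then show False using w that by (simp add: norm_mult)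
  qed
  have [measurable]: "cnj \<in> borel_measurable borel"
    by (intro borel_measurable_continuous_onI continuous_intros)
  have meas: "F \<in> borel_measurable borel"
    unfolding F_def using g(2) by measurable
  have cont_g: "continuous_on (cball 0 r) g"
    using g(1) sub by (meson holomorphic_on_imp_continuous_on continuous_on_subset)
  have "continuous_on {0..1} (\<lambda>t. g (of_real r * cis (2 * pi * t)))"
    using r0 by (intro continuous_on_compose2[OF cont_g] continuous_intros) (auto simp: norm_mult)
  then have cont: "continuous_on {0..1} (\<lambda>t. F (cis (2 * pi * t)))"
    unfolding F_def using nz r0 by (intro continuous_intros) auto
  have "((\<lambda>u. g u / (u - w)) has_contour_integral (2 * of_real pi * \<i> * g w)) (circlepath 0 r)"
    using g(1) sub w by (intro Cauchy_integral_circlepath_simple) (auto intro: holomorphic_on_subset)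
  then have "((\<lambda>t. g (circlepath 0 r t) / (circlepath 0 r t - w) *
      vector_derivative (circlepath 0 r) (at t within {0..1})) has_integral (2 * of_real pi * \<i> * g w)) {0..1}"
    by (simp add: has_contour_integral_def)
  then have "((\<lambda>t. 2 * of_real pi * \<i> * F (cis (2 * pi * t))) has_integral (2 * of_real pi * \<i> * g w)) {0..1}"
  proof (rule has_integral_eq[rotated])
    fix t :: real assume t: "t \<in> {0..1}"
    let ?e = "cis (2 * pi * t)"
    have c: "circlepath 0 r t = of_real r * ?e"
      by (simp add: circlepath cis_conv_exp mult_ac)
    have d: "vector_derivative (circlepath 0 r) (at t within {0..1}) = 2 * pi * \<i> * of_real r * ?e"
      using t by (simp add: vector_derivative_circlepath01 cis_conv_exp mult_ac)
    have "?e * cnj ?e = 1" by (simp add: cis_cnj cis_mult)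
    then have e: "of_real r * ?e - w = of_real r * ?e * (1 - w * cnj ?e / of_real r)"
      using r0 by (simp add: right_diff_distrib mult.left_commute)
    have "?e \<noteq> 0" "1 - w * cnj ?e / of_real r \<noteq> 0" using nz[of ?e] by auto
    then show "g (circlepath 0 r t) / (circlepath 0 r t - w) * vector_derivative (circlepath 0 r) (at t within {0..1}) =
        2 * of_real pi * \<i> * F ?e"
      unfolding c d F_def e using r0 by simp
  qed
  from has_integral_mult_right[OF this, of "1 / (2 * of_real pi * \<i>)"]
  have "((\<lambda>t. F (cis (2 * pi * t))) has_integral g w) {0..1}" by simp
  then have "g w = integral {0..1} (\<lambda>t. F (cis (2 * pi * t)))" by (simp add: integral_unique)
  then show ?thesis using circle_integral(1)[OF meas cont] by (simp add: F_def)
qed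

lemma measure_torus [simp]: "measure (torus_measure :: (complex ^ 'n::finite) measure) UNIV = 1"
  using torus.prob_space by simp

section \<open>Monomials and multiple geometric series\<close>

definition mon :: "('n \<Rightarrow> int) \<Rightarrow> complex ^ 'n \<Rightarrow> complex" where
  "mon a z = (\<Prod>i\<in>UNIV. z $ i ^ nat (a i))"

definition deg :: "('n::finite \<Rightarrow> int) \<Rightarrow> nat" where
  "deg a = (\<Sum>i\<in>UNIV. nat (a i))"

lemma mon_add:
  assumes "a \<in> nonneg_cone" "b \<in> nonneg_cone"
  shows "mon (a + b) z = mon a z * mon b z"
  using assms by (simp add: mon_def nonneg_cone_def nat_add_distrib power_add prod.distrib)

lemma mon_0 [simp]: "mon 0 z = 1"
  by (simp add: mon_def)

lemma mon_scaleR: "mon a (r *\<^sub>R z) = of_real r ^ deg a * mon a z"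
  by (simp add: mon_def deg_def scaleR_conv_of_real[where 'a = complex] power_mult_distrib prod.distrib power_sum)

lemma norm_mon: "cmod (mon a z) = (\<Prod>i\<in>UNIV. cmod (z $ i) ^ nat (a i))"
  by (simp add: mon_def norm_power prod_norm[symmetric])

lemma norm_mon_le:
  fixes z :: "complex ^ 'n::finite"
  assumes "\<And>i. cmod (z $ i) \<le> \<rho>"
  shows "cmod (mon a z) \<le> \<rho> ^ deg a"
  unfolding norm_mon deg_def power_sum
  using assms by (intro prod_mono) (auto intro: power_mono)

lemma norm_mon_torus: "(\<And>i. cmod ((z :: complex ^ 'n::finite) $ i) = 1) \<Longrightarrow> cmod (mon a z) = 1"
  by (simp add: norm_mon)

lemma mon_borel [measurable]: "mon a \<in> borel_measurable borel"
  unfolding mon_def by (intro borel_measurable_continuous_onI continuous_intros)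

lemma nonneg_cone_PiE: "nonneg_cone = Pi\<^sub>E UNIV (\<lambda>_. {0..})"
  by (auto simp: nonneg_cone_def)

lemma geometric_has_sum_int:
  fixes x :: "'c :: {real_normed_field, banach}"
  assumes "norm x < 1"
  shows "((\<lambda>k. x ^ nat k) has_sum 1 / (1 - x)) {0..}"
proof -
  have "((\<lambda>k. x ^ k) has_sum 1 / (1 - x)) UNIV"
    using assms by (intro norm_summable_imp_has_sum geometric_sums) (simp_all add: norm_power summable_geometric)
  then have "((\<lambda>k. x ^ nat k) \<circ> int has_sum 1 / (1 - x)) UNIV" by (simp add: o_def)
  then have "((\<lambda>k. x ^ nat k) has_sum 1 / (1 - x)) (range int)"
    by (subst has_sum_reindex) auto
  moreover have "range int = {0..}" by (auto simp: image_def intro: zero_le_imp_eq_int)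
  ultimately show ?thesis by simp
qed

lemma infsum_geometric_prod:
  fixes x :: "'n::finite \<Rightarrow> 'c :: {real_normed_field, banach}"
  assumes "\<And>i. norm (x i) < 1"
  shows "(\<Sum>\<^sub>\<infinity>a\<in>nonneg_cone. \<Prod>i\<in>UNIV. x i ^ nat (a i)) = (\<Prod>i\<in>UNIV. 1 / (1 - x i))"
proof -
  have "(\<lambda>k. x i ^ nat k) abs_summable_on {0..}" for i
    using geometric_has_sum_int[of "norm (x i)"] assms[of i] by (simp add: norm_power has_sum_imp_summable)
  then have "(\<Sum>\<^sub>\<infinity>a\<in>nonneg_cone. \<Prod>i\<in>UNIV. x i ^ nat (a i)) = (\<Prod>i\<in>UNIV. \<Sum>\<^sub>\<infinity>k\<in>{0..}. x i ^ nat k)"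
    unfolding nonneg_cone_PiE by (intro infsum_prod_PiE_abs) auto
  also have "\<dots> = (\<Prod>i\<in>UNIV. 1 / (1 - x i))"
    using geometric_has_sum_int[OF assms] by (intro prod.cong refl infsumI) auto
  finally show ?thesis .
qed

text \<open>The sum for the absolute values is nonzero, whereas the sum of a family that is not summable is zero by
  convention.\<close>

lemma geometric_prod_abs_summable:
  fixes x :: "'n::finite \<Rightarrow> 'c :: {real_normed_field, banach}"
  assumes "\<And>i. norm (x i) < 1"
  shows "(\<lambda>a. \<Prod>i\<in>UNIV. x i ^ nat (a i)) abs_summable_on nonneg_cone"
proof -
  have *: "(\<Sum>\<^sub>\<infinity>a\<in>nonneg_cone. \<Prod>i\<in>UNIV. norm (x i) ^ nat (a i)) = (\<Prod>i\<in>UNIV. 1 / (1 - norm (x i)))"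
    using assms by (intro infsum_geometric_prod) simp
  have "1 - norm (x i) \<noteq> 0" for i using assms[of i] by simp
  then have "(\<Prod>i\<in>UNIV. 1 / (1 - norm (x i))) \<noteq> 0" by simp
  then have "(\<lambda>a. \<Prod>i\<in>UNIV. norm (x i) ^ nat (a i)) summable_on nonneg_cone"
    unfolding *[symmetric] by (rule contrapos_np) (rule infsum_not_exists)
  then show ?thesis by (simp add: norm_power prod_norm[symmetric])
qed

lemma power_deg_summable:
  assumes "0 \<le> \<rho>" "\<rho> < (1 :: real)"
  shows "(\<lambda>a :: 'n::finite \<Rightarrow> int. \<rho> ^ deg a) summable_on nonneg_cone"
  using geometric_prod_abs_summable[of "\<lambda>_ :: 'n. \<rho>"] assms
  by (simp add: deg_def power_sum abs_prod power_abs)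

lemma integral_mon_mon:
  fixes a b :: "'n::finite \<Rightarrow> int"
  assumes "a \<in> nonneg_cone" "b \<in> nonneg_cone"
  shows "(\<integral>z. mon a z * cnj (mon b z) \<partial>torus_measure) = (if a = b then 1 else 0)"
proof -
  have "(\<integral>z. mon a z * cnj (mon b z) \<partial>torus_measure) =
      (\<integral>z. (\<Prod>i\<in>UNIV. z $ i ^ nat (a i) * cnj (z $ i) ^ nat (b i)) \<partial>torus_measure)"
    by (simp add: mon_def prod.distrib)
  also have "\<dots> = (\<Prod>i\<in>UNIV. \<integral>z. z ^ nat (a i) * cnj z ^ nat (b i) \<partial>circle_measure)"
    by (rule torus_integral_prod) (rule circle_integral_power)
  also have "\<dots> = (\<Prod>i\<in>UNIV. if a i = b i then 1 else 0)"
  proof (rule prod.cong[OF refl])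
    fix i
    have "nat (a i) = nat (b i) \<longleftrightarrow> a i = b i" using assms by (simp add: nonneg_cone_def eq_nat_nat_iff)
    then show "(\<integral>z. z ^ nat (a i) * cnj z ^ nat (b i) \<partial>circle_measure) = (if a i = b i then 1 else 0)"
      by (simp add: circle_integral_power)
  qed
  also have "\<dots> = (if a = b then 1 else 0)"
    by (auto simp: fun_eq_iff)
  finally show ?thesis .
qed

section \<open>Termwise integration\<close>

text \<open>Dominated convergence for unordered sums over a countable index set, obtained from the theorem for series by
  enumerating the index set.\<close>

lemma has_sum_integral:
  fixes f :: "'i \<Rightarrow> 'b \<Rightarrow> complex"
  assumes M: "finite_measure M" and A: "countable A" "infinite A"
    and meas: "\<And>a. a \<in> A \<Longrightarrow> f a \<in> borel_measurable M"
    and B: "B summable_on A" and bound: "AE z in M. \<forall>a\<in>A. cmod (f a z) \<le> B a"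
    and F: "AE z in M. F z = (\<Sum>\<^sub>\<infinity>a\<in>A. f a z)" "F \<in> borel_measurable M"
  shows "((\<lambda>a. integral\<^sup>L M (f a)) has_sum integral\<^sup>L M F) A"
proof -
  interpret finite_measure M by fact
  define e where "e = from_nat_into A"
  have e: "bij_betw e UNIV A" unfolding e_def using A by (rule bij_betw_from_nat_into)
  have eA: "e n \<in> A" for n using e by (auto simp: bij_betw_def)

  have Be: "summable (\<lambda>n. B (e n))"
    using B by (intro summable_on_imp_summable) (simp add: summable_on_reindex_bij_betw[OF e])
  have int: "integrable M (f (e n))" for n
    using bound meas[OF eA] eA by (intro integrable_const_bound[where B = "B (e n)"]) auto
  have nrm: "(\<integral>z. cmod (f (e n) z) \<partial>M) \<le> B (e n) * measure M (space M)" for n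
  proof -
    have "(\<integral>z. cmod (f (e n) z) \<partial>M) \<le> (\<integral>z. B (e n) \<partial>M)"
      using bound eA by (intro integral_mono_AE integrable_norm int) auto
    then show ?thesis by (simp add: mult.commute)
  qed
  have s1: "AE z in M. summable (\<lambda>n. norm (f (e n) z))"
    using bound by eventually_elim (rule summable_comparison_test'[OF Be, of 0], use eA in auto)
  have s2: "summable (\<lambda>n. \<integral>z. norm (f (e n) z) \<partial>M)"
    by (rule summable_comparison_test'[OF summable_mult2[OF Be, of "measure M (space M)"], of 0])
      (use nrm in auto)
  have "(\<lambda>n. integral\<^sup>L M (f (e n))) sums (\<integral>z. (\<Sum>n. f (e n) z) \<partial>M)"
    by (rule sums_integral[OF int s1 s2])
  moreover have "(\<integral>z. (\<Sum>n. f (e n) z) \<partial>M) = integral\<^sup>L M F"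
  proof (rule integral_cong_AE)
    show "(\<lambda>z. \<Sum>n. f (e n) z) \<in> borel_measurable M"
      using meas eA by (intro borel_measurable_suminf) auto
    show "AE z in M. (\<Sum>n. f (e n) z) = F z"
      using F(1) bound
    proof eventually_elim
      case (elim z)
      have s: "summable (\<lambda>n. norm (f (e n) z))"
        by (rule summable_comparison_test'[OF Be, of 0]) (use elim eA in auto)
      have "((\<lambda>n. f (e n) z) has_sum (\<Sum>n. f (e n) z)) UNIV"
        by (rule norm_summable_imp_has_sum[OF s summable_sums[OF summable_norm_cancel[OF s]]])
      then have "((\<lambda>a. f a z) has_sum (\<Sum>n. f (e n) z)) A"
        using has_sum_reindex_bij_betw[OF e, of "\<lambda>a. f a z"] by simp
      then show ?case using elim by (simp add: infsumI)
    qed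
  qed (rule F(2))
  moreover have "summable (\<lambda>n. norm (integral\<^sup>L M (f (e n))))"
    by (rule summable_comparison_test'[OF s2, of 0]) (use integral_norm_bound in auto)
  ultimately have "((\<lambda>n. integral\<^sup>L M (f (e n))) has_sum integral\<^sup>L M F) UNIV"
    by (intro norm_summable_imp_has_sum) simp_all
  then show ?thesis using has_sum_reindex_bij_betw[OF e, of "\<lambda>a. integral\<^sup>L M (f a)"] by simp
qed

lemma countable_nonneg_cone: "countable (nonneg_cone :: ('n::finite \<Rightarrow> int) set)"
  by (rule countable_subset[OF subset_UNIV]) simp

lemma infinite_nonneg_cone: "infinite (nonneg_cone :: ('n::finite \<Rightarrow> int) set)"
proof
  assume "finite (nonneg_cone :: ('n \<Rightarrow> int) set)"
  moreover have "range (\<lambda>k :: nat. (\<lambda>_ :: 'n. int k)) \<subseteq> nonneg_cone" by (auto simp: nonneg_cone_def)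
  moreover have "inj (\<lambda>k :: nat. (\<lambda>_ :: 'n. int k))" by (auto simp: inj_on_def fun_eq_iff)
  ultimately show False using finite_subset range_inj_infinite by blast
qed

section \<open>Power series of analytic functions on the polydisc\<close>

lemma open_polydisc: "open (polydisc :: (complex ^ 'n::finite) set)"
proof -
  have "polydisc = (\<Inter>i. {z :: complex ^ 'n. cmod (z $ i) < 1})" by (auto simp: polydisc_def)
  moreover have "open (\<Inter>i. {z :: complex ^ 'n. cmod (z $ i) < 1})"
    by (intro open_INT ballI open_Collect_less continuous_intros) simp
  ultimately show ?thesis by simp
qed

lemma polydisc_radius:
  fixes z :: "complex ^ 'n::finite"
  assumes "z \<in> polydisc"
  obtains \<rho> where "0 < \<rho>" "\<rho> < 1" "\<And>i. cmod (z $ i) < \<rho>"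
proof -
  define m where "m = Max (range (\<lambda>i. cmod (z $ i)))"
  have m: "cmod (z $ i) \<le> m" for i unfolding m_def by (intro Max_ge) auto
  have "m \<in> range (\<lambda>i. cmod (z $ i))" unfolding m_def by (intro Max_in) auto
  then have "0 \<le> m" "m < 1" using assms by (auto simp: polydisc_def)
  moreover have "cmod (z $ i) < (1 + m) / 2" for i using m[of i] \<open>m < 1\<close> by simp
  ultimately show ?thesis by (intro that[of "(1 + m) / 2"]) auto
qed

lemma analytic_continuous_on: "analytic_polydisc f \<Longrightarrow> continuous_on polydisc f"
  unfolding analytic_polydisc_def
  by (meson continuous_at_imp_continuous_on has_derivative_continuous)

lemma analytic_polydisc_cong:
  assumes "\<And>z. z \<in> polydisc \<Longrightarrow> f z = g z" "analytic_polydisc f"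
  shows "analytic_polydisc (g :: complex ^ 'n::finite \<Rightarrow> complex)"
  unfolding analytic_polydisc_def
proof
  fix z :: "complex ^ 'n" assume z: "z \<in> polydisc"
  then obtain D where "(f has_derivative D) (at z)" "\<forall>c v. D (c *s v) = c * D v"
    using assms(2) by (auto simp: analytic_polydisc_def)
  moreover from this have "(g has_derivative D) (at z)"
    using has_derivative_transform_within_open[OF _ open_polydisc z] assms(1) by blast
  ultimately show "\<exists>D. (g has_derivative D) (at z) \<and> (\<forall>c v. D (c *s v) = c * D v)" by blast
qed

lemma analytic_borel:
  assumes "analytic_polydisc f" "\<And>z. z \<notin> polydisc \<Longrightarrow> f z = 0"
  shows "f \<in> borel_measurable borel"
proof -
  have "(\<lambda>z. indicator polydisc z *\<^sub>R f z) \<in> borel_measurable borel"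
    by (intro borel_measurable_continuous_on_indicator analytic_continuous_on[OF assms(1)]
        borel_open[OF open_polydisc])
  also have "(\<lambda>z. indicator polydisc z *\<^sub>R f z) = f"
    using assms(2) by (auto simp: fun_eq_iff indicator_def)
  finally show ?thesis .
qed

lemma analytic_bounded_smaller:
  fixes f :: "complex ^ 'n::finite \<Rightarrow> complex"
  assumes "analytic_polydisc f" "\<rho> < 1"
  shows "\<exists>K\<ge>0. \<forall>z. (\<forall>i. cmod (z $ i) \<le> \<rho>) \<longrightarrow> cmod (f z) \<le> K"
proof -
  let ?S = "{z :: complex ^ 'n. \<forall>i. cmod (z $ i) \<le> \<rho>}"
  have "closed ?S"
    unfolding Collect_all_eq by (intro closed_INT ballI closed_Collect_le continuous_intros)
  moreover have "bounded ?S"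
  proof (rule boundedI)
    fix z assume "z \<in> ?S"
    then have "(\<Sum>i\<in>UNIV. cmod (z $ i)) \<le> (\<Sum>i\<in>(UNIV :: 'n set). \<rho>)"
      by (intro sum_mono) auto
    moreover have "norm z \<le> (\<Sum>i\<in>UNIV. cmod (z $ i))"
      unfolding norm_vec_def by (rule L2_set_le_sum) simp
    ultimately show "norm z \<le> (\<Sum>i\<in>(UNIV :: 'n set). \<rho>)" by linarith
  qed
  ultimately have "compact ?S" by (simp add: compact_eq_bounded_closed)
  moreover have "?S \<subseteq> polydisc" using assms(2) by (auto simp: polydisc_def intro: le_less_trans)
  ultimately have "bounded (f ` ?S)"
    using analytic_continuous_on[OF assms(1)]
    by (intro compact_imp_bounded compact_continuous_image) (auto intro: continuous_on_subset)
  then obtain K where "\<And>z. z \<in> ?S \<Longrightarrow> cmod (f z) \<le> K" by (auto simp: bounded_iff)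
  then show ?thesis by (intro exI[of _ "max 0 K"]) (auto simp: le_max_iff_disj)
qed

lemma analytic_slice_holomorphic:
  fixes f :: "complex ^ 'n::finite \<Rightarrow> complex"
  assumes f: "analytic_polydisc f" and c: "\<And>i. i \<noteq> j \<Longrightarrow> cmod (c i) < 1"
  shows "(\<lambda>x. f (\<chi> i. if i = j then x else c i)) holomorphic_on ball 0 1"
  unfolding holomorphic_on_open[OF open_ball]
proof (intro ballI)
  fix x :: complex assume "x \<in> ball 0 1"
  define p where "p x = (\<chi> i. if i = j then x else c i)" for x
  have "p x \<in> polydisc" using c \<open>x \<in> ball 0 1\<close> by (auto simp: p_def polydisc_def)
  then obtain D where D: "(f has_derivative D) (at (p x))" "\<And>c v. D (c *s v) = c * D v"
    using f by (auto simp: analytic_polydisc_def)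
  have p: "p = (\<lambda>x. p 0 + x *s axis j 1)"
    by (auto simp: p_def fun_eq_iff vec_eq_iff axis_def)
  have "linear (\<lambda>x :: complex. x *s (axis j 1 :: complex ^ 'n))"
    by (rule linearI) (simp_all add: vec_eq_iff algebra_simps)
  then have "((\<lambda>x. x *s axis j 1) has_derivative (\<lambda>x. x *s (axis j 1 :: complex ^ 'n))) (at x)"
    by (intro bounded_linear_imp_has_derivative) (simp add: linear_conv_bounded_linear)
  then have "(p has_derivative (\<lambda>x. x *s axis j 1)) (at x)"
    by (subst p) (auto intro!: derivative_eq_intros)
  from has_derivative_compose[OF this D(1)]
  have "((\<lambda>x. f (p x)) has_derivative (\<lambda>h. h * D (axis j 1))) (at x)" by (simp add: D(2))
  then have "((\<lambda>x. f (p x)) has_field_derivative D (axis j 1)) (at x)"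
    by (simp add: has_field_derivative_def mult_commute_abs)
  then show "\<exists>f'. ((\<lambda>x. f (\<chi> i. if i = j then x else c i)) has_field_derivative f') (at x)"
    by (auto simp: p_def)
qed

lemma norm_cauchy_kernel_le:
  assumes "cmod w < r" "cmod z = 1"
  shows "cmod (1 / (1 - w * cnj z / of_real r)) \<le> 1 / (1 - cmod w / r)"
proof -
  have r: "0 < r" using assms(1) norm_ge_zero[of w] by linarith
  have "1 - cmod w / r \<le> cmod (1 - w * cnj z / of_real r)"
    using norm_triangle_ineq2[of 1 "w * cnj z / of_real r"] assms(2) r by (simp add: norm_mult norm_divide)
  moreover have "0 < 1 - cmod w / r" using assms(1) r by simp
  ultimately show ?thesis by (simp add: norm_divide frac_le)
qed

text \<open>The coordinates are moved to the torus one at a time, by the one-variable formula. The induction hypothesis is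
  integrated over a point of which only the new coordinate is then resampled.\<close>

lemma polydisc_cauchy_formula:
  fixes f :: "complex ^ 'n::finite \<Rightarrow> complex"
  assumes f: "analytic_polydisc f" "f \<in> borel_measurable borel"
    and w: "\<And>i. cmod (w $ i) < r" and r: "r < 1"
  shows "f w = (\<integral>z. f (r *\<^sub>R z) * (\<Prod>i\<in>UNIV. 1 / (1 - w $ i * cnj (z $ i) / of_real r)) \<partial>torus_measure)"
proof -
  have r0: "0 < r" using w[of undefined] norm_ge_zero[of "w $ undefined"] by linarith
  note [measurable] = f(2)
  have [measurable]: "cnj \<in> borel_measurable borel"
    by (intro borel_measurable_continuous_onI continuous_intros)
  obtain K where K: "0 \<le> K" "\<And>z. (\<And>i. cmod (z $ i) \<le> r) \<Longrightarrow> cmod (f z) \<le> K"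
    using analytic_bounded_smaller[OF f(1) r] by blast
  define point where "point J z = (\<chi> i. if i \<in> J then of_real r * z $ i else w $ i)" for J and z :: "complex ^ 'n"
  define ker where "ker J z = (\<Prod>i\<in>J. 1 / (1 - w $ i * cnj (z $ i) / of_real r))" for J and z :: "complex ^ 'n"
  define G where "G J z = f (point J z) * ker J z" for J z
  have pm [measurable]: "point J \<in> borel_measurable borel" for J
    unfolding point_def by measurable
  have km [measurable]: "ker J \<in> borel_measurable borel" for J
    unfolding ker_def by (intro borel_measurable_prod) measurable
  have Gm [measurable]: "G J \<in> borel_measurable borel" for J
    unfolding G_def by measurable
  have G_int: "integrable torus_measure (G J)" for J
  proof (rule torus.integrable_const_bound[where B = "K * (\<Prod>i\<in>J. 1 / (1 - cmod (w $ i) / r))"])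
    show "AE z in torus_measure. norm (G J z) \<le> K * (\<Prod>i\<in>J. 1 / (1 - cmod (w $ i) / r))"
      using AE_torus_norm
    proof eventually_elim
      case (elim z)
      have "cmod (f (point J z)) \<le> K"
        using elim r0 w by (intro K(2)) (auto simp: point_def norm_mult less_imp_le)
      moreover have "cmod (ker J z) \<le> (\<Prod>i\<in>J. 1 / (1 - cmod (w $ i) / r))"
        unfolding ker_def prod_norm[symmetric]
        using elim w by (intro prod_mono conjI norm_ge_zero norm_cauchy_kernel_le) auto
      ultimately show ?case unfolding G_def norm_mult using K(1) by (intro mult_mono) auto
    qed
  qed simp
  have "finite J \<Longrightarrow> f w = integral\<^sup>L torus_measure (G J)" for J
  proof (induction J rule: finite_induct)
    case empty
    have "point {} z = w" for z by (simp add: point_def vec_eq_iff)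
    then show ?case by (simp add: G_def ker_def)
  next
    case (insert j J)
    have "integral\<^sup>L torus_measure (G (insert j J)) =
        (\<integral>z. (\<integral>z'. G (insert j J) (mix (- {j}) z z') \<partial>torus_measure) \<partial>torus_measure)"
      by (rule torus_integral_mix[OF G_int])
    also have "\<dots> = integral\<^sup>L torus_measure (G J)"
    proof (rule integral_cong_AE)
      show "(\<lambda>z. \<integral>z'. G (insert j J) (mix (- {j}) z z') \<partial>torus_measure) \<in> borel_measurable torus_measure"
      proof (rule torus.borel_measurable_lebesgue_integral)
        have "(\<lambda>x. G (insert j J) (mix (- {j}) (fst x) (snd x))) \<in> borel_measurable (torus_measure \<Otimes>\<^sub>M torus_measure)"
          by (rule measurable_compose[OF mix_measurable Gm])
        then show "(\<lambda>(z, z'). G (insert j J) (mix (- {j}) z z')) \<in> borel_measurable (torus_measure \<Otimes>\<^sub>M torus_measure)"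
          by (simp add: case_prod_beta)
      qed
      show "AE z in torus_measure. (\<integral>z'. G (insert j J) (mix (- {j}) z z') \<partial>torus_measure) = G J z"
        using AE_torus_norm
      proof eventually_elim
        case (elim z)
        define g where "g x = f (\<chi> i. if i = j then x else point J z $ i)" for x
        have ghol: "g holomorphic_on ball 0 1"
          unfolding g_def using elim r0 r w 
          by (intro analytic_slice_holomorphic[OF f(1)]) (auto simp: point_def norm_mult intro: less_trans)
        have gm [measurable]: "g \<in> borel_measurable borel" unfolding g_def by measurable
        have "G (insert j J) (mix (- {j}) z z') = ker J z * (g (of_real r * z' $ j) / (1 - w $ j * cnj (z' $ j) / of_real r))" for z'
        proof -
          have "point (insert j J) (mix (- {j}) z z') = (\<chi> i. if i = j then of_real r * z' $ j else point J z $ i)"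
            by (auto simp: point_def vec_eq_iff)
          moreover have "ker J (mix (- {j}) z z') = ker J z"
            unfolding ker_def using insert.hyps by (intro prod.cong) auto
          moreover have "ker (insert j J) y = 1 / (1 - w $ j * cnj (y $ j) / of_real r) * ker J y" for y
            unfolding ker_def using insert.hyps by simp
          ultimately show ?thesis by (simp add: G_def g_def)
        qed
        then have "(\<integral>z'. G (insert j J) (mix (- {j}) z z') \<partial>torus_measure) =
            ker J z * (\<integral>z'. g (of_real r * z' $ j) / (1 - w $ j * cnj (z' $ j) / of_real r) \<partial>torus_measure)"
          by (simp only: integral_mult_right_zero)
        also have "(\<integral>z'. g (of_real r * z' $ j) / (1 - w $ j * cnj (z' $ j) / of_real r) \<partial>torus_measure) =
            (\<integral>x. g (of_real r * x) / (1 - w $ j * cnj x / of_real r) \<partial>circle_measure)"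
          unfolding distr_torus_nth[of j, symmetric] by (subst integral_distr) auto
        also have "\<dots> = g (w $ j)"
          by (rule circle_cauchy_formula[OF ghol gm w r, symmetric])
        also have "g (w $ j) = f (point J z)"
          unfolding g_def using insert.hyps by (intro arg_cong[where f = f]) (auto simp: vec_eq_iff point_def)
        finally show ?case by (simp add: G_def mult.commute)
      qed
    qed simp
    finally show ?case using insert.IH by simp
  qed
  from this[of UNIV] show ?thesis
    by (simp add: G_def[abs_def] ker_def point_def scaleR_vec_def scaleR_conv_of_real[where 'a = complex])
qed

text \<open>The coefficients obtained by integrating over tori of different radii agree, because an absolutely
  convergent series can be integrated termwise against a conjugate monomial.\<close>

lemma power_series_coefficient:
  fixes c :: "('n::finite \<Rightarrow> int) \<Rightarrow> complex"
  assumes f: "f \<in> borel_measurable borel" and \<rho>: "0 \<le> \<rho>"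
    and c: "(\<lambda>a. cmod (c a) * \<rho> ^ deg a) summable_on nonneg_cone"
    and fc: "\<And>z. (\<And>i. cmod (z $ i) = \<rho>) \<Longrightarrow> ((\<lambda>a. c a * mon a z) has_sum f z) nonneg_cone"
    and b: "b \<in> nonneg_cone"
  shows "(\<integral>z. f (\<rho> *\<^sub>R z) * cnj (mon b z) \<partial>torus_measure) = c b * of_real \<rho> ^ deg b"
proof -
  note [measurable] = f
  have [measurable]: "cnj \<in> borel_measurable borel"
    by (intro borel_measurable_continuous_onI continuous_intros)
  define F where "F a z = c a * of_real \<rho> ^ deg a * (mon a z * cnj (mon b z))" for a and z :: "complex ^ 'n"
  have sum_F: "((\<lambda>a. integral\<^sup>L torus_measure (F a)) has_sum (\<integral>z. f (\<rho> *\<^sub>R z) * cnj (mon b z) \<partial>torus_measure)) nonneg_cone"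
  proof (rule has_sum_integral[OF _ countable_nonneg_cone infinite_nonneg_cone _ c])
    show "finite_measure (torus_measure :: (complex ^ 'n) measure)" by unfold_locales
    show "F a \<in> borel_measurable torus_measure" for a unfolding F_def by measurable
    show "AE z in torus_measure. \<forall>a\<in>nonneg_cone. cmod (F a z) \<le> cmod (c a) * \<rho> ^ deg a"
      using AE_torus_norm
      by eventually_elim (use \<rho> in \<open>auto simp: F_def norm_mult norm_power norm_mon_torus\<close>)
    show "AE z in torus_measure. f (\<rho> *\<^sub>R z) * cnj (mon b z) = (\<Sum>\<^sub>\<infinity>a\<in>nonneg_cone. F a z)"
      using AE_torus_norm
    proof eventually_elim
      case (elim z)
      have "((\<lambda>a. c a * mon a (\<rho> *\<^sub>R z)) has_sum f (\<rho> *\<^sub>R z)) nonneg_cone"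
        using elim \<rho> by (intro fc) simp
      from has_sum_cmult_left[OF this, of "cnj (mon b z)"]
      have "((\<lambda>a. F a z) has_sum f (\<rho> *\<^sub>R z) * cnj (mon b z)) nonneg_cone"
        by (simp add: F_def mon_scaleR mult_ac)
      then show ?case by (simp add: infsumI)
    qed
  qed simp
  have int_F: "integral\<^sup>L torus_measure (F a) = (if a = b then c b * of_real \<rho> ^ deg b else 0)" if "a \<in> nonneg_cone" for a
    using that b by (simp add: F_def[abs_def] integral_mon_mon)
  from sum_F have "((\<lambda>a. if a = b then c b * of_real \<rho> ^ deg b else 0) has_sum
      (\<integral>z. f (\<rho> *\<^sub>R z) * cnj (mon b z) \<partial>torus_measure)) nonneg_cone"
    by (rule has_sum_cong[THEN iffD1, rotated]) (rule int_F)
  moreover have "((\<lambda>a. if a = b then c b * of_real \<rho> ^ deg b else 0) has_sum c b * of_real \<rho> ^ deg b) nonneg_cone"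
    using has_sum_finite[of "{b}" "\<lambda>a. if a = b then c b * of_real \<rho> ^ deg b else 0"] b
    by (subst has_sum_cong_neutral[where T = "{b}" and g = "\<lambda>a. if a = b then c b * of_real \<rho> ^ deg b else 0"]) auto
  ultimately show ?thesis by (rule has_sum_unique)
qed

lemma torus_integral_bound:
  fixes g :: "complex ^ 'n::finite \<Rightarrow> complex"
  assumes "AE z in torus_measure. cmod (g z) \<le> K" "0 \<le> K"
  shows "cmod (integral\<^sup>L torus_measure g) \<le> K"
proof (cases "integrable torus_measure g")
  case True
  have "cmod (integral\<^sup>L torus_measure g) \<le> (\<integral>z. cmod (g z) \<partial>torus_measure)" by (rule integral_norm_bound)
  also have "\<dots> \<le> (\<integral>z. K \<partial>(torus_measure :: (complex ^ 'n) measure))"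
    using True assms(1) by (intro integral_mono_AE) auto
  finally show ?thesis by simp
qed (use assms(2) in \<open>simp add: not_integrable_integral_eq\<close>)

text \<open>Expanding the Cauchy kernel into a geometric series gives an expansion on each smaller polydisc; by
  \<open>power_series_coefficient\<close> its coefficients do not depend on the radius.\<close>

theorem polydisc_power_series:
  fixes f :: "complex ^ 'n::finite \<Rightarrow> complex"
  assumes f: "analytic_polydisc f" "f \<in> borel_measurable borel"
  shows "\<exists>c. (\<forall>\<rho>. 0 \<le> \<rho> \<longrightarrow> \<rho> < 1 \<longrightarrow> (\<lambda>a. cmod (c a) * \<rho> ^ deg a) summable_on nonneg_cone) \<and>
    (\<forall>z\<in>polydisc. ((\<lambda>a. c a * mon a z) has_sum f z) nonneg_cone)"
proof -
  note [measurable] = f(2)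
  have [measurable]: "cnj \<in> borel_measurable borel"
    by (intro borel_measurable_continuous_onI continuous_intros)
  define C where "C r a = (\<integral>z. f (r *\<^sub>R z) * cnj (mon a z) \<partial>torus_measure) / of_real r ^ deg a" for r a
  have C_summable: "(\<lambda>a. cmod (C r a) * \<rho> ^ deg a) summable_on nonneg_cone"
    if r: "0 < r" "r < 1" and \<rho>: "0 \<le> \<rho>" "\<rho> < r" for r \<rho>
  proof -
    obtain K where K: "0 \<le> K" "\<And>z. (\<And>i. cmod (z $ i) \<le> r) \<Longrightarrow> cmod (f z) \<le> K"
      using analytic_bounded_smaller[OF f(1) r(2)] by blast
    have "cmod (\<integral>z. f (r *\<^sub>R z) * cnj (mon a z) \<partial>torus_measure) \<le> K" for a
    proof (rule torus_integral_bound[OF _ K(1)])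
      show "AE z in torus_measure. cmod (f (r *\<^sub>R z) * cnj (mon a z)) \<le> K"
        using AE_torus_norm
        by eventually_elim (use r in \<open>auto simp: norm_mult norm_mon_torus intro!: K(2)\<close>)
    qed
    then have "cmod (C r a) * \<rho> ^ deg a \<le> K * (\<rho> / r) ^ deg a" for a
      using r \<rho> by (simp add: C_def norm_divide norm_power power_divide divide_right_mono mult_right_mono)
    then show ?thesis
      using \<rho> r by (intro summable_on_comparison_test[OF summable_on_cmult_right[OF power_deg_summable[of "\<rho> / r"]]]) auto
  qed
  have C_has_sum: "((\<lambda>a. C r a * mon a w) has_sum f w) nonneg_cone"
    if r: "r < 1" and w: "\<And>i. cmod (w $ i) < r" for r w
  proof -
    have r0: "0 < r" using w[of undefined] norm_ge_zero[of "w $ undefined"] by linarith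
    obtain K where K: "0 \<le> K" "\<And>z. (\<And>i. cmod (z $ i) \<le> r) \<Longrightarrow> cmod (f z) \<le> K"
      using analytic_bounded_smaller[OF f(1) r] by blast
    define F where "F a z = f (r *\<^sub>R z) * (\<Prod>i\<in>UNIV. (w $ i * cnj (z $ i) / of_real r) ^ nat (a i))" for a and z :: "complex ^ 'n"
    have F_eq: "F a z = mon a w / of_real r ^ deg a * (f (r *\<^sub>R z) * cnj (mon a z))" for a z
      by (simp add: F_def mon_def deg_def power_sum power_divide power_mult_distrib prod_dividef prod.distrib)
    have quot: "norm (cmod (w $ i) / r) < 1" for i using w[of i] r0 by simp
    have "((\<lambda>a. integral\<^sup>L torus_measure (F a)) has_sum
        (\<integral>z. f (r *\<^sub>R z) * (\<Prod>i\<in>UNIV. 1 / (1 - w $ i * cnj (z $ i) / of_real r)) \<partial>torus_measure)) nonneg_cone"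
    proof (rule has_sum_integral[OF _ countable_nonneg_cone infinite_nonneg_cone])
      show "finite_measure (torus_measure :: (complex ^ 'n) measure)" by unfold_locales
      show "F a \<in> borel_measurable torus_measure" for a unfolding F_eq[abs_def] by measurable
      show "(\<lambda>a. K * norm (\<Prod>i\<in>UNIV. (cmod (w $ i) / r) ^ nat (a i))) summable_on nonneg_cone"
        by (intro summable_on_cmult_right geometric_prod_abs_summable quot)
      show "AE z in torus_measure. \<forall>a\<in>nonneg_cone. cmod (F a z) \<le> K * norm (\<Prod>i\<in>UNIV. (cmod (w $ i) / r) ^ nat (a i))"
        using AE_torus_norm
      proof eventually_elim
        case (elim z)
        have "cmod (f (r *\<^sub>R z)) \<le> K" using elim r0 by (intro K(2)) simp
        then show ?case
          using elim r0 by (auto simp: F_def norm_mult norm_divide norm_power abs_prod simp flip: prod_norm intro!: mult_right_mono prod_nonneg)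
      qed
      show "AE z in torus_measure. f (r *\<^sub>R z) * (\<Prod>i\<in>UNIV. 1 / (1 - w $ i * cnj (z $ i) / of_real r)) =
          (\<Sum>\<^sub>\<infinity>a\<in>nonneg_cone. F a z)"
        using AE_torus_norm
      proof eventually_elim
        case (elim z)
        have "norm (w $ i * cnj (z $ i) / of_real r) < 1" for i
          using quot[of i] elim by (simp add: norm_mult norm_divide)
        then show ?case
          unfolding F_def by (simp add: infsum_geometric_prod infsum_cmult_right')
      qed
    qed measurable
    moreover have "integral\<^sup>L torus_measure (F a) = C r a * mon a w" for a
      unfolding F_eq[abs_def] by (simp add: C_def)
    ultimately show ?thesis
      using polydisc_cauchy_formula[OF f w r] by simp
  qed
  have C_less: "C \<rho> b = C r b" if "0 < \<rho>" "\<rho> < r" "r < 1" "b \<in> nonneg_cone" for \<rho> r b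
  proof -
    have "(\<integral>z. f (\<rho> *\<^sub>R z) * cnj (mon b z) \<partial>torus_measure) = C r b * of_real \<rho> ^ deg b"
      using that by (intro power_series_coefficient[OF f(2)] C_summable C_has_sum) auto
    then show ?thesis using that by (simp add: C_def[of \<rho>])
  qed
  have C_eq: "C r b = C (1/2) b" if "0 < r" "r < 1" "b \<in> nonneg_cone" for r b
  proof (cases r "1/2 :: real" rule: linorder_cases)
    case less
    then show ?thesis by (rule C_less[OF that(1) _ _ that(3)]) simp
  next
    case greater
    then show ?thesis by (intro C_less[symmetric] that) simp_all
  qed (simp only:)
  show ?thesis
  proof (intro exI[of _ "C (1/2)"] conjI allI impI ballI)
    fix \<rho> :: real assume \<rho>: "0 \<le> \<rho>" "\<rho> < 1"
    define r where "r = (1 + \<rho>) / 2"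
    have r: "0 < r" "r < 1" "\<rho> < r" using \<rho> by (auto simp: r_def)
    have "(\<lambda>a. cmod (C r a) * \<rho> ^ deg a) summable_on nonneg_cone" using r \<rho> by (intro C_summable)
    then show "(\<lambda>a. cmod (C (1/2) a) * \<rho> ^ deg a) summable_on nonneg_cone"
      by (rule summable_on_cong[THEN iffD1, rotated]) (use r in \<open>simp only: C_eq[of r]\<close>)
  next
    fix z :: "complex ^ 'n" assume z: "z \<in> polydisc"
    obtain r where r: "0 < r" "r < 1" "\<And>i. cmod (z $ i) < r" using polydisc_radius[OF z] by blast
    have "((\<lambda>a. C r a * mon a z) has_sum f z) nonneg_cone"
      using r by (intro C_has_sum)
    then show "((\<lambda>a. C (1/2) a * mon a z) has_sum f z) nonneg_cone"
      by (rule has_sum_cong[THEN iffD1, rotated]) (use r(1,2) in \<open>simp only: C_eq[of r]\<close>)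
  qed
qed

section \<open>Analyticity of power series\<close>

definition mon_deriv :: "('n::finite \<Rightarrow> int) \<Rightarrow> complex ^ 'n \<Rightarrow> complex ^ 'n \<Rightarrow> complex" where
  "mon_deriv a z h = (\<Sum>i\<in>UNIV. (of_nat (nat (a i)) * (h $ i * z $ i ^ (nat (a i) - 1))) *
     (\<Prod>j\<in>UNIV - {i}. z $ j ^ nat (a j)))"

lemma mon_has_derivative: "(mon a has_derivative mon_deriv a z) (at z within S)"
proof -
  have "((\<lambda>z. z $ i ^ nat (a i)) has_derivative (\<lambda>h. of_nat (nat (a i)) * (h $ i * z $ i ^ (nat (a i) - 1)))) (at z within S)"
    for i
  proof -
    have "((\<lambda>z. z $ i) has_derivative (\<lambda>h :: complex ^ 'a. h $ i)) (at z within S)"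
      by (rule bounded_linear_imp_has_derivative[OF bounded_linear_vec_nth])
    from has_derivative_power[OF this, of "nat (a i)"] show ?thesis by (simp add: mult.assoc)
  qed
  then show ?thesis
    unfolding mon_def[abs_def] mon_deriv_def[abs_def] by (intro has_derivative_prod)
qed

lemma mon_deriv_scale: "mon_deriv a z (c *s h) = c * mon_deriv a z h"
  by (simp add: mon_deriv_def sum_distrib_left mult_ac)

lemma norm_mon_deriv_le:
  fixes z :: "complex ^ 'n::finite"
  assumes "\<And>i. cmod (z $ i) \<le> \<rho>"
  shows "cmod (mon_deriv a z h) \<le> of_nat (deg a) * \<rho> ^ (deg a - 1) * norm h"
proof -
  have \<rho>: "0 \<le> \<rho>" using assms[of undefined] norm_ge_zero[of "z $ undefined"] by linarith
  have "cmod ((of_nat (nat (a i)) * (h $ i * z $ i ^ (nat (a i) - 1))) * (\<Prod>j\<in>UNIV - {i}. z $ j ^ nat (a j)))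
      \<le> of_nat (nat (a i)) * \<rho> ^ (deg a - 1) * norm h" for i
  proof (cases "nat (a i) = 0")
    case False
    have "cmod (\<Prod>j\<in>UNIV - {i}. z $ j ^ nat (a j)) \<le> (\<Prod>j\<in>UNIV - {i}. \<rho> ^ nat (a j))"
      unfolding prod_norm[symmetric] norm_power using assms by (intro prod_mono) (auto intro: power_mono)
    moreover have "cmod (z $ i ^ (nat (a i) - 1)) \<le> \<rho> ^ (nat (a i) - 1)"
      unfolding norm_power using assms by (intro power_mono) auto
    ultimately have "cmod (z $ i ^ (nat (a i) - 1)) * cmod (\<Prod>j\<in>UNIV - {i}. z $ j ^ nat (a j))
        \<le> \<rho> ^ (nat (a i) - 1) * (\<Prod>j\<in>UNIV - {i}. \<rho> ^ nat (a j))"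
      using \<rho> by (intro mult_mono) auto
    also have "\<dots> = \<rho> ^ (nat (a i) - 1 + (\<Sum>j\<in>UNIV - {i}. nat (a j)))"
      by (simp add: power_add power_sum)
    also have "nat (a i) - 1 + (\<Sum>j\<in>UNIV - {i}. nat (a j)) = deg a - 1"
      using False by (simp add: deg_def sum.remove[of UNIV i])
    finally have 1: "cmod (z $ i ^ (nat (a i) - 1)) * cmod (\<Prod>j\<in>UNIV - {i}. z $ j ^ nat (a j)) \<le> \<rho> ^ (deg a - 1)" .
    have "cmod (h $ i) \<le> norm h" by (rule Finite_Cartesian_Product.norm_nth_le)
    then have "cmod (h $ i) * (cmod (z $ i ^ (nat (a i) - 1)) * cmod (\<Prod>j\<in>UNIV - {i}. z $ j ^ nat (a j))) \<le> norm h * \<rho> ^ (deg a - 1)"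
      using 1 by (intro mult_mono) auto
    then have "of_nat (nat (a i)) * (cmod (h $ i) * (cmod (z $ i ^ (nat (a i) - 1)) * cmod (\<Prod>j\<in>UNIV - {i}. z $ j ^ nat (a j))))
        \<le> of_nat (nat (a i)) * (norm h * \<rho> ^ (deg a - 1))"
      by (intro mult_left_mono) auto
    then show ?thesis by (simp add: norm_mult mult_ac)
  qed simp
  then have "cmod (mon_deriv a z h) \<le> (\<Sum>i\<in>UNIV. of_nat (nat (a i)) * \<rho> ^ (deg a - 1) * norm h)"
    unfolding mon_deriv_def by (intro order_trans[OF norm_sum] sum_mono)
  also have "\<dots> = of_nat (deg a) * \<rho> ^ (deg a - 1) * norm h"
    by (simp add: deg_def sum_distrib_right)
  finally show ?thesis .
qed

lemma deg_power_summable: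
  assumes \<rho>: "0 < \<rho>" "\<rho> < (1 :: real)"
  shows "(\<lambda>a :: 'n::finite \<Rightarrow> int. of_nat (deg a) * \<rho> ^ (deg a - 1)) summable_on nonneg_cone"
proof -
  define \<sigma> where "\<sigma> = sqrt \<rho>"
  have \<sigma>: "0 < \<sigma>" "\<sigma> < 1" "\<sigma> * \<sigma> = \<rho>" using \<rho> by (auto simp: \<sigma>_def)
  have "(\<lambda>n. of_nat n * \<sigma> ^ n) \<longlonglongrightarrow> 0" using \<sigma> by (intro powser_times_n_limit_0) simp
  then have "Bseq (\<lambda>n. of_nat n * \<sigma> ^ n)" by (intro convergent_imp_Bseq) (auto simp: convergent_def)
  then obtain B where B: "\<And>n. norm (of_nat n * \<sigma> ^ n) \<le> B" by (auto simp: Bseq_def)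
  have "of_nat n * \<rho> ^ (n - 1) \<le> B / \<rho> * \<sigma> ^ n" for n
  proof (cases n)
    case 0
    have "0 \<le> B" using B[of 0] by simp
    then show ?thesis using 0 \<rho> by simp
  next
    case (Suc m)
    have "of_nat n * \<rho> ^ (n - 1) * \<rho> = (of_nat n * \<sigma> ^ n) * \<sigma> ^ n"
      by (simp add: Suc \<sigma>(3)[symmetric] power_mult_distrib)
    also have "\<dots> \<le> B * \<sigma> ^ n"
      using B[of n] \<sigma> by (intro mult_right_mono) auto
    finally show ?thesis using \<rho> by (simp add: field_simps)
  qed
  then show ?thesis
    using \<rho> \<sigma> by (intro summable_on_comparison_test[OF summable_on_cmult_right[OF power_deg_summable[of \<sigma>], of "B / \<rho>"]]) auto
qed

definition power_series :: "(('n::finite \<Rightarrow> int) \<Rightarrow> complex) \<Rightarrow> complex ^ 'n \<Rightarrow> complex" where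
  "power_series c z = (if z \<in> polydisc then \<Sum>\<^sub>\<infinity>a\<in>nonneg_cone. c a * mon a z else 0)"

lemma zero_in_nonneg_cone [simp]: "0 \<in> nonneg_cone"
  by (simp add: nonneg_cone_def)

lemma power_series_abs_summable:
  fixes z :: "complex ^ 'n::finite"
  assumes "\<And>a. a \<in> nonneg_cone \<Longrightarrow> cmod (c a) \<le> B" "z \<in> polydisc"
  shows "(\<lambda>a. norm (c a * mon a z)) summable_on nonneg_cone"
proof -
  obtain \<rho> where \<rho>: "0 < \<rho>" "\<rho> < 1" "\<And>i. cmod (z $ i) < \<rho>"
    using polydisc_radius[OF assms(2)] by blast
  have B: "0 \<le> B" using order_trans[OF norm_ge_zero assms(1)[OF zero_in_nonneg_cone]] .
  show ?thesis
  proof (rule summable_on_comparison_test)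
    show "(\<lambda>a :: 'n \<Rightarrow> int. B * \<rho> ^ deg a) summable_on nonneg_cone"
      using \<rho> by (intro summable_on_cmult_right power_deg_summable) auto
    show "norm (c a * mon a z) \<le> B * \<rho> ^ deg a" if "a \<in> nonneg_cone" for a
      unfolding norm_mult using assms(1)[OF that] B \<rho>(3) by (intro mult_mono norm_mon_le) (auto simp: less_imp_le)
  qed simp
qed

text \<open>Bounded coefficients suffice: on a smaller polydisc the differentiated series is dominated by a convergent
  numerical series, so the series may be differentiated termwise after enumerating the exponents.\<close>

lemma analytic_power_series:
  fixes c :: "('n::finite \<Rightarrow> int) \<Rightarrow> complex"
  assumes c: "\<And>a. a \<in> nonneg_cone \<Longrightarrow> cmod (c a) \<le> B"
  shows "analytic_polydisc (power_series c)"
  unfolding analytic_polydisc_def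
proof
  fix z0 :: "complex ^ 'n" assume "z0 \<in> polydisc"
  then obtain \<rho> where \<rho>: "0 < \<rho>" "\<rho> < 1" "\<And>i. cmod (z0 $ i) < \<rho>" using polydisc_radius by blast
  have B: "0 \<le> B" using order_trans[OF norm_ge_zero c[OF zero_in_nonneg_cone]] .
  define S where "S = {z :: complex ^ 'n. \<forall>i. cmod (z $ i) < \<rho>}"
  have S_eq: "S = (\<Inter>i. {z :: complex ^ 'n. cmod (z $ i) < \<rho>})" by (auto simp: S_def)
  have "open (\<Inter>i. {z :: complex ^ 'n. cmod (z $ i) < \<rho>})"
    by (intro open_INT ballI open_Collect_less continuous_intros) simp
  then have "open S" by (simp add: S_eq)
  have "convex S"
  proof (rule convexI)
    fix x y and u v :: real assume *: "x \<in> S" "y \<in> S" "0 \<le> u" "0 \<le> v" "u + v = 1"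
    have "cmod (u *\<^sub>R x $ i + v *\<^sub>R y $ i) < \<rho>" for i
      using convexD[OF convex_ball[of 0 \<rho>], of "x $ i" "y $ i" u v] * by (simp add: S_def)
    then show "u *\<^sub>R x + v *\<^sub>R y \<in> S" by (simp add: S_def)
  qed
  have SP: "S \<subseteq> polydisc" using \<rho>(2) by (auto simp: S_def polydisc_def intro: less_trans)
  define e where "e = from_nat_into (nonneg_cone :: ('n \<Rightarrow> int) set)"
  have e: "bij_betw e UNIV nonneg_cone"
    unfolding e_def using countable_nonneg_cone infinite_nonneg_cone by (rule bij_betw_from_nat_into)
  have eN: "e n \<in> nonneg_cone" for n using e by (auto simp: bij_betw_def)
  define f where "f n z = c (e n) * mon (e n) z" for n z
  define f' where "f' n z h = c (e n) * mon_deriv (e n) z h" for n z h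
  define M where "M n = B * (of_nat (deg (e n)) * \<rho> ^ (deg (e n) - 1))" for n
  define g' where "g' z h = (\<Sum>n. f' n z h)" for z h
  have "(\<lambda>a :: 'n \<Rightarrow> int. B * (of_nat (deg a) * \<rho> ^ (deg a - 1))) summable_on nonneg_cone"
    using \<rho> by (intro summable_on_cmult_right deg_power_summable)
  then have M: "summable M"
    unfolding M_def using summable_on_reindex_bij_betw[OF e, of "\<lambda>a. B * (of_nat (deg a) * \<rho> ^ (deg a - 1))"]
    by (intro summable_on_imp_summable) simp
  have bound: "norm (f' n z h) \<le> M n * norm h" if "z \<in> S" for n z h
  proof -
    have "norm (f' n z h) \<le> B * (of_nat (deg (e n)) * \<rho> ^ (deg (e n) - 1) * norm h)"
      unfolding f'_def norm_mult using that c[OF eN] B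
      by (intro mult_mono norm_mon_deriv_le) (auto simp: S_def less_imp_le)
    then show ?thesis by (simp add: M_def mult_ac)
  qed
  have f'_summable: "summable (\<lambda>n. norm (f' n z h))" if "z \<in> S" for z h
    by (rule summable_comparison_test'[OF summable_mult2[OF M], of 0]) (use bound[OF that] in auto)
  have sums_f: "(\<lambda>n. f n z) sums power_series c z" if "z \<in> S" for z
  proof -
    have "((\<lambda>a. c a * mon a z) has_sum power_series c z) nonneg_cone"
      using that SP abs_summable_summable[OF power_series_abs_summable[of c B z]] c
      by (auto simp: power_series_def)
    then have "((\<lambda>n. f n z) has_sum power_series c z) UNIV"
      unfolding f_def using has_sum_reindex_bij_betw[OF e, of "\<lambda>a. c a * mon a z"] by simp
    then show ?thesis by (rule has_sum_imp_sums)
  qed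
  have z0S: "z0 \<in> S" using \<rho>(3) by (simp add: S_def)
  have "\<exists>g. \<forall>z\<in>S. (\<lambda>n. f n z) sums (g z) \<and> (g has_derivative g' z) (at z within S)"
  proof (rule has_derivative_series[where f = f and f' = f' and g' = g' and x = z0,
        OF \<open>convex S\<close> _ _ z0S sums_f[OF z0S]])
    show "(f n has_derivative f' n z) (at z within S)" for n z
      unfolding f_def[abs_def] f'_def[abs_def]
      by (intro has_derivative_mult_right mon_has_derivative)
    fix \<epsilon> :: real assume "0 < \<epsilon>"
    from suminf_exist_split[OF this M] obtain N where N: "\<And>n. n \<ge> N \<Longrightarrow> norm (\<Sum>i. M (i + n)) < \<epsilon>" by blast
    have "norm ((\<Sum>i<n. f' i z h) - g' z h) \<le> \<epsilon> * norm h" if "n \<ge> N" "z \<in> S" for n z h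
    proof -
      have s: "summable (\<lambda>n. f' n z h)" using f'_summable[OF that(2)] by (rule summable_norm_cancel)
      have Ms: "summable (\<lambda>i. M (i + n))" using M by (simp add: summable_iff_shift)
      have "norm ((\<Sum>i<n. f' i z h) - g' z h) = norm (\<Sum>i. f' (i + n) z h)"
        unfolding g'_def suminf_split_initial_segment[OF s, of n] by simp
      also have "\<dots> \<le> (\<Sum>i. M (i + n) * norm h)"
      proof (rule norm_suminf_le)
        show "norm (f' (i + n) z h) \<le> M (i + n) * norm h" for i using bound[OF that(2)] .
      qed (rule summable_mult2[OF Ms])
      also have "\<dots> = (\<Sum>i. M (i + n)) * norm h" by (rule suminf_mult2[OF Ms, symmetric])
      also have "\<dots> \<le> \<epsilon> * norm h" using N[OF that(1)] by (intro mult_right_mono) auto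
      finally show ?thesis .
    qed
    then show "\<forall>\<^sub>F n in sequentially. \<forall>z\<in>S. \<forall>h. norm ((\<Sum>i<n. f' i z h) - g' z h) \<le> \<epsilon> * norm h"
      unfolding eventually_sequentially by blast
  qed
  then obtain g where g: "\<And>z. z \<in> S \<Longrightarrow> (\<lambda>n. f n z) sums (g z)" "\<And>z. z \<in> S \<Longrightarrow> (g has_derivative g' z) (at z within S)"
    by blast
  have "g z = power_series c z" if "z \<in> S" for z using sums_unique2[OF g(1)[OF that] sums_f[OF that]] .
  moreover have "(g has_derivative g' z0) (at z0)"
    using g(2)[OF z0S] at_within_open[OF z0S \<open>open S\<close>] by simp
  ultimately have "(power_series c has_derivative g' z0) (at z0)"
    using has_derivative_transform_within_open[OF _ \<open>open S\<close> z0S] by blast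
  moreover have "g' z0 (k *s h) = k * g' z0 h" for k h
    unfolding g'_def using summable_norm_cancel[OF f'_summable[OF z0S, of h]]
    by (subst suminf_mult[symmetric]) (auto simp: f'_def mon_deriv_scale mult_ac)
  ultimately show "\<exists>D. (power_series c has_derivative D) (at z0) \<and> (\<forall>k h. D (k *s h) = k * D h)" by blast
qed

section \<open>The Hardy space as a space of square-summable families\<close>

text \<open>Parseval's identity on the torus of radius \<open>r\<close>: one of the two factors \<open>f\<close> of the squared modulus is expanded, and
  the integrals against the other factor are its coefficients.\<close>

lemma radial_mean_has_sum:
  fixes f :: "complex ^ 'n::finite \<Rightarrow> complex"
  assumes f: "analytic_polydisc f" "f \<in> borel_measurable borel"
    and c: "\<And>\<rho>. 0 \<le> \<rho> \<Longrightarrow> \<rho> < 1 \<Longrightarrow> (\<lambda>a. cmod (c a) * \<rho> ^ deg a) summable_on nonneg_cone"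
    and fc: "\<And>z. z \<in> polydisc \<Longrightarrow> ((\<lambda>a. c a * mon a z) has_sum f z) nonneg_cone"
    and r: "0 \<le> r" "r < 1"
  shows "((\<lambda>a. (cmod (c a))\<^sup>2 * r ^ (2 * deg a)) has_sum radial_mean f r) nonneg_cone"
proof -
  note [measurable] = f(2)
  have [measurable]: "cnj \<in> borel_measurable borel"
    by (intro borel_measurable_continuous_onI continuous_intros)
  obtain K where K: "0 \<le> K" "\<And>z. (\<And>i. cmod (z $ i) \<le> r) \<Longrightarrow> cmod (f z) \<le> K"
    using analytic_bounded_smaller[OF f(1) r(2)] by blast
  define F where "F a z = cnj (c a) * of_real r ^ deg a * (f (r *\<^sub>R z) * cnj (mon a z))" for a and z :: "complex ^ 'n"
  have sum_F: "((\<lambda>a. integral\<^sup>L torus_measure (F a)) has_sum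
      (\<integral>z. complex_of_real ((cmod (f (r *\<^sub>R z)))\<^sup>2) \<partial>torus_measure)) nonneg_cone"
  proof (rule has_sum_integral[OF _ countable_nonneg_cone infinite_nonneg_cone])
    show "finite_measure (torus_measure :: (complex ^ 'n) measure)" by unfold_locales
    show "F a \<in> borel_measurable torus_measure" for a unfolding F_def[abs_def] by measurable
    show "(\<lambda>a. K * (cmod (c a) * r ^ deg a)) summable_on nonneg_cone"
      by (intro summable_on_cmult_right c r)
    show "AE z in torus_measure. \<forall>a\<in>nonneg_cone. cmod (F a z) \<le> K * (cmod (c a) * r ^ deg a)"
      using AE_torus_norm
    proof eventually_elim
      case (elim z)
      have "cmod (f (r *\<^sub>R z)) \<le> K" using elim r by (intro K(2)) simp
      then have "cmod (c a) * r ^ deg a * cmod (f (r *\<^sub>R z)) \<le> cmod (c a) * r ^ deg a * K" for a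
        using r by (intro mult_left_mono) auto
      then show ?case using elim r by (simp add: F_def norm_mult norm_power norm_mon_torus mult_ac)
    qed
    show "AE z in torus_measure. complex_of_real ((cmod (f (r *\<^sub>R z)))\<^sup>2) = (\<Sum>\<^sub>\<infinity>a\<in>nonneg_cone. F a z)"
      using AE_torus_norm
    proof eventually_elim
      case (elim z)
      have "r *\<^sub>R z \<in> polydisc" using elim r by (simp add: polydisc_def)
      from has_sum_cmult_right[OF has_sum_cnj_iff[THEN iffD2, OF fc[OF this]], of "f (r *\<^sub>R z)"]
      have "((\<lambda>a. F a z) has_sum f (r *\<^sub>R z) * cnj (f (r *\<^sub>R z))) nonneg_cone"
        by (simp add: F_def mon_scaleR mult_ac)
      then show ?case unfolding complex_norm_square by (simp add: infsumI)
    qed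
  qed measurable
  have int_F: "integral\<^sup>L torus_measure (F a) = of_real ((cmod (c a))\<^sup>2 * r ^ (2 * deg a))" if a: "a \<in> nonneg_cone" for a
  proof -
    have "(\<integral>z. f (r *\<^sub>R z) * cnj (mon a z) \<partial>torus_measure) = c a * of_real r ^ deg a"
      using r by (intro power_series_coefficient[OF f(2) r(1) c[OF r] _ a] fc) (auto simp: polydisc_def)
    then have "integral\<^sup>L torus_measure (F a) = cnj (c a) * of_real r ^ deg a * (c a * of_real r ^ deg a)"
      unfolding F_def[abs_def] by (simp only: integral_mult_right_zero)
    then have "integral\<^sup>L torus_measure (F a) = (c a * cnj (c a)) * of_real r ^ (deg a + deg a)"
      by (simp add: power_add mult_ac)
    also have "\<dots> = of_real ((cmod (c a))\<^sup>2) * of_real r ^ (2 * deg a)"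
      unfolding complex_norm_square by (simp add: mult_2)
    finally show ?thesis by simp
  qed
  have "(\<integral>z. complex_of_real ((cmod (f (r *\<^sub>R z)))\<^sup>2) \<partial>torus_measure) = of_real (radial_mean f r)"
    unfolding radial_mean_def by (rule integral_complex_of_real)
  with sum_F have "((\<lambda>a. integral\<^sup>L torus_measure (F a)) has_sum of_real (radial_mean f r)) nonneg_cone"
    by (simp only:)
  then have "((\<lambda>a. complex_of_real ((cmod (c a))\<^sup>2 * r ^ (2 * deg a))) has_sum of_real (radial_mean f r)) nonneg_cone"
    by (rule has_sum_cong[THEN iffD1, rotated]) (rule int_F)
  then show ?thesis by (simp only: has_sum_of_real_iff)
qed

text \<open>The isomorphism from the families supported in the cone onto \<^const>\<open>hardy2\<close>; like the elements of
  that space, its values vanish outside the polydisc.\<close>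

definition hardy_of :: "('n::finite \<Rightarrow> int) ell2 \<Rightarrow> complex ^ 'n \<Rightarrow> complex" where
  "hardy_of a = power_series (coef a)"

lemma hardy_of_analytic: "analytic_polydisc (hardy_of a)"
  unfolding hardy_of_def by (rule analytic_power_series) (rule coef_bound)

lemma hardy_of_outside: "z \<notin> polydisc \<Longrightarrow> hardy_of a z = 0"
  by (simp add: hardy_of_def power_series_def)

lemma hardy_of_borel: "hardy_of a \<in> borel_measurable borel"
  by (rule analytic_borel[OF hardy_of_analytic hardy_of_outside])

lemma hardy_of_abs_summable: "z \<in> polydisc \<Longrightarrow> (\<lambda>x. norm (coef a x * mon x z)) summable_on nonneg_cone"
  by (rule power_series_abs_summable) (rule coef_bound)

lemma hardy_of_has_sum: "z \<in> polydisc \<Longrightarrow> ((\<lambda>x. coef a x * mon x z) has_sum hardy_of a z) nonneg_cone"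
  using abs_summable_summable[OF hardy_of_abs_summable[of z a]] by (simp add: hardy_of_def power_series_def)

lemma hardy_of_linear:
  "hardy_of (a + b) z = hardy_of a z + hardy_of b z" "hardy_of (a - b) z = hardy_of a z - hardy_of b z"
  "hardy_of (cscale c a) z = c * hardy_of a z"
proof -
  have add: "hardy_of (a + b) z = hardy_of a z + hardy_of b z" for a b
  proof (cases "z \<in> polydisc")
    case True
    have "((\<lambda>x. coef (a + b) x * mon x z) has_sum hardy_of a z + hardy_of b z) nonneg_cone"
      using has_sum_add[OF hardy_of_has_sum[OF True, of a] hardy_of_has_sum[OF True, of b]]
      by (simp add: distrib_right)
    then show ?thesis using hardy_of_has_sum[OF True, of "a + b"] has_sum_unique by blast
  qed (simp add: hardy_of_outside)
  have sc: "hardy_of (cscale c a) z = c * hardy_of a z" for c a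
  proof (cases "z \<in> polydisc")
    case True
    have "((\<lambda>x. coef (cscale c a) x * mon x z) has_sum c * hardy_of a z) nonneg_cone"
      using has_sum_cmult_right[OF hardy_of_has_sum[OF True, of a], of c] by (simp add: mult_ac)
    then show ?thesis using hardy_of_has_sum[OF True, of "cscale c a"] has_sum_unique by blast
  qed (simp add: hardy_of_outside)
  have "a - b = a + cscale (- 1) b" by (rule ell2_eqI) simp
  then have "hardy_of (a - b) z = hardy_of a z + hardy_of (cscale (- 1) b) z" by (simp only: add)
  then show "hardy_of (a - b) z = hardy_of a z - hardy_of b z" by (simp add: sc)
  show "hardy_of (a + b) z = hardy_of a z + hardy_of b z" "hardy_of (cscale c a) z = c * hardy_of a z"
    by (rule add, rule sc)
qed

lemma hardy_of_summable:
  assumes "0 \<le> \<rho>" "\<rho> < 1"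
  shows "(\<lambda>x. cmod (coef a x) * \<rho> ^ deg x) summable_on nonneg_cone"
  using assms
  by (intro summable_on_comparison_test[OF summable_on_cmult_right[OF power_deg_summable[of \<rho>], of "norm a"]])
    (auto intro: mult_right_mono coef_bound)

lemma hardy_of_radial_mean:
  assumes "0 \<le> r" "r < 1"
  shows "((\<lambda>x. (cmod (coef a x))\<^sup>2 * r ^ (2 * deg x)) has_sum radial_mean (hardy_of a) r) nonneg_cone"
  by (rule radial_mean_has_sum[OF hardy_of_analytic hardy_of_borel hardy_of_summable hardy_of_has_sum assms])

lemma radial_partial_sums_le:
  fixes s :: "'i \<Rightarrow> real"
  assumes "finite F" "\<And>r. 0 \<le> r \<Longrightarrow> r < 1 \<Longrightarrow> (\<Sum>a\<in>F. s a * r ^ k a) \<le> B"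
  shows "(\<Sum>a\<in>F. s a) \<le> B"
proof (rule tendsto_upperbound)
  show "((\<lambda>r. \<Sum>a\<in>F. s a * r ^ k a) \<longlongrightarrow> (\<Sum>a\<in>F. s a)) (at_left 1)"
    by (auto intro!: tendsto_eq_intros)
  have "\<forall>\<^sub>F r in at_left (1 :: real). r \<in> {0<..<1}"
    by (intro eventually_at_leftI[of 0]) auto
  then show "\<forall>\<^sub>F r in at_left 1. (\<Sum>a\<in>F. s a * r ^ k a) \<le> B"
    by eventually_elim (use assms(2) in auto)
qed simp

text \<open>The supremum of the radial means is the full sum of squares, as each finite partial sum is recovered
  in the limit \<open>r \<rightarrow> 1\<close>.\<close>

lemma hardy_of_norm_bounds:
  fixes a :: "('n::finite \<Rightarrow> int) ell2"
  assumes a: "supp_in nonneg_cone a"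
  shows "0 \<le> r \<Longrightarrow> r < 1 \<Longrightarrow> radial_mean (hardy_of a) r \<le> (norm a)\<^sup>2"
    and "(\<And>r. 0 \<le> r \<Longrightarrow> r < 1 \<Longrightarrow> radial_mean (hardy_of a) r \<le> B) \<Longrightarrow> (norm a)\<^sup>2 \<le> B"
proof -
  have nrm: "((\<lambda>x. (cmod (coef a x))\<^sup>2) has_sum (norm a)\<^sup>2) nonneg_cone"
  proof -
    have "((\<lambda>x. (cmod (coef a x))\<^sup>2) has_sum (norm a)\<^sup>2) UNIV"
      unfolding norm_ell2_square by (rule has_sum_infsum[OF coef_square_summable])
    then show ?thesis
      by (rule has_sum_cong_neutral[THEN iffD1, rotated -1]) (use a in \<open>auto simp: supp_in_def\<close>)
  qed
  show "radial_mean (hardy_of a) r \<le> (norm a)\<^sup>2" if r: "0 \<le> r" "r < 1"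
  proof (rule has_sum_mono[OF hardy_of_radial_mean[OF r] nrm])
    fix x :: "'n \<Rightarrow> int"
    have "r ^ (2 * deg x) \<le> 1" using r by (intro power_le_one) auto
    then show "(cmod (coef a x))\<^sup>2 * r ^ (2 * deg x) \<le> (cmod (coef a x))\<^sup>2"
      by (simp add: mult_left_le)
  qed
  show "(norm a)\<^sup>2 \<le> B" if B: "\<And>r. 0 \<le> r \<Longrightarrow> r < 1 \<Longrightarrow> radial_mean (hardy_of a) r \<le> B"
  proof (rule has_sum_le_finite_sums[OF nrm])
    fix F :: "('n \<Rightarrow> int) set" assume F: "finite F" "F \<subseteq> nonneg_cone"
    show "(\<Sum>x\<in>F. (cmod (coef a x))\<^sup>2) \<le> B"
    proof (rule radial_partial_sums_le[OF F(1)])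
      fix r :: real assume r: "0 \<le> r" "r < 1"
      have "(\<Sum>x\<in>F. (cmod (coef a x))\<^sup>2 * r ^ (2 * deg x)) \<le> radial_mean (hardy_of a) r"
        by (rule finite_sum_le_has_sum[OF hardy_of_radial_mean[OF r] F(1,2)]) (use r in auto)
      then show "(\<Sum>x\<in>F. (cmod (coef a x))\<^sup>2 * r ^ (2 * deg x)) \<le> B" using B[OF r] by linarith
    qed
  qed
qed

lemma hardy_of_in_hardy2:
  assumes "supp_in nonneg_cone a"
  shows "hardy_of a \<in> hardy2" "hardy_norm (hardy_of a) = norm a"
proof -
  have bdd: "bdd_above (radial_mean (hardy_of a) ` {0..<1})"
    using hardy_of_norm_bounds(1)[OF assms] by (intro bdd_aboveI2[where M = "(norm a)\<^sup>2"]) auto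
  then show "hardy_of a \<in> hardy2"
    by (simp add: hardy2_def hardy_of_analytic hardy_of_outside)
  have "(SUP r\<in>{0..<1}. radial_mean (hardy_of a) r) = (norm a)\<^sup>2"
  proof (rule antisym)
    show "(SUP r\<in>{0..<1}. radial_mean (hardy_of a) r) \<le> (norm a)\<^sup>2"
      using hardy_of_norm_bounds(1)[OF assms] by (intro cSUP_least) auto
    show "(norm a)\<^sup>2 \<le> (SUP r\<in>{0..<1}. radial_mean (hardy_of a) r)"
      using bdd by (intro hardy_of_norm_bounds(2)[OF assms] cSUP_upper) auto
  qed
  then show "hardy_norm (hardy_of a) = norm a" by (simp add: hardy_norm_def)
qed

lemma hardy2_imp_hardy_of:
  assumes "f \<in> hardy2"
  obtains a where "supp_in nonneg_cone a" "f = hardy_of a"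
proof -
  have f: "analytic_polydisc f" "f \<in> borel_measurable borel" and f0: "\<And>z. z \<notin> polydisc \<Longrightarrow> f z = 0"
    and bdd: "bdd_above (radial_mean f ` {0..<1})"
    using assms analytic_borel by (auto simp: hardy2_def)
  obtain c where c: "\<And>\<rho>. 0 \<le> \<rho> \<Longrightarrow> \<rho> < 1 \<Longrightarrow> (\<lambda>a. cmod (c a) * \<rho> ^ deg a) summable_on nonneg_cone"
    "\<And>z. z \<in> polydisc \<Longrightarrow> ((\<lambda>a. c a * mon a z) has_sum f z) nonneg_cone"
    using polydisc_power_series[OF f] by blast
  obtain B where B: "\<And>r. 0 \<le> r \<Longrightarrow> r < 1 \<Longrightarrow> radial_mean f r \<le> B"
  proof -
    from bdd obtain M where "\<And>x. x \<in> radial_mean f ` {0..<1} \<Longrightarrow> x \<le> M" by (auto simp: bdd_above_def)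
    then show ?thesis by (intro that[of M]) auto
  qed
  define d where "d x = (if x \<in> nonneg_cone then c x else 0)" for x
  have "(\<Sum>x\<in>F. (cmod (d x))\<^sup>2) \<le> (sqrt (max 0 B))\<^sup>2" if F: "finite F" for F
  proof -
    have "(\<Sum>x\<in>F. (cmod (d x))\<^sup>2) = (\<Sum>x\<in>F \<inter> nonneg_cone. (cmod (c x))\<^sup>2)"
      using F by (intro sum.mono_neutral_cong_right) (auto simp: d_def)
    also have "\<dots> \<le> B"
    proof (rule radial_partial_sums_le)
      fix r :: real assume r: "0 \<le> r" "r < 1"
      have "(\<Sum>x\<in>F \<inter> nonneg_cone. (cmod (c x))\<^sup>2 * r ^ (2 * deg x)) \<le> radial_mean f r"
        by (rule finite_sum_le_has_sum[OF radial_mean_has_sum[OF f c r]]) (use F r in auto)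
      then show "(\<Sum>x\<in>F \<inter> nonneg_cone. (cmod (c x))\<^sup>2 * r ^ (2 * deg x)) \<le> B" using B[OF r] by linarith
    qed (use F in simp)
    finally show ?thesis by simp
  qed
  from ell2_memI(1)[OF this] have d: "coef (Ell2 d) = d" by simp
  show ?thesis
  proof (rule that[of "Ell2 d"])
    show "supp_in nonneg_cone (Ell2 d)" by (simp add: supp_in_def d) (simp add: d_def)
    have "f z = hardy_of (Ell2 d) z" for z
    proof (cases "z \<in> polydisc")
      case True
      have "(\<Sum>\<^sub>\<infinity>x\<in>nonneg_cone. d x * mon x z) = f z"
        using c(2)[OF True] by (intro infsumI) (simp add: d_def cong: has_sum_cong)
      then show ?thesis using True by (simp add: hardy_of_def power_series_def d)
    qed (simp add: f0 hardy_of_outside)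
    then show "f = hardy_of (Ell2 d)" by blast
  qed
qed

lemma hardy2_eq: "hardy2 = hardy_of ` {a. supp_in nonneg_cone a}"
  using hardy_of_in_hardy2(1) hardy2_imp_hardy_of by blast

lemma hardy_of_eq_iff:
  assumes "supp_in nonneg_cone a" "supp_in nonneg_cone b"
  shows "hardy_of a = hardy_of b \<longleftrightarrow> a = b"
proof
  assume "hardy_of a = hardy_of b"
  then have "hardy_of (a - b) = (\<lambda>z. 0)" by (auto simp: hardy_of_linear)
  moreover have "hardy_of (0 :: ('a \<Rightarrow> int) ell2) = (\<lambda>z. 0)"
    using hardy_of_linear(3)[of 0 0] by auto
  ultimately have "hardy_norm (hardy_of (a - b)) = hardy_norm (hardy_of (0 :: ('a \<Rightarrow> int) ell2))" by simp
  then have "norm (a - b) = 0"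
    using hardy_of_in_hardy2(2)[of "a - b"] hardy_of_in_hardy2(2)[of "0 :: ('a \<Rightarrow> int) ell2"] assms by simp
  then show "a = b" by simp
qed simp

lemma cinner_polarization:
  "cinner a b = (\<Sum>k<4. \<i> ^ k * of_real ((norm (a + cscale (\<i> ^ k) b))\<^sup>2)) / 4"
proof -
  have s4: "(\<Sum>k<4. h k) = h 0 + h 1 + h 2 + h 3" for h :: "nat \<Rightarrow> complex"
    by (simp add: numeral_eq_Suc)
  have i3: "\<i> ^ 3 = - \<i>" by (simp add: power3_eq_cube)
  show ?thesis
    unfolding cinner_self_norm[symmetric] s4
    by (simp add: cinner_add_left cinner_simps i3 algebra_simps del: cscale_simps)
qed

lemma hardy_inner_hardy_of:
  assumes "supp_in nonneg_cone a" "supp_in nonneg_cone b"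
  shows "hardy_inner (hardy_of a) (hardy_of b) = cinner a b"
proof -
  have "(\<lambda>z. hardy_of a z + c * hardy_of b z) = hardy_of (a + cscale c b)" for c
    by (auto simp: hardy_of_linear)
  then have "hardy_norm (\<lambda>z. hardy_of a z + c * hardy_of b z) = norm (a + cscale c b)" for c
    using hardy_of_in_hardy2(2)[of "a + cscale c b"] assms by simp
  then show ?thesis unfolding hardy_inner_def cinner_polarization[of a b] by simp
qed

section \<open>Multiplication in the Hardy space\<close>

lemma hardy_of_delta:
  assumes "x \<in> nonneg_cone" "z \<in> polydisc"
  shows "hardy_of (delta x) z = mon x z"
proof -
  have "((\<lambda>y. coef (delta x) y * mon y z) has_sum mon x z) {x}"
    using has_sum_finite[of "{x}" "\<lambda>y. coef (delta x) y * mon y z"] by simp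
  then have "((\<lambda>y. coef (delta x) y * mon y z) has_sum mon x z) nonneg_cone"
    by (rule has_sum_cong_neutral[THEN iffD1, rotated -1]) (use assms in auto)
  then show ?thesis using hardy_of_has_sum[OF assms(2)] has_sum_unique by blast
qed

lemma hardy_of_one: "z \<in> polydisc \<Longrightarrow> hardy_of (delta 0) z = 1"
  using hardy_of_delta[OF zero_in_nonneg_cone] mon_0 by simp

lemma supp_in_shift_cone: "x \<in> nonneg_cone \<Longrightarrow> supp_in nonneg_cone u \<Longrightarrow> supp_in nonneg_cone (shift x u)"
  by (auto intro: supp_in_shift nonneg_cone_add)

lemma hardy_of_shift:
  assumes x: "x \<in> nonneg_cone" and u: "supp_in nonneg_cone u" and z: "z \<in> polydisc"
  shows "hardy_of (shift x u) z = mon x z * hardy_of u z"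
proof -
  have "((\<lambda>y. mon x z * (coef u y * mon y z)) has_sum mon x z * hardy_of u z) nonneg_cone"
    by (intro has_sum_cmult_right hardy_of_has_sum z)
  then have "(((\<lambda>y. coef (shift x u) y * mon y z) \<circ> (\<lambda>y. y + x)) has_sum mon x z * hardy_of u z) nonneg_cone"
    by (rule has_sum_cong[THEN iffD1, rotated]) (use x in \<open>simp add: mon_add\<close>)
  then have "((\<lambda>y. coef (shift x u) y * mon y z) has_sum mon x z * hardy_of u z) ((\<lambda>y. y + x) ` nonneg_cone)"
    by (subst has_sum_reindex) (auto simp: inj_on_def)
  then have "((\<lambda>y. coef (shift x u) y * mon y z) has_sum mon x z * hardy_of u z) nonneg_cone"
  proof (rule has_sum_cong_neutral[THEN iffD1, rotated -1])
    fix y assume "y \<in> nonneg_cone - (\<lambda>y. y + x) ` nonneg_cone"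
    then have "y - x \<notin> nonneg_cone" by (metis DiffD2 diff_add_cancel imageI)
    then show "coef (shift x u) y * mon y z = 0" using u by (simp add: supp_in_def)
  next
    fix y assume "y \<in> (\<lambda>y. y + x) ` nonneg_cone - nonneg_cone"
    then show "coef (shift x u) y * mon y z = 0" using nonneg_cone_add x by blast
  qed simp
  then show ?thesis using hardy_of_has_sum[OF z] has_sum_unique by blast
qed

lemma hardy_of_bound:
  fixes z :: "complex ^ 'n::finite"
  obtains K where "\<And>a. cmod (hardy_of a z) \<le> norm a * K"
proof (cases "z \<in> polydisc")
  case False
  then show ?thesis using that[of 0] by (simp add: hardy_of_outside)
next
  case True
  have s: "(\<lambda>x. norm (mon x z)) summable_on nonneg_cone"
    using power_series_abs_summable[of "\<lambda>_. 1" 1 z] True by simp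
  show ?thesis
  proof (rule that[of "\<Sum>\<^sub>\<infinity>x\<in>nonneg_cone. norm (mon x z)"])
    fix a :: "('n \<Rightarrow> int) ell2"
    have "hardy_of a z = (\<Sum>\<^sub>\<infinity>x\<in>nonneg_cone. coef a x * mon x z)"
      by (rule infsumI[symmetric, OF hardy_of_has_sum[OF True]])
    then have "cmod (hardy_of a z) \<le> (\<Sum>\<^sub>\<infinity>x\<in>nonneg_cone. norm (coef a x * mon x z))"
      using norm_infsum_bound[OF hardy_of_abs_summable[OF True]] by simp
    also have "\<dots> \<le> (\<Sum>\<^sub>\<infinity>x\<in>nonneg_cone. norm a * norm (mon x z))"
      by (intro infsum_mono hardy_of_abs_summable[OF True] summable_on_cmult_right s)
        (auto simp: norm_mult intro: mult_right_mono coef_bound)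
    finally show "cmod (hardy_of a z) \<le> norm a * (\<Sum>\<^sub>\<infinity>x\<in>nonneg_cone. norm (mon x z))"
      by (simp add: infsum_cmult_right')
  qed
qed

lemma bounded_linear_hardy_of: "bounded_linear (\<lambda>a. hardy_of a z)"
proof -
  obtain K where K: "\<And>a. cmod (hardy_of a z) \<le> norm a * K" using hardy_of_bound[of z] by blast
  then show ?thesis
    by (intro bounded_linear_intro[where K = K])
      (auto simp: hardy_of_linear scaleR_conv_of_real simp flip: cscale_of_real)
qed

lemma hardy_of_conv:
  assumes u: "uni u" "supp_in nonneg_cone u" and f: "supp_in nonneg_cone f"
  shows "hardy_of (conv u f) z = hardy_of u z * hardy_of f z"
proof (cases "z \<in> polydisc")
  case True
  show ?thesis
  proof (rule bounded_linear_eqI[where A = nonneg_cone and X = "\<lambda>f. hardy_of (conv u f) z"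
        and Y = "\<lambda>f. hardy_of u z * hardy_of f z"])
    show "bounded_linear (\<lambda>f. hardy_of (conv u f) z)"
      by (intro bounded_linear_compose[OF bounded_linear_hardy_of bounded_linear_conv] u)
    show "bounded_linear (\<lambda>f. hardy_of u z * hardy_of f z)"
      by (intro bounded_linear_const_mult bounded_linear_hardy_of)
    show "hardy_of (conv u (cscale c (delta a))) z = hardy_of u z * hardy_of (cscale c (delta a)) z"
      if "a \<in> nonneg_cone" for c a
      using that u True
      by (simp add: conv_linear conv_delta hardy_of_linear hardy_of_shift hardy_of_delta)
  qed (use f in \<open>auto simp: supp_in_def\<close>)
qed (simp add: hardy_of_outside)

lemma supp_in_conv_cone:
  "uni u \<Longrightarrow> supp_in nonneg_cone u \<Longrightarrow> supp_in nonneg_cone f \<Longrightarrow> supp_in nonneg_cone (conv u f)"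
  by (rule supp_in_conv) (auto intro: nonneg_cone_add)

text \<open>All powers of \<open>u\<close> have norm one, and evaluation at \<open>z\<close> is a bounded functional, so the powers of the value
  at \<open>z\<close> are bounded.\<close>

lemma hardy_of_uni_bound:
  assumes u: "uni u" "supp_in nonneg_cone u"
  shows "cmod (hardy_of u z) \<le> 1"
proof (cases "z \<in> polydisc")
  case True
  obtain K where K: "\<And>a. cmod (hardy_of a z) \<le> norm a * K" using hardy_of_bound[of z] by blast
  obtain d :: "('a \<Rightarrow> int) ell2" where d: "supp_in nonneg_cone d" "norm d = 1" "hardy_of d z = 1"
    using hardy_of_one[OF True] by (intro that[of "delta 0"]) simp_all
  have pow: "supp_in nonneg_cone ((conv u ^^ n) d) \<and> norm ((conv u ^^ n) d) = 1 \<and>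
      hardy_of ((conv u ^^ n) d) z = hardy_of u z ^ n" for n
    by (induction n) (use u d in \<open>simp_all add: supp_in_conv_cone hardy_of_conv\<close>)
  have "cmod (hardy_of u z) ^ n \<le> K" for n
    using K[of "(conv u ^^ n) d"] pow[of n] by (simp add: norm_power)
  then show ?thesis by (metis not_le real_arch_pow)
qed (simp add: hardy_of_outside)

section \<open>Inner functions and unimodular symbols\<close>

definition unimodular_limit :: "(complex ^ 'n \<Rightarrow> complex) \<Rightarrow> complex ^ 'n \<Rightarrow> bool" where
  "unimodular_limit f z \<longleftrightarrow> (\<exists>w. ((\<lambda>r. f (r *\<^sub>R z)) \<longlongrightarrow> w) (at_left 1) \<and> cmod w = 1)"

lemma at_left_1_radius: "\<forall>\<^sub>F r in at_left (1 :: real). 0 < r \<and> r < 1"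
  by (rule eventually_at_leftI[of 0]) auto

lemma torus_radius_polydisc:
  "(\<And>i. cmod (z $ i) = 1) \<Longrightarrow> 0 \<le> r \<Longrightarrow> r < 1 \<Longrightarrow> r *\<^sub>R z \<in> polydisc"
  by (simp add: polydisc_def)

lemma unimodular_limit_cong:
  assumes "\<And>i. cmod (z $ i) = 1" "\<And>z. z \<in> polydisc \<Longrightarrow> f z = g z"
  shows "unimodular_limit f z \<longleftrightarrow> unimodular_limit g z"
proof -
  have "\<forall>\<^sub>F r in at_left 1. f (r *\<^sub>R z) = g (r *\<^sub>R z)"
    using at_left_1_radius
  proof eventually_elim
    case (elim r)
    then show ?case using assms(1) by (intro assms(2) torus_radius_polydisc) auto
  qed
  then have "((\<lambda>r. f (r *\<^sub>R z)) \<longlongrightarrow> w) (at_left 1) \<longleftrightarrow> ((\<lambda>r. g (r *\<^sub>R z)) \<longlongrightarrow> w) (at_left 1)" for w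
    by (rule tendsto_cong)
  then show ?thesis by (simp add: unimodular_limit_def)
qed

definition radius :: "nat \<Rightarrow> real" where
  "radius n = 1 - inverse (real (Suc n))"

lemma radius: "0 \<le> radius n" "radius n < 1" "radius \<longlonglongrightarrow> 1"
  using LIMSEQ_inverse_real_of_nat_add_minus[of 1]
  by (auto simp: radius_def[abs_def] field_simps)

lemma radius_at_left: "filterlim radius (at_left 1) sequentially"
  unfolding filterlim_at using radius by (auto simp: less_le)

lemma hardy_of_norm_limit:
  assumes a: "supp_in nonneg_cone a" and L: "(\<lambda>n. radial_mean (hardy_of a) (radius n)) \<longlonglongrightarrow> L"
  shows "(norm a)\<^sup>2 = L"
proof (rule antisym)
  show "L \<le> (norm a)\<^sup>2"
    using hardy_of_norm_bounds(1)[OF a] radius by (intro LIMSEQ_le_const2[OF L]) auto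
  show "(norm a)\<^sup>2 \<le> L"
  proof (rule hardy_of_norm_bounds(2)[OF a])
    fix r :: real assume r: "0 \<le> r" "r < 1"
    have "\<forall>\<^sub>F n in sequentially. r < radius n" using order_tendstoD(1)[OF radius(3) r(2)] .
    then have "\<forall>\<^sub>F n in sequentially. radial_mean (hardy_of a) r \<le> radial_mean (hardy_of a) (radius n)"
    proof eventually_elim
      case (elim n)
      then show ?case
        using r radius
        by (intro has_sum_mono[OF hardy_of_radial_mean[OF r, of a] hardy_of_radial_mean[of "radius n" a]]
            mult_left_mono power_mono) auto
    qed
    then show "radial_mean (hardy_of a) r \<le> L"
      by (intro tendsto_lowerbound[OF L]) auto
  qed
qed

text \<open>Only two monomials are multiplied, because by polarization that is all the orthonormality of the translates
  of \<open>p\<close> requires. The product is bounded, so its radial means converge by dominated convergence, and in the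
  limit the modulus of \<open>p\<close> disappears.\<close>

lemma norm_polynomial_multiple:
  fixes p :: "('n::finite \<Rightarrow> int) ell2"
  assumes p: "supp_in nonneg_cone p" and C: "\<And>z. z \<in> polydisc \<Longrightarrow> cmod (hardy_of p z) \<le> C"
    and lim: "AE z in torus_measure. unimodular_limit (hardy_of p) z"
    and \<beta>: "\<beta> \<in> nonneg_cone" and \<gamma>: "\<gamma> \<in> nonneg_cone"
  shows "(norm (cscale c (shift \<beta> p) + cscale d (shift \<gamma> p)))\<^sup>2 =
    (\<integral>z. (cmod (c * mon \<beta> z + d * mon \<gamma> z))\<^sup>2 \<partial>torus_measure)"
proof -
  define h where "h = cscale c (shift \<beta> p) + cscale d (shift \<gamma> p)"
  define Q where "Q z = c * mon \<beta> z + d * mon \<gamma> z" for z :: "complex ^ 'n"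
  have Qcont: "continuous_on UNIV Q"
    unfolding Q_def mon_def by (intro continuous_intros)
  have [measurable]: "Q \<in> borel_measurable borel" using Qcont by (rule borel_measurable_continuous_onI)
  have h: "supp_in nonneg_cone h" using p \<beta> \<gamma> by (simp add: h_def supp_in_shift_cone)
  have hQ: "hardy_of h z = Q z * hardy_of p z" if "z \<in> polydisc" for z
    using p \<beta> \<gamma> that by (simp add: h_def Q_def hardy_of_linear hardy_of_shift distrib_right)
  note [measurable] = hardy_of_borel[of h]
  have Q_bound: "cmod (Q (r *\<^sub>R z)) \<le> cmod c + cmod d"
    if "\<And>i. cmod (z $ i) = 1" "0 \<le> r" "r < 1" for r z
  proof -
    have "cmod (mon a (r *\<^sub>R z)) \<le> 1" for a
      using norm_mon_le[of "r *\<^sub>R z" 1 a] that by simp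
    then have "cmod c * cmod (mon \<beta> (r *\<^sub>R z)) \<le> cmod c" "cmod d * cmod (mon \<gamma> (r *\<^sub>R z)) \<le> cmod d"
      by (simp_all add: mult_left_le)
    then show ?thesis
      unfolding Q_def by (intro order_trans[OF norm_triangle_ineq] add_mono) (simp_all add: norm_mult)
  qed
  have "(\<lambda>n. radial_mean (hardy_of h) (radius n)) \<longlonglongrightarrow> (\<integral>z. (cmod (Q z))\<^sup>2 \<partial>torus_measure)"
    unfolding radial_mean_def
  proof (rule integral_dominated_convergence[where w = "\<lambda>_. ((cmod c + cmod d) * C)\<^sup>2"])
    show "AE z in torus_measure. (\<lambda>n. (cmod (hardy_of h (radius n *\<^sub>R z)))\<^sup>2) \<longlonglongrightarrow> (cmod (Q z))\<^sup>2"
      using AE_torus_norm lim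
    proof eventually_elim
      case (elim z)
      obtain w where w: "((\<lambda>r. hardy_of p (r *\<^sub>R z)) \<longlongrightarrow> w) (at_left 1)" "cmod w = 1"
        using elim by (auto simp: unimodular_limit_def)
      have "(\<lambda>n. hardy_of p (radius n *\<^sub>R z)) \<longlonglongrightarrow> w"
        by (rule filterlim_compose[OF w(1) radius_at_left])
      moreover have "(\<lambda>n. Q (radius n *\<^sub>R z)) \<longlonglongrightarrow> Q z"
      proof -
        have "(\<lambda>n. radius n *\<^sub>R z) \<longlonglongrightarrow> 1 *\<^sub>R z" by (intro tendsto_intros radius)
        then show ?thesis
          using Qcont by (intro isCont_tendsto_compose[of z Q]) (simp_all add: continuous_on_eq_continuous_at)
      qed
      ultimately have "(\<lambda>n. (cmod (Q (radius n *\<^sub>R z) * hardy_of p (radius n *\<^sub>R z)))\<^sup>2) \<longlonglongrightarrow> (cmod (Q z * w))\<^sup>2"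
        by (intro tendsto_intros)
      then show ?case using elim radius w(2) by (simp add: hQ torus_radius_polydisc norm_mult)
    qed
    show "AE z in torus_measure. norm ((cmod (hardy_of h (radius n *\<^sub>R z)))\<^sup>2) \<le> ((cmod c + cmod d) * C)\<^sup>2" for n
      using AE_torus_norm
    proof eventually_elim
      case (elim z)
      have "radius n *\<^sub>R z \<in> polydisc" using elim radius torus_radius_polydisc by blast
      then have "cmod (hardy_of h (radius n *\<^sub>R z)) \<le> (cmod c + cmod d) * C"
        unfolding hQ[OF \<open>radius n *\<^sub>R z \<in> polydisc\<close>] norm_mult
        using elim radius by (intro mult_mono Q_bound C) auto
      then show ?case by (simp add: power_mono)
    qed
    show "(\<lambda>z. (cmod (Q z))\<^sup>2) \<in> borel_measurable torus_measure" by measurable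
    show "(\<lambda>z. (cmod (hardy_of h (radius n *\<^sub>R z)))\<^sup>2) \<in> borel_measurable torus_measure" for n
      by measurable
  qed simp
  from hardy_of_norm_limit[OF h this] show ?thesis by (simp add: h_def Q_def)
qed

text \<open>The norm of a binomial is not changed by multiplication with \<open>\<phi>\<close>; by polarization the translates of its
  coefficient family by exponents in the cone are orthonormal. Every exponent is a difference of two such
  exponents.\<close>

lemma inner_function_symbol:
  fixes \<phi> :: "complex ^ 'n::finite \<Rightarrow> complex"
  assumes "inner_function \<phi>"
  obtains p where "uni p" "supp_in nonneg_cone p" "\<And>z. z \<in> polydisc \<Longrightarrow> \<phi> z = hardy_of p z"
    "AE z in torus_measure. unimodular_limit (hardy_of p) z"
proof -
  define f where "f z = (if z \<in> polydisc then \<phi> z else 0)" for z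
  have \<phi>: "analytic_polydisc \<phi>" "bounded (\<phi> ` polydisc)"
    and lim: "AE z in torus_measure. unimodular_limit \<phi> z"
    using assms by (auto simp: inner_function_def hardy_infinity_def unimodular_limit_def)
  obtain C where C: "\<And>z. z \<in> polydisc \<Longrightarrow> cmod (\<phi> z) \<le> C" using \<phi>(2) by (auto simp: bounded_iff)
  have f: "analytic_polydisc f"
    by (rule analytic_polydisc_cong[OF _ \<phi>(1)]) (simp add: f_def)
  have [measurable]: "f \<in> borel_measurable borel" by (rule analytic_borel[OF f]) (simp add: f_def)
  have "radial_mean f r \<le> C\<^sup>2" if "0 \<le> r" "r < 1" for r
    unfolding radial_mean_def
  proof (rule torus.integral_le_const)
    show AE: "AE z in torus_measure. (cmod (f (r *\<^sub>R z)))\<^sup>2 \<le> C\<^sup>2"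
      using AE_torus_norm
      by eventually_elim (use that C in \<open>auto simp: f_def torus_radius_polydisc intro!: power_mono\<close>)
    show "integrable torus_measure (\<lambda>z. (cmod (f (r *\<^sub>R z)))\<^sup>2)"
      by (rule torus.integrable_const_bound[where B = "C\<^sup>2"]) (use AE in auto)
  qed
  then have "f \<in> hardy2"
    using f by (auto simp: hardy2_def f_def intro!: bdd_aboveI2[where M = "C\<^sup>2"])
  then obtain p where p: "supp_in nonneg_cone p" "f = hardy_of p" using hardy2_imp_hardy_of by blast
  have eq: "\<phi> z = hardy_of p z" if "z \<in> polydisc" for z using that by (simp add: p(2)[symmetric] f_def)
  have lim_p: "AE z in torus_measure. unimodular_limit (hardy_of p) z"
    using lim AE_torus_norm
  proof eventually_elim
    case (elim z)
    then show ?case using unimodular_limit_cong[of z \<phi> "hardy_of p"] eq by simp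
  qed
  have lim_1: "AE z in torus_measure. unimodular_limit (hardy_of (delta 0)) (z :: complex ^ 'n)"
    using AE_torus_norm
  proof eventually_elim
    case (elim z)
    have "unimodular_limit (\<lambda>_. 1) z" by (auto simp: unimodular_limit_def intro!: exI[of _ 1])
    then show ?case using unimodular_limit_cong[of z "\<lambda>_. 1" "hardy_of (delta 0)"] elim by (simp add: hardy_of_delta)
  qed
  have norms: "norm (cscale c (shift \<beta> p) + cscale d (shift \<gamma> p)) = norm (cscale c (delta \<beta>) + cscale d (delta \<gamma>))"
    if "\<beta> \<in> nonneg_cone" "\<gamma> \<in> nonneg_cone" for \<beta> \<gamma> c d
  proof -
    have 1: "cmod (hardy_of p z) \<le> C" if "z \<in> polydisc" for z using C[OF that] eq[OF that] by simp
    have 2: "cmod (hardy_of (delta 0) z) \<le> 1" if "z \<in> polydisc" for z :: "complex ^ 'n"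
      using that by (simp add: hardy_of_delta)
    have 3: "supp_in nonneg_cone (delta 0 :: ('n \<Rightarrow> int) ell2)" by simp
    have "(norm (cscale c (shift \<beta> p) + cscale d (shift \<gamma> p)))\<^sup>2 =
        (norm (cscale c (shift \<beta> (delta 0)) + cscale d (shift \<gamma> (delta 0 :: ('n \<Rightarrow> int) ell2))))\<^sup>2"
      by (rule trans[OF norm_polynomial_multiple[OF p(1) 1 lim_p that]
            norm_polynomial_multiple[OF 3 2 lim_1 that, symmetric]])
    then have "norm (cscale c (shift \<beta> p) + cscale d (shift \<gamma> p)) =
        norm (cscale c (shift \<beta> (delta 0)) + cscale d (shift \<gamma> (delta 0 :: ('n \<Rightarrow> int) ell2)))"
      by (rule power2_eq_imp_eq) simp_all
    then show ?thesis by simp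
  qed
  have orth: "cinner (shift \<beta> p) (shift \<gamma> p) = cinner (delta \<beta>) (delta \<gamma>)"
    if "\<beta> \<in> nonneg_cone" "\<gamma> \<in> nonneg_cone" for \<beta> \<gamma>
    unfolding cinner_polarization using norms[OF that, of 1] by simp
  have "uni p"
    unfolding uni_def
  proof
    fix a :: "'n \<Rightarrow> int"
    define \<beta> \<gamma> where "\<beta> = (\<lambda>i. max 0 (a i))" and "\<gamma> = (\<lambda>i. max 0 (- a i))"
    have bg: "\<beta> \<in> nonneg_cone" "\<gamma> \<in> nonneg_cone" "a = \<beta> - \<gamma>"
      by (auto simp: nonneg_cone_def \<beta>_def \<gamma>_def fun_eq_iff)
    have "cinner (shift a p) p = cinner (shift \<gamma> (shift a p)) (shift \<gamma> p)" by (simp only: cinner_shift_shift)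
    also have "\<dots> = cinner (shift \<beta> p) (shift \<gamma> p)" by (simp add: bg(3))
    also have "\<dots> = (if a = 0 then 1 else 0)" using orth[OF bg(1,2)] by (simp add: bg(3))
    finally show "cinner (shift a p) p = (if a = 0 then 1 else 0)" .
  qed
  then show ?thesis using that p(1) eq lim_p by blast
qed

lemma inner_function_hardy_of:
  assumes "uni u" "supp_in nonneg_cone u" "AE z in torus_measure. unimodular_limit (hardy_of u) z"
  shows "inner_function (hardy_of u)"
  using assms hardy_of_uni_bound[OF assms(1,2)] hardy_of_analytic[of u]
  by (auto simp: inner_function_def hardy_infinity_def unimodular_limit_def bounded_iff)

section \<open>Dependence on coordinates\<close>

lemma hardy_of_coordinates:
  assumes u: "supp_in {a. \<forall>i\<in>J. a i = 0} u" and zw: "z \<in> polydisc" "w \<in> polydisc" "\<And>i. i \<notin> J \<Longrightarrow> z $ i = w $ i"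
  shows "hardy_of u z = hardy_of u w"
proof -
  have "coef u x * mon x z = coef u x * mon x w" for x
  proof (cases "coef u x = 0")
    case False
    then have x: "x i = 0" if "i \<in> J" for i using u that by (auto simp: supp_in_def)
    have "z $ i ^ nat (x i) = w $ i ^ nat (x i)" for i using x[of i] zw(3)[of i] by (cases "i \<in> J") auto
    then show ?thesis by (simp add: mon_def)
  qed simp
  then show ?thesis
    using hardy_of_has_sum[OF zw(1), of u] hardy_of_has_sum[OF zw(2), of u] has_sum_unique by (metis (no_types, lifting) has_sum_cong)
qed

text \<open>Setting the \<open>i\<close>-th coordinate to zero deletes all terms in which it occurs, and by assumption this does not
  change the function.\<close>

lemma supp_in_independent:
  fixes u :: "('n::finite \<Rightarrow> int) ell2"
  assumes u: "supp_in nonneg_cone u"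
    and indep: "\<And>z w. z \<in> polydisc \<Longrightarrow> w \<in> polydisc \<Longrightarrow> (\<And>j. j \<noteq> i \<Longrightarrow> z $ j = w $ j) \<Longrightarrow> hardy_of u z = hardy_of u w"
  shows "supp_in {a. a i = 0} u"
proof -
  let ?A = "{a :: 'n \<Rightarrow> int. a i = 0}"
  have "hardy_of u z = hardy_of (restr ?A u) z" for z
  proof (cases "z \<in> polydisc")
    case True
    define w where "w = (\<chi> j. if j = i then 0 else z $ j)"
    have w: "w \<in> polydisc" using True by (simp add: w_def polydisc_def)
    have "coef u x * mon x w = coef (restr ?A u) x * mon x z" if "x \<in> nonneg_cone" for x
    proof (cases "x i = 0")
      case True
      have "w $ j ^ nat (x j) = z $ j ^ nat (x j)" for j using True by (simp add: w_def)
      then show ?thesis using True by (simp add: mon_def)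
    next
      case False
      moreover have "0 \<le> x i" using that by (simp add: nonneg_cone_def)
      ultimately have "0 < nat (x i)" by simp
      then have "mon x w = 0" unfolding mon_def by (intro prod_zero bexI[of _ i]) (auto simp: w_def)
      then show ?thesis using False by simp
    qed
    then have "hardy_of (restr ?A u) z = hardy_of u w"
      using True w by (auto simp: hardy_of_def power_series_def intro: infsum_cong)
    also have "\<dots> = hardy_of u z" using w True by (intro indep) (auto simp: w_def)
    finally show ?thesis by simp
  qed (simp add: hardy_of_outside)
  then have "u = restr ?A u"
    using u by (subst hardy_of_eq_iff[symmetric]) (auto simp: supp_in_def)
  then show ?thesis by (metis supp_in_simps(1))
qed

section \<open>Radial limits of separated factors\<close>

lemma hardy_of_coefficient:
  assumes "0 \<le> \<rho>" "\<rho> < 1" "b \<in> nonneg_cone"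
  shows "(\<integral>z. hardy_of a (\<rho> *\<^sub>R z) * cnj (mon b z) \<partial>torus_measure) = coef a b * of_real \<rho> ^ deg b"
proof (rule power_series_coefficient[OF hardy_of_borel assms(1) _ hardy_of_has_sum assms(3)])
  show "(\<lambda>x. cmod (coef a x) * \<rho> ^ deg x) summable_on nonneg_cone"
    using assms by (intro hardy_of_summable)
  show "z \<in> polydisc" if "\<And>i. cmod (z $ i) = \<rho>" for z using that assms by (simp add: polydisc_def)
qed

text \<open>
  Mix the coordinates of \<open>z\<close> and \<open>z'\<close>. At the mixed point the radial limits of \<open>u s\<close> and \<open>v s\<close> are unimodular for almost all
  pairs, and \<open>u\<close> only sees \<open>z\<close> while \<open>v\<close> only sees \<open>z'\<close>. Thus \<open>v(r z') / u(r z)\<close> converges; moreover \<open>\<bar>u(r z)\<bar>\<close> tends to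
  one, because it lies between \<open>\<bar>u s\<bar>\<close> and one. For a fixed \<open>z\<close> put \<open>c(r) = 1 / u(r z)\<close>. Integrating \<open>v(r z') c(r)\<close> over \<open>z'\<close>
  against a conjugate monomial gives a nonzero coefficient of \<open>v\<close> times a power of \<open>r\<close> times \<open>c(r)\<close>. So \<open>c(r)\<close>
  converges, and with it \<open>v(r z')\<close> for almost all \<open>z'\<close>.
\<close>

lemma separated_factors_radial_limits:
  fixes u v s :: "('n::finite \<Rightarrow> int) ell2"
  assumes u: "uni u" "supp_in nonneg_cone u" "supp_in {a. \<forall>i\<in>J. a i = 0} u"
    and v: "uni v" "supp_in nonneg_cone v" "supp_in {a. \<forall>i\<in>-J. a i = 0} v"
    and s: "uni s" "supp_in nonneg_cone s"
    and lim_us: "AE z in torus_measure. unimodular_limit (hardy_of (conv u s)) z"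
    and lim_vs: "AE z in torus_measure. unimodular_limit (hardy_of (conv v s)) z"
  shows "AE z in torus_measure. unimodular_limit (hardy_of u) z"
    and "AE z in torus_measure. unimodular_limit (hardy_of v) z"
    and "AE z in torus_measure. unimodular_limit (hardy_of s) z"
proof -
  define U V S P Q where "U = hardy_of u" and "V = hardy_of v" and "S = hardy_of s"
    and "P = hardy_of (conv u s)" and "Q = hardy_of (conv v s)"
  have PU: "P z = U z * S z" "Q z = V z * S z" for z
    using u v s by (simp_all add: P_def Q_def U_def V_def S_def hardy_of_conv)
  have bound: "cmod (U z) \<le> 1" "cmod (V z) \<le> 1" "cmod (S z) \<le> 1" for z
    using u v s by (simp_all add: U_def V_def S_def hardy_of_uni_bound)
  have [measurable]: "V \<in> borel_measurable borel" by (simp add: V_def hardy_of_borel)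
  have [measurable]: "cnj \<in> borel_measurable borel"
    by (intro borel_measurable_continuous_onI continuous_intros)
  define tor where "tor z \<longleftrightarrow> (\<forall>i. cmod ((z :: complex ^ 'n) $ i) = 1)" for z
  have AE_tor: "AE z in torus_measure. tor z" using AE_torus_norm by (simp add: tor_def)
  define good where "good z z' \<longleftrightarrow> tor z \<and> tor z' \<and> unimodular_limit P (mix (- J) z z') \<and>
    unimodular_limit Q (mix (- J) z z')" for z z'
  have "AE z in torus_measure. AE z' in torus_measure. unimodular_limit P (mix (- J) z z') \<and>
    unimodular_limit Q (mix (- J) z z')"
    using lim_us lim_vs by (intro AE_torus_mix) (auto simp: P_def Q_def)
  then have AE_good: "AE z in torus_measure. AE z' in torus_measure. good z z'"
    using AE_tor
  proof eventually_elim
    case (elim z)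
    from elim(1) AE_tor show ?case by eventually_elim (use elim in \<open>auto simp: good_def\<close>)
  qed
  have ratio: "(\<exists>w. ((\<lambda>r. V (r *\<^sub>R z') / U (r *\<^sub>R z)) \<longlongrightarrow> w) (at_left 1) \<and> cmod w = 1) \<and>
      ((\<lambda>r. cmod (U (r *\<^sub>R z))) \<longlongrightarrow> 1) (at_left 1)" if g: "good z z'" for z z'
  proof -
    define y where "y = mix (- J) z z'"
    have tor: "tor z" "tor z'" "tor y" using that by (auto simp: good_def y_def tor_def)
    obtain w1 w2 where w: "((\<lambda>r. P (r *\<^sub>R y)) \<longlongrightarrow> w1) (at_left 1)" "cmod w1 = 1"
      "((\<lambda>r. Q (r *\<^sub>R y)) \<longlongrightarrow> w2) (at_left 1)" "cmod w2 = 1"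
      using g unfolding good_def y_def unimodular_limit_def by blast
    have "w1 \<noteq> 0" using w(2) by auto
    have Uy: "U (r *\<^sub>R y) = U (r *\<^sub>R z)" "V (r *\<^sub>R y) = V (r *\<^sub>R z')" if r: "0 < r" "r < 1" for r
    proof -
      have "r *\<^sub>R x \<in> polydisc" if "tor x" for x
        using that r by (intro torus_radius_polydisc) (auto simp: tor_def)
      then show "U (r *\<^sub>R y) = U (r *\<^sub>R z)" "V (r *\<^sub>R y) = V (r *\<^sub>R z')"
        unfolding U_def V_def using tor
        by (auto intro!: hardy_of_coordinates[OF u(3)] hardy_of_coordinates[OF v(3)] simp: y_def)
    qed
    have "((\<lambda>r. Q (r *\<^sub>R y) / P (r *\<^sub>R y)) \<longlongrightarrow> w2 / w1) (at_left 1)"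
      using w(1,3) \<open>w1 \<noteq> 0\<close> by (intro tendsto_divide)
    moreover have "\<forall>\<^sub>F r in at_left 1. Q (r *\<^sub>R y) / P (r *\<^sub>R y) = V (r *\<^sub>R z') / U (r *\<^sub>R z)"
      using tendsto_imp_eventually_ne[OF w(1) \<open>w1 \<noteq> 0\<close>] at_left_1_radius
    proof eventually_elim
      case (elim r)
      then show ?case using Uy[of r] by (simp add: PU)
    qed
    ultimately have 1: "((\<lambda>r. V (r *\<^sub>R z') / U (r *\<^sub>R z)) \<longlongrightarrow> w2 / w1) (at_left 1)"
      by (rule Lim_transform_eventually)
    have "((\<lambda>r. cmod (U (r *\<^sub>R z))) \<longlongrightarrow> 1) (at_left 1)"
    proof (rule tendsto_sandwich)
      show "((\<lambda>r. cmod (P (r *\<^sub>R y))) \<longlongrightarrow> 1) (at_left 1)" using tendsto_norm[OF w(1)] w(2) by simp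
      show "\<forall>\<^sub>F r in at_left 1. cmod (P (r *\<^sub>R y)) \<le> cmod (U (r *\<^sub>R z))"
        using at_left_1_radius
        by eventually_elim (use Uy bound(3) in \<open>simp add: PU norm_mult mult_left_le\<close>)
    qed (auto simp: bound)
    with 1 w(2,4) show ?thesis by (auto simp: norm_divide)
  qed
  \<comment> \<open>Fix a good point for the variables of \<open>u\<close>; the reciprocals along its radius turn out to converge.\<close>
  have exists_AE: "\<exists>z. R z" if "AE z in torus_measure. R (z :: complex ^ 'n)" for R
  proof (rule ccontr)
    assume "\<nexists>z. R z"
    then have "AE z in (torus_measure :: (complex ^ 'n) measure). False" using that by simp
    then show False using torus.AE_False by blast
  qed
  obtain z0 where z0: "AE z' in torus_measure. good z0 z'" using exists_AE[OF AE_good] by blast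
  define c where "c r = 1 / U (r *\<^sub>R z0)" for r
  obtain z1 where "good z0 z1" using exists_AE[OF z0] by blast
  then have U0: "((\<lambda>r. cmod (U (r *\<^sub>R z0))) \<longlongrightarrow> 1) (at_left 1)" using ratio by blast
  then have "((\<lambda>r. 1 / cmod (U (r *\<^sub>R z0))) \<longlongrightarrow> 1 / 1) (at_left 1)" by (intro tendsto_divide tendsto_const) auto
  then have cn: "((\<lambda>r. cmod (c r)) \<longlongrightarrow> 1) (at_left 1)" by (simp add: c_def norm_divide)
  have "\<forall>\<^sub>F r in at_left 1. cmod (c r) < 2" using order_tendstoD(2)[OF cn, of 2] by simp
  then obtain b0 where b0: "b0 < 1" "\<And>r. b0 < r \<Longrightarrow> r < 1 \<Longrightarrow> cmod (c r) < 2"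
    by (auto simp: eventually_at_left[of 0 1])
  define b where "b = max b0 0"
  have b: "0 \<le> b" "b < 1" "\<And>r. b < r \<Longrightarrow> r < 1 \<Longrightarrow> cmod (c r) \<le> 2"
    using b0 by (auto simp: b_def less_imp_le)
  define F where "F r z' = V (r *\<^sub>R z') * c r" for r z'
  define G where "G z' = lim (\<lambda>n. F (radius n) z')" for z'
  have [measurable]: "F r \<in> borel_measurable borel" for r unfolding F_def[abs_def] by measurable
  have [measurable]: "G \<in> borel_measurable borel" unfolding G_def[abs_def] by measurable
  have FG: "AE z' in torus_measure. ((\<lambda>r. F r z') \<longlongrightarrow> G z') (at_left 1) \<and> cmod (G z') = 1"
    using z0
  proof eventually_elim
    case (elim z')
    then obtain w where w: "((\<lambda>r. F r z') \<longlongrightarrow> w) (at_left 1)" "cmod w = 1"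
      using ratio by (auto simp: F_def c_def)
    have "(\<lambda>n. F (radius n) z') \<longlonglongrightarrow> w" by (rule filterlim_compose[OF w(1) radius_at_left])
    then have "G z' = w" by (simp add: G_def limI)
    then show ?case using w by simp
  qed
  have "v \<noteq> 0" using uni_orthonormal[OF v(1), of 0 0] by (auto simp: cinner_simps)
  then obtain k where k: "coef v k \<noteq> 0" using ell2_eqI[of v 0] by auto
  then have kN: "k \<in> nonneg_cone" using v(2) by (auto simp: supp_in_def)
  define L where "L = (\<integral>z. G z * cnj (mon k z) \<partial>torus_measure) / coef v k"
  have cL: "(c \<longlongrightarrow> L) (at_left 1)"
  proof (rule tendsto_at_left_sequentially[OF b(2)])
    fix R :: "nat \<Rightarrow> real"
    assume R: "\<And>n. R n < 1" "\<And>n. b < R n" "R \<longlonglongrightarrow> 1"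
    have Rl: "filterlim R (at_left 1) sequentially"
      unfolding filterlim_at using R by (auto simp: less_le)
    have R0: "0 \<le> R n" for n using R(2)[of n] b(1) by linarith
    have "(\<lambda>n. \<integral>z. F (R n) z * cnj (mon k z) \<partial>torus_measure) \<longlonglongrightarrow> (\<integral>z. G z * cnj (mon k z) \<partial>torus_measure)"
    proof (rule integral_dominated_convergence[where w = "\<lambda>_. 2"])
      show "AE z in torus_measure. (\<lambda>n. F (R n) z * cnj (mon k z)) \<longlonglongrightarrow> G z * cnj (mon k z)"
        using FG
        by eventually_elim (auto intro!: tendsto_intros filterlim_compose[OF _ Rl])
      show "AE z in torus_measure. norm (F (R n) z * cnj (mon k z)) \<le> 2" for n
        using AE_torus_norm
      proof eventually_elim
        case (elim z)
        have "cmod (V (R n *\<^sub>R z)) * cmod (c (R n)) \<le> 1 * 2"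
          using bound(2) b(3)[OF R(2,1)] by (intro mult_mono) auto
        then show ?case using elim by (simp add: F_def norm_mult norm_mon_torus)
      qed
      show "(\<lambda>z. G z * cnj (mon k z)) \<in> borel_measurable torus_measure" by measurable
      show "(\<lambda>z. F (R n) z * cnj (mon k z)) \<in> borel_measurable torus_measure" for n by measurable
    qed simp
    moreover have "(\<integral>z. F (R n) z * cnj (mon k z) \<partial>torus_measure) = coef v k * of_real (R n) ^ deg k * c (R n)" for n
    proof -
      have "(\<integral>z. F (R n) z * cnj (mon k z) \<partial>torus_measure) = (\<integral>z. c (R n) * (V (R n *\<^sub>R z) * cnj (mon k z)) \<partial>torus_measure)"
        by (simp add: F_def mult_ac)
      also have "\<dots> = c (R n) * (coef v k * of_real (R n) ^ deg k)"
        unfolding integral_mult_right_zero V_def by (subst hardy_of_coefficient[OF R0 R(1) kN]) simp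
      finally show ?thesis by simp
    qed
    ultimately have "(\<lambda>n. coef v k * of_real (R n) ^ deg k * c (R n)) \<longlonglongrightarrow> L * coef v k"
      using k by (simp add: L_def)
    moreover have "(\<lambda>n. coef v k * of_real (R n) ^ deg k) \<longlonglongrightarrow> coef v k * of_real 1 ^ deg k"
      by (intro tendsto_intros R)
    ultimately have "(\<lambda>n. coef v k * of_real (R n) ^ deg k * c (R n) / (coef v k * of_real (R n) ^ deg k)) \<longlonglongrightarrow>
        L * coef v k / (coef v k * of_real 1 ^ deg k)"
      using k by (intro tendsto_divide) auto
    moreover have "R n \<noteq> 0" for n using R(2)[of n] b(1) by linarith
    ultimately show "(\<lambda>n. c (R n)) \<longlonglongrightarrow> L" using k by simp
  qed
  have L1: "cmod L = 1"
    using tendsto_unique[OF _ tendsto_norm[OF cL] cn] by simp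
  then have "L \<noteq> 0" by auto
  show limV: "AE z in torus_measure. unimodular_limit (hardy_of v) z"
    using FG
  proof eventually_elim
    case (elim z)
    have "((\<lambda>r. F r z / c r) \<longlongrightarrow> G z / L) (at_left 1)"
      using elim cL \<open>L \<noteq> 0\<close> by (intro tendsto_divide) auto
    moreover have "\<forall>\<^sub>F r in at_left 1. F r z / c r = V (r *\<^sub>R z)"
      using tendsto_imp_eventually_ne[OF cL \<open>L \<noteq> 0\<close>] by eventually_elim (simp add: F_def)
    ultimately have "((\<lambda>r. V (r *\<^sub>R z)) \<longlongrightarrow> G z / L) (at_left 1)" by (rule Lim_transform_eventually)
    then show ?case using elim L1 by (auto simp: unimodular_limit_def V_def norm_divide)
  qed
  show limU: "AE z in torus_measure. unimodular_limit (hardy_of u) z"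
    using AE_good
  proof eventually_elim
    case (elim z)
    from elim limV have "AE z' in torus_measure. good z z' \<and> unimodular_limit V z'"
      by eventually_elim (simp add: V_def)
    then obtain z' where z': "good z z'" "unimodular_limit V z'" using exists_AE by blast
    obtain w where w: "((\<lambda>r. V (r *\<^sub>R z') / U (r *\<^sub>R z)) \<longlongrightarrow> w) (at_left 1)" "cmod w = 1"
      using ratio[OF z'(1)] by blast
    obtain w' where w': "((\<lambda>r. V (r *\<^sub>R z')) \<longlongrightarrow> w') (at_left 1)" "cmod w' = 1"
      using z'(2) by (auto simp: unimodular_limit_def)
    have ne: "w \<noteq> 0" "w' \<noteq> 0" using w w' by auto
    have "((\<lambda>r. V (r *\<^sub>R z') / (V (r *\<^sub>R z') / U (r *\<^sub>R z))) \<longlongrightarrow> w' / w) (at_left 1)"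
      using w(1) w'(1) ne by (intro tendsto_divide)
    moreover have "\<forall>\<^sub>F r in at_left 1. V (r *\<^sub>R z') / (V (r *\<^sub>R z') / U (r *\<^sub>R z)) = U (r *\<^sub>R z)"
      using tendsto_imp_eventually_ne[OF w'(1) ne(2)] by eventually_elim simp
    ultimately have "((\<lambda>r. U (r *\<^sub>R z)) \<longlongrightarrow> w' / w) (at_left 1)" by (rule Lim_transform_eventually)
    then show ?case using w(2) w'(2) by (auto simp: unimodular_limit_def U_def norm_divide)
  qed
  show "AE z in torus_measure. unimodular_limit (hardy_of s) z"
    using limU lim_us
  proof eventually_elim
    case (elim z)
    obtain w where w: "((\<lambda>r. U (r *\<^sub>R z)) \<longlongrightarrow> w) (at_left 1)" "cmod w = 1"
      using elim by (auto simp: unimodular_limit_def U_def)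
    obtain w' where w': "((\<lambda>r. P (r *\<^sub>R z)) \<longlongrightarrow> w') (at_left 1)" "cmod w' = 1"
      using elim by (auto simp: unimodular_limit_def P_def)
    have "w \<noteq> 0" using w by auto
    have "((\<lambda>r. P (r *\<^sub>R z) / U (r *\<^sub>R z)) \<longlongrightarrow> w' / w) (at_left 1)"
      using w(1) w'(1) \<open>w \<noteq> 0\<close> by (intro tendsto_divide)
    moreover have "\<forall>\<^sub>F r in at_left 1. P (r *\<^sub>R z) / U (r *\<^sub>R z) = S (r *\<^sub>R z)"
      using tendsto_imp_eventually_ne[OF w(1) \<open>w \<noteq> 0\<close>] by eventually_elim (simp add: PU)
    ultimately have "((\<lambda>r. S (r *\<^sub>R z)) \<longlongrightarrow> w' / w) (at_left 1)" by (rule Lim_transform_eventually)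
    then show ?case using w(2) w'(2) by (auto simp: unimodular_limit_def S_def norm_divide)
  qed
qed

section \<open>Truncated Toeplitz operators on the polydisc\<close>

text \<open>The isomorphism \<open>hardy_of\<close> carries the model space, its projection and the truncated Toeplitz operator over to
  their counterparts for the symbols, so that the abstract characterization applies.\<close>

lemma partial_isometry_iff_commute:
  fixes \<phi>1 \<phi>2 :: "complex ^ 'n::finite \<Rightarrow> complex"
  assumes symbol1: "uni p" "supp_in nonneg_cone p" "\<And>z. z \<in> polydisc \<Longrightarrow> \<phi>1 z = hardy_of p z"
    and symbol2: "uni q" "supp_in nonneg_cone q" "\<And>z. z \<in> polydisc \<Longrightarrow> \<phi>2 z = hardy_of q z"
  shows "partial_isometry_on (model_space \<phi>1) (truncated_toeplitz \<phi>1 \<phi>2) \<longleftrightarrow>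
    (\<forall>f. mult_proj nonneg_cone p (mult_proj nonneg_cone q f) = mult_proj nonneg_cone q (mult_proj nonneg_cone p f))"
proof -
  interpret truncated_symbols nonneg_cone p q
    using symbol1(1,2) symbol2(1,2) nonneg_cone_add by unfold_locales auto
  have mult: "(\<lambda>z. \<phi>1 z * hardy_of b z) = hardy_of (conv p b)" "(\<lambda>z. \<phi>2 z * hardy_of b z) = hardy_of (conv q b)"
    if "supp_in nonneg_cone b" for b
  proof -
    have "\<phi>1 z * hardy_of b z = hardy_of (conv p b) z \<and> \<phi>2 z * hardy_of b z = hardy_of (conv q b) z" for z
      using that p symbol1(3)[of z] q symbol2(3)[of z]
      by (cases "z \<in> polydisc") (auto simp: hardy_of_conv hardy_of_outside)
    then show "(\<lambda>z. \<phi>1 z * hardy_of b z) = hardy_of (conv p b)" "(\<lambda>z. \<phi>2 z * hardy_of b z) = hardy_of (conv q b)"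
      by auto
  qed
  have in_model: "hardy_of a \<in> model_space \<phi>1 \<longleftrightarrow> a \<in> model" if a: "supp_in nonneg_cone a" for a
  proof -
    have "hardy_of a \<in> model_space \<phi>1 \<longleftrightarrow> (\<forall>b. supp_in nonneg_cone b \<longrightarrow> cinner a (conv p b) = 0)"
      using a hardy_of_in_hardy2(1)[OF a]
      by (auto simp: model_space_def hardy2_eq mult hardy_inner_hardy_of supp_conv_symbol)
    also have "\<dots> \<longleftrightarrow> restr nonneg_cone (conv (sharp p) a) = 0"
    proof
      assume *: "\<forall>b. supp_in nonneg_cone b \<longrightarrow> cinner a (conv p b) = 0"
      show "restr nonneg_cone (conv (sharp p) a) = 0"
      proof (rule ell2_eqI)
        fix x
        show "coef (restr nonneg_cone (conv (sharp p) a)) x = coef 0 x"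
          using *[rule_format, of "delta x"] p(1) by (simp add: cinner_conv_right)
      qed
    next
      assume *: "restr nonneg_cone (conv (sharp p) a) = 0"
      show "\<forall>b. supp_in nonneg_cone b \<longrightarrow> cinner a (conv p b) = 0"
      proof (intro allI impI)
        fix b :: "('n \<Rightarrow> int) ell2" assume "supp_in nonneg_cone b"
        then have "cinner a (conv p b) = cinner (conv (sharp p) a) (restr nonneg_cone b)"
          using p(1) by (simp add: cinner_conv_right)
        also have "\<dots> = 0" using * by (simp add: cinner_simps flip: cinner_restr)
        finally show "cinner a (conv p b) = 0" .
      qed
    qed
    finally show ?thesis using a by (simp add: model_def)
  qed
  have supp: "supp_in nonneg_cone a" if "a \<in> model" for a using that by (simp add: model_def)
  have space: "model_space \<phi>1 = hardy_of ` model"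
  proof (intro set_eqI iffI)
    fix f assume f: "f \<in> model_space \<phi>1"
    then have "f \<in> hardy2" by (simp add: model_space_def)
    then obtain a where "supp_in nonneg_cone a" "f = hardy_of a" using hardy2_imp_hardy_of by blast
    then show "f \<in> hardy_of ` model" using in_model f by blast
  qed (use in_model supp in blast)
  have T: "truncated_toeplitz \<phi>1 \<phi>2 (hardy_of a) = hardy_of (compr a)" if a: "a \<in> model" for a
  proof -
    have eq: "(\<lambda>z. \<phi>2 z * hardy_of a z - hardy_of b z) = hardy_of (conv q a - b)" for b
      using fun_cong[OF mult(2)[OF supp[OF a]]] by (auto simp: hardy_of_linear)
    have inner_eq: "hardy_inner (\<lambda>z. \<phi>2 z * hardy_of a z - hardy_of b z) (hardy_of c) = cinner (conv q a - b) c"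
      if "b \<in> model" "c \<in> model" for b c
      unfolding eq using that a by (intro hardy_inner_hardy_of) (auto simp: supp supp_conv_symbol)
    have orth: "cinner (conv q a - compr a) c = 0" if "c \<in> model" for c
      using model_orth_mult_proj[OF that] by (simp add: compr_def)
    show ?thesis
      unfolding truncated_toeplitz_def hardy_projection_def
    proof (rule the_equality)
      show "hardy_of (compr a) \<in> model_space \<phi>1 \<and>
          (\<forall>s\<in>model_space \<phi>1. hardy_inner (\<lambda>z. \<phi>2 z * hardy_of a z - hardy_of (compr a) z) s = 0)"
        using a by (auto simp: space inner_eq compr_model orth)
    next
      fix g assume g: "g \<in> model_space \<phi>1 \<and>
          (\<forall>s\<in>model_space \<phi>1. hardy_inner (\<lambda>z. \<phi>2 z * hardy_of a z - g z) s = 0)"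
      then obtain b where b: "b \<in> model" "g = hardy_of b" by (auto simp: space)
      have d: "compr a - b \<in> model" using a b by (intro model_subspace compr_model)
      then have "cinner (conv q a - b) (compr a - b) = 0"
        using g b inner_eq[OF b(1) d] by (auto simp: space)
      moreover have "cinner (compr a - b) (compr a - b) =
          cinner (conv q a - b) (compr a - b) - cinner (conv q a - compr a) (compr a - b)"
        unfolding cinner_simps(3)[symmetric] by simp
      ultimately have "cinner (compr a - b) (compr a - b) = 0" using orth[OF d] by simp
      then have "compr a = b" by (simp add: cinner_self_norm)
      then show "g = hardy_of (compr a)" using b by simp
    qed
  qed
  have bounded: "bounded_operator_on (model_space \<phi>1) (truncated_toeplitz \<phi>1 \<phi>2)"
    unfolding bounded_operator_on_def
  proof (intro conjI ballI allI)
    fix f assume "f \<in> model_space \<phi>1"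
    then obtain a where a: "a \<in> model" "f = hardy_of a" by (auto simp: space)
    show "truncated_toeplitz \<phi>1 \<phi>2 f \<in> model_space \<phi>1" using a by (auto simp: space T compr_model)
    show "truncated_toeplitz \<phi>1 \<phi>2 (\<lambda>z. c * f z) = (\<lambda>z. c * truncated_toeplitz \<phi>1 \<phi>2 f z)" for c
    proof -
      have "(\<lambda>z. c * f z) = hardy_of (cscale c a)" by (simp add: a hardy_of_linear fun_eq_iff)
      then have "truncated_toeplitz \<phi>1 \<phi>2 (\<lambda>z. c * f z) = hardy_of (cscale c (compr a))"
        using a by (simp only: T model_subspace compr_linear)
      then show ?thesis unfolding a(2) T[OF a(1)] by (simp add: hardy_of_linear fun_eq_iff)
    qed
    fix g assume "g \<in> model_space \<phi>1"
    then obtain b where b: "b \<in> model" "g = hardy_of b" by (auto simp: space)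
    have "(\<lambda>z. f z + g z) = hardy_of (a + b)" by (simp add: a b hardy_of_linear fun_eq_iff)
    then have "truncated_toeplitz \<phi>1 \<phi>2 (\<lambda>z. f z + g z) = hardy_of (compr a + compr b)"
      using a b by (simp only: T model_subspace compr_linear)
    then show "truncated_toeplitz \<phi>1 \<phi>2 (\<lambda>z. f z + g z) =
        (\<lambda>z. truncated_toeplitz \<phi>1 \<phi>2 f z + truncated_toeplitz \<phi>1 \<phi>2 g z)"
      unfolding a(2) b(2) T[OF a(1)] T[OF b(1)] by (simp add: hardy_of_linear fun_eq_iff)
  next
    show "\<exists>K. \<forall>f\<in>model_space \<phi>1. hardy_norm (truncated_toeplitz \<phi>1 \<phi>2 f) \<le> K * hardy_norm f"
      by (intro exI[of _ 1]) (auto simp: space T hardy_of_in_hardy2 supp compr_model norm_compr_le)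
  qed
  have zero: "hardy_of a = (\<lambda>z. 0) \<longleftrightarrow> a = 0" if "supp_in nonneg_cone a" for a :: "('n \<Rightarrow> int) ell2"
  proof -
    have "hardy_of (0 :: ('n \<Rightarrow> int) ell2) = (\<lambda>z. 0)" using hardy_of_linear(3)[of 0 0] by auto
    then show ?thesis using hardy_of_eq_iff[OF that, of 0] by simp
  qed
  have "partial_isometry_on (model_space \<phi>1) (truncated_toeplitz \<phi>1 \<phi>2) \<longleftrightarrow>
      (\<forall>f\<in>model. (\<forall>g\<in>model. compr g = 0 \<longrightarrow> cinner f g = 0) \<longrightarrow> norm (compr f) = norm f)"
  proof -
    have "kernel_on (model_space \<phi>1) (truncated_toeplitz \<phi>1 \<phi>2) = hardy_of ` {g \<in> model. compr g = 0}"
      by (auto simp: kernel_on_def space T zero supp compr_model)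
    then have "partial_isometry_on (model_space \<phi>1) (truncated_toeplitz \<phi>1 \<phi>2) \<longleftrightarrow>
        (\<forall>f\<in>model. (\<forall>g\<in>{g \<in> model. compr g = 0}. hardy_inner (hardy_of f) (hardy_of g) = 0) \<longrightarrow>
          hardy_norm (truncated_toeplitz \<phi>1 \<phi>2 (hardy_of f)) = hardy_norm (hardy_of f))"
      using bounded by (simp add: partial_isometry_on_def space)
    then show ?thesis
      by (simp add: T supp compr_model hardy_inner_hardy_of hardy_of_in_hardy2) blast
  qed
  also have "\<dots> \<longleftrightarrow> (\<forall>f. mult_proj nonneg_cone p (mult_proj nonneg_cone q f) = mult_proj nonneg_cone q (mult_proj nonneg_cone p f))"
    using partial_isometry_imp_commute commute_imp_partial_isometry by blast
  finally show ?thesis .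
qed

theorem theorem1p5:
  fixes \<phi>1 \<phi>2 :: "complex ^ 'n \<Rightarrow> complex"
  assumes "CARD('n) > 1"
    and "inner_function \<phi>1" and "\<not> \<phi>1 constant_on polydisc"
    and "inner_function \<phi>2" and "\<not> \<phi>2 constant_on polydisc"
  shows "partial_isometry_on (model_space \<phi>1) (truncated_toeplitz \<phi>1 \<phi>2) \<longleftrightarrow>
    (\<exists>\<phi>1' \<phi>2' \<psi> :: complex ^ 'n \<Rightarrow> complex.
       inner_function \<phi>1' \<and> inner_function \<phi>2' \<and> inner_function \<psi> \<and>
       separated \<phi>1' \<phi>2' \<and>
       (\<forall>z\<in>polydisc. \<phi>1 z = \<phi>1' z * \<psi> z) \<and>
       (\<forall>z\<in>polydisc. \<phi>2 z = \<phi>2' z * \<psi> z))"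
    (is "_ \<longleftrightarrow> ?factors")
proof -
  obtain p where p: "uni p" "supp_in nonneg_cone p" "\<And>z. z \<in> polydisc \<Longrightarrow> \<phi>1 z = hardy_of p z"
    and lim_p: "AE z in torus_measure. unimodular_limit (hardy_of p) z"
    using inner_function_symbol[OF assms(2)] by blast
  obtain q where q: "uni q" "supp_in nonneg_cone q" "\<And>z. z \<in> polydisc \<Longrightarrow> \<phi>2 z = hardy_of q z"
    and lim_q: "AE z in torus_measure. unimodular_limit (hardy_of q) z"
    using inner_function_symbol[OF assms(4)] by blast
  have "?factors" if comm: "\<And>f. mult_proj nonneg_cone p (mult_proj nonneg_cone q f) = mult_proj nonneg_cone q (mult_proj nonneg_cone p f)"
  proof -
    from separated_factorization[OF p(1,2) q(1,2) comm]
    obtain J u v s where "uni u \<and> uni v \<and> uni s \<and> supp_in (nonneg_cone \<inter> {a. \<forall>i\<in>J. a i = 0}) u \<and>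
       supp_in (nonneg_cone \<inter> {a. \<forall>i. i \<notin> J \<longrightarrow> a i = 0}) v \<and> supp_in nonneg_cone s \<and>
       conv u s = p \<and> conv v s = q"
      by (elim exE)
    then have u: "uni u" "supp_in nonneg_cone u" "supp_in {a. \<forall>i\<in>J. a i = 0} u"
      and v: "uni v" "supp_in nonneg_cone v" "supp_in {a. \<forall>i\<in>-J. a i = 0} v"
      and s: "uni s" "supp_in nonneg_cone s" and us: "conv u s = p" and vs: "conv v s = q"
      by (auto elim!: supp_in_mono)
    have lims: "AE z in torus_measure. unimodular_limit (hardy_of (conv u s)) z"
      "AE z in torus_measure. unimodular_limit (hardy_of (conv v s)) z"
      using lim_p lim_q by (simp_all add: us vs)
    note radial = separated_factors_radial_limits[OF u v s lims]
    have "separated (hardy_of u) (hardy_of v)"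
      unfolding separated_def
    proof
      assume "\<exists>i. depends_on_coordinate (hardy_of u) i \<and> depends_on_coordinate (hardy_of v) i"
      then obtain i where i: "depends_on_coordinate (hardy_of u) i" "depends_on_coordinate (hardy_of v) i"
        by blast
      have "hardy_of u z = hardy_of u w" if "i \<in> J" "z \<in> polydisc" "w \<in> polydisc" "\<forall>j. j \<noteq> i \<longrightarrow> z $ j = w $ j" for z w
        using that by (intro hardy_of_coordinates[OF u(3)]) auto
      moreover have "hardy_of v z = hardy_of v w" if "i \<notin> J" "z \<in> polydisc" "w \<in> polydisc" "\<forall>j. j \<noteq> i \<longrightarrow> z $ j = w $ j" for z w
        using that by (intro hardy_of_coordinates[OF v(3)]) auto
      ultimately show False using i by (auto simp: depends_on_coordinate_def)
    qed
    moreover have "\<phi>1 z = hardy_of u z * hardy_of s z" "\<phi>2 z = hardy_of v z * hardy_of s z" if "z \<in> polydisc" for z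
      using that u v s p(3) q(3) hardy_of_conv[OF u(1,2) s(2)] hardy_of_conv[OF v(1,2) s(2)] by (simp_all add: us vs)
    ultimately show ?thesis
      using inner_function_hardy_of[OF u(1,2) radial(1)] inner_function_hardy_of[OF v(1,2) radial(2)]
        inner_function_hardy_of[OF s radial(3)]
      by (intro exI[of _ "hardy_of u"] exI[of _ "hardy_of v"] exI[of _ "hardy_of s"]) simp
  qed
  moreover have "\<forall>f. mult_proj nonneg_cone p (mult_proj nonneg_cone q f) = mult_proj nonneg_cone q (mult_proj nonneg_cone p f)"
    if factors: "?factors"
  proof -
    obtain \<phi>1' \<phi>2' \<psi> :: "complex ^ 'n \<Rightarrow> complex" where
      inn: "inner_function \<phi>1'" "inner_function \<phi>2'" "inner_function \<psi>" and sep: "separated \<phi>1' \<phi>2'"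
      and eq: "\<And>z. z \<in> polydisc \<Longrightarrow> \<phi>1 z = \<phi>1' z * \<psi> z" "\<And>z. z \<in> polydisc \<Longrightarrow> \<phi>2 z = \<phi>2' z * \<psi> z"
      using factors by blast
    obtain u where u: "uni u" "supp_in nonneg_cone u" "\<And>z. z \<in> polydisc \<Longrightarrow> \<phi>1' z = hardy_of u z"
      using inner_function_symbol[OF inn(1)] by blast
    obtain v where v: "uni v" "supp_in nonneg_cone v" "\<And>z. z \<in> polydisc \<Longrightarrow> \<phi>2' z = hardy_of v z"
      using inner_function_symbol[OF inn(2)] by blast
    obtain s where s: "uni s" "supp_in nonneg_cone s" "\<And>z. z \<in> polydisc \<Longrightarrow> \<psi> z = hardy_of s z"
      using inner_function_symbol[OF inn(3)] by blast
    have us: "p = conv u s" and vs: "q = conv v s"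
    proof -
      have "hardy_of p z = hardy_of (conv u s) z \<and> hardy_of q z = hardy_of (conv v s) z" for z
        using p(3)[of z] q(3)[of z] eq[of z] u(3)[of z] v(3)[of z] s(3)[of z] u(1,2) v(1,2) s(2)
        by (cases "z \<in> polydisc") (auto simp: hardy_of_conv hardy_of_outside)
      then have "hardy_of p = hardy_of (conv u s)" "hardy_of q = hardy_of (conv v s)" by auto
      then show "p = conv u s" "q = conv v s"
        using hardy_of_eq_iff p(2) q(2) supp_in_conv_cone u(1,2) v(1,2) s(2) by blast+
    qed
    define J where "J = {i. \<not> depends_on_coordinate \<phi>1' i}"
    have "supp_in {a. a i = 0} u" if "i \<in> J" for i
    proof (rule supp_in_independent[OF u(2)])
      fix z w :: "complex ^ 'n"
      assume "z \<in> polydisc" "w \<in> polydisc" "\<And>j. j \<noteq> i \<Longrightarrow> z $ j = w $ j"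
      moreover from this have "\<phi>1' z = \<phi>1' w"
        using that unfolding J_def depends_on_coordinate_def by blast
      ultimately show "hardy_of u z = hardy_of u w" using u(3)[of z] u(3)[of w] by simp
    qed
    then have uJ: "supp_in (nonneg_cone \<inter> {a. \<forall>i\<in>J. a i = 0}) u"
      using u(2) by (auto simp: supp_in_def)
    have "supp_in {a. a i = 0} v" if "i \<notin> J" for i
    proof (rule supp_in_independent[OF v(2)])
      fix z w :: "complex ^ 'n"
      assume "z \<in> polydisc" "w \<in> polydisc" "\<And>j. j \<noteq> i \<Longrightarrow> z $ j = w $ j"
      moreover have "\<not> depends_on_coordinate \<phi>2' i" using that sep by (auto simp: J_def separated_def)
      ultimately have "\<phi>2' z = \<phi>2' w" unfolding depends_on_coordinate_def by blast
      then show "hardy_of v z = hardy_of v w"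
        using v(3)[of z] v(3)[of w] \<open>z \<in> polydisc\<close> \<open>w \<in> polydisc\<close> by simp
    qed
    then have vJ: "supp_in (nonneg_cone \<inter> {a. \<forall>i. i \<notin> J \<longrightarrow> a i = 0}) v"
      using v(2) by (auto simp: supp_in_def)
    show ?thesis
      unfolding us vs using separated_imp_commute[OF u(1) uJ v(1) vJ s(1)] by blast
  qed
  ultimately show ?thesis
    using partial_isometry_iff_commute[OF p q] by blast
qed

end
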